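(* Let $J$ be a periodic Jacobi operator on $\ell^2(\mathbb{N})$ with minimal period $q\geq 1$, and let $P_{\rm c}$ be the projection onto its continuous spectrum. Let $I_1,\dots,I_q$ be the bands of $J$ and $k_j:[-\pi,0]\to I_j$ ($1\le j\le q$) the associated phase functions. (1) Suppose that for each $1\leq j \leq q$ and every $\varphi \in [-\pi,0]$, if $k''_j(\varphi)=0$ then $k'''_j(\varphi)\neq 0$. Then there exists a constant $C>0$ (depending only on $J$) such that for all $t>0$ and all $u\in\ell^1(\mathbb{N})$, $$\|e^{-itJ}P_{\rm c}u\|_{\ell^{\infty}} \leq C\,t^{-1/3}\,\|u\|_{\ell^1}.$$ (2) Let $q\geq 2$ be even, and suppose that $\sigma_{\rm c}(J)$, the continuous spectrum of $J$, consists of exactly $q$ disjoint intervals $I_1,\ldots , I_q$ (with no conditions on the phase functions $k_j$). Then there exists a constant $C>0$ (depending only on $J$) such that for all $t>0$ and all $u\in\ell^1(\mathbb{N})$, $$\|e^{-itJ}P_{\rm c}u\|_{\ell^{\infty}} \leq C\,t^{-1/(q+1)}\,\|u\|_{\ell^1}.$$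
   Context: $\mathbb{N}=\{1,2,3,\dots\}$. A periodic Jacobi operator $J$ of minimal period $q\ge 1$ on $\ell^2(\mathbb{N})$ is the bounded self-adjoint operator given by $(Jv)_1=b_1v_1+a_1v_2$ and $(Jv)_n=a_{n-1}v_{n-1}+b_nv_n+a_nv_{n+1}$ for $n\ge 2$, where $a_n>0$ and $b_n\in\mathbb{R}$ satisfy $a_{n+q}=a_n$ and $b_{n+q}=b_n$ for all $n\in\mathbb{N}$, and $q$ is the smallest positive integer with this property. $P_{\rm c}$ is the orthogonal projection of $\ell^2(\mathbb{N})$ onto the subspace associated with the continuous part of the spectrum of $J$ (i.e. the orthogonal complement of the closed span of the $\ell^2$-eigenvectors of $J$). Monodromy matrix and discriminant: for $a>0$, $b\in\mathbb{R}$, $x\in\mathbb{C}$ put $A(a,b,x)=\frac1a\begin{pmatrix} x-b & -1\\ a^2 & 0\end{pmatrix}$, $T_q(x)=A(a_q,b_q,x)\cdots A(a_1,b_1,x)$ and $\Delta(x)=\mathrm{Trace}(T_q(x))$, a real polynomial of degree $q$. Bands: the continuous spectrum is $\sigma_{\rm c}(J)=\Delta^{-1}([-2,2])=\bigcup_{j=1}^q I_j$, with $I_j=[\lambda_{2j-1},\lambda_{2j}]$, $\lambda_1<\lambda_2\le\lambda_3<\lambda_4\le\cdots\le\lambda_{2q-1}<\lambda_{2q}$, where $\Delta(\lambda_i)^2=4$ for all $i$ and $\Delta$ maps each $I_j$ strictly monotonically onto $[-2,2]$. Phase functions: for $1\le j\le q$, $k_j:[-\pi,0]\to I_j$ is the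 function defined by $k_j(\varphi)=(\Delta|_{I_j})^{-1}(2\cos\varphi)$; equivalently, $k_j$ is the inverse of $\Theta|_{I_j}$, where $\Theta:\sigma_{\rm c}(J)\to[-\pi,0]$ is determined by $\Delta(x)=2\cos\Theta(x)$. Derivatives at the endpoints of $[-\pi,0]$ are one-sided. Norms: $\|u\|_{\ell^1}=\sum_{n\ge1}|u_n|$, $\|u\|_{\ell^\infty}=\sup_{n\ge1}|u_n|$. *)

theory Defs
  imports "HOL-Analysis.Analysis"
begin

(* All sequences are indexed from 0: the entry u n stands for u_{n+1} of the usual
   notation on {1,2,3,...}.  In the same way a n, b n stand for a_{n+1}, b_{n+1}. *)

section \<open>Sequence spaces\<close>

definition ell1 :: "(nat \<Rightarrow> complex) set" where
  "ell1 = {u. summable (\<lambda>n. cmod (u n))}"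

definition ell1_norm :: "(nat \<Rightarrow> complex) \<Rightarrow> real" where
  "ell1_norm u = (\<Sum>n. cmod (u n))"

(* Extended-real valued, hence infinite on unbounded sequences. *)
definition ellinf_norm :: "(nat \<Rightarrow> complex) \<Rightarrow> ereal" where
  "ellinf_norm u = (SUP n. ereal (cmod (u n)))"

definition ell2 :: "(nat \<Rightarrow> complex) set" where
  "ell2 = {v. summable (\<lambda>n. (cmod (v n))\<^sup>2)}"

definition ell2_norm :: "(nat \<Rightarrow> complex) \<Rightarrow> real" where
  "ell2_norm v = sqrt (\<Sum>n. (cmod (v n))\<^sup>2)"

definition ell2_inner :: "(nat \<Rightarrow> complex) \<Rightarrow> (nat \<Rightarrow> complex) \<Rightarrow> complex" where
  "ell2_inner v w = (\<Sum>n. cnj (v n) * w n)"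

definition lin_span :: "(nat \<Rightarrow> complex) set \<Rightarrow> (nat \<Rightarrow> complex) set" where
  "lin_span S = {v. \<exists>F c. finite F \<and> F \<subseteq> S \<and> v = (\<lambda>n. \<Sum>w\<in>F. c w * w n)}"

definition closed_span :: "(nat \<Rightarrow> complex) set \<Rightarrow> (nat \<Rightarrow> complex) set" where
  "closed_span S =
     {v \<in> ell2. \<forall>e>0. \<exists>w \<in> lin_span S. ell2_norm (\<lambda>n. v n - w n) < e}"

definition orth_compl :: "(nat \<Rightarrow> complex) set \<Rightarrow> (nat \<Rightarrow> complex) set" where
  "orth_compl S = {v \<in> ell2. \<forall>w\<in>S. ell2_inner w v = 0}"

definition orth_proj :: "(nat \<Rightarrow> complex) set \<Rightarrow> (nat \<Rightarrow> complex) \<Rightarrow> (nat \<Rightarrow> complex)" where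
  "orth_proj S v = (THE w. w \<in> S \<and> (\<forall>s\<in>S. ell2_inner s (\<lambda>n. v n - w n) = 0))"

section \<open>Operators\<close>

(* For a bounded operator T the exponential series of z T converges in operator norm,
   so its values on ell2 are given by the coordinatewise sums below. *)
definition exp_op ::
  "complex \<Rightarrow> ((nat \<Rightarrow> complex) \<Rightarrow> (nat \<Rightarrow> complex)) \<Rightarrow> (nat \<Rightarrow> complex) \<Rightarrow> (nat \<Rightarrow> complex)" where
  "exp_op z T v = (\<lambda>n. \<Sum>k. z ^ k / fact k * ((T ^^ k) v) n)"

definition eigenvectors :: "((nat \<Rightarrow> complex) \<Rightarrow> (nat \<Rightarrow> complex)) \<Rightarrow> (nat \<Rightarrow> complex) set" where
  "eigenvectors T = {v \<in> ell2. v \<noteq> (\<lambda>n. 0) \<and> (\<exists>z. T v = (\<lambda>n. z * v n))}"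

definition cont_subspace :: "((nat \<Rightarrow> complex) \<Rightarrow> (nat \<Rightarrow> complex)) \<Rightarrow> (nat \<Rightarrow> complex) set" where
  "cont_subspace T = orth_compl (closed_span (eigenvectors T))"

definition cont_proj ::
  "((nat \<Rightarrow> complex) \<Rightarrow> (nat \<Rightarrow> complex)) \<Rightarrow> (nat \<Rightarrow> complex) \<Rightarrow> (nat \<Rightarrow> complex)" where
  "cont_proj T = orth_proj (cont_subspace T)"

(* The spectrum of the restriction of the bounded self-adjoint operator T to its continuous
   subspace; a bijective bounded operator on a Hilbert space has a bounded inverse. *)
definition cont_spectrum :: "((nat \<Rightarrow> complex) \<Rightarrow> (nat \<Rightarrow> complex)) \<Rightarrow> complex set" where
  "cont_spectrum T =
     {z. \<not> bij_betw (\<lambda>v n. T v n - z * v n) (cont_subspace T) (cont_subspace T)}"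

section \<open>Periodic Jacobi operators\<close>

fun jacobi :: "(nat \<Rightarrow> real) \<Rightarrow> (nat \<Rightarrow> real) \<Rightarrow> (nat \<Rightarrow> complex) \<Rightarrow> nat \<Rightarrow> complex" where
  "jacobi a b v 0 = b 0 * v 0 + a 0 * v 1"
| "jacobi a b v (Suc n) = a n * v n + b (Suc n) * v (Suc n) + a (Suc n) * v (Suc (Suc n))"

definition is_period :: "(nat \<Rightarrow> real) \<Rightarrow> (nat \<Rightarrow> real) \<Rightarrow> nat \<Rightarrow> bool" where
  "is_period a b p \<longleftrightarrow> 1 \<le> p \<and> (\<forall>n. a (n + p) = a n \<and> b (n + p) = b n)"

definition periodic_jacobi :: "(nat \<Rightarrow> real) \<Rightarrow> (nat \<Rightarrow> real) \<Rightarrow> nat \<Rightarrow> bool" where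
  "periodic_jacobi a b q \<longleftrightarrow>
     (\<forall>n. 0 < a n) \<and> is_period a b q \<and> (\<forall>p. is_period a b p \<longrightarrow> q \<le> p)"

section \<open>Discriminant, bands and phase functions\<close>

definition transfer_matrix :: "real \<Rightarrow> real \<Rightarrow> 'x::real_normed_field \<Rightarrow> 'x ^ 2 ^ 2" where
  "transfer_matrix a b x =
     (1 / a) *\<^sub>R vector [vector [x - of_real b, - 1], vector [of_real (a\<^sup>2), 0]]"

primrec monodromy ::
  "(nat \<Rightarrow> real) \<Rightarrow> (nat \<Rightarrow> real) \<Rightarrow> nat \<Rightarrow> 'x::real_normed_field \<Rightarrow> 'x ^ 2 ^ 2" where
  "monodromy a b 0 x = mat 1"
| "monodromy a b (Suc n) x = transfer_matrix (a n) (b n) x ** monodromy a b n x"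

definition discriminant ::
  "(nat \<Rightarrow> real) \<Rightarrow> (nat \<Rightarrow> real) \<Rightarrow> nat \<Rightarrow> 'x::real_normed_field \<Rightarrow> 'x" where
  "discriminant a b q x = trace (monodromy a b q x)"

(* The list l is [lambda_1, ..., lambda_{2q}], so that for j < q the (j+1)-st band is
   [l ! (2 j), l ! (2 j + 1)]. *)
definition is_band_edges :: "(nat \<Rightarrow> real) \<Rightarrow> (nat \<Rightarrow> real) \<Rightarrow> nat \<Rightarrow> real list \<Rightarrow> bool" where
  "is_band_edges a b q l \<longleftrightarrow>
     length l = 2 * q \<and>
     (\<forall>j<q. l ! (2 * j) < l ! (2 * j + 1)) \<and>
     (\<forall>j. Suc j < q \<longrightarrow> l ! (2 * j + 1) \<le> l ! (2 * Suc j)) \<and>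
     (\<forall>x\<in>set l. (discriminant a b q x)\<^sup>2 = 4) \<and>
     discriminant a b q -` {-2..2} = (\<Union>j<q. {l ! (2 * j)..l ! (2 * j + 1)}) \<and>
     (\<forall>j<q. let I = {l ! (2 * j)..l ! (2 * j + 1)} in
        (strict_mono_on I (discriminant a b q) \<or> strict_antimono_on I (discriminant a b q)) \<and>
        discriminant a b q ` I = {-2..2})"

(* Existence is classical Floquet theory; uniqueness holds because the open bands are the
   connected components of the set where the absolute value of the discriminant is below 2. *)
definition band_edges :: "(nat \<Rightarrow> real) \<Rightarrow> (nat \<Rightarrow> real) \<Rightarrow> nat \<Rightarrow> real list" where
  "band_edges a b q = (THE l. is_band_edges a b q l)"

definition band :: "(nat \<Rightarrow> real) \<Rightarrow> (nat \<Rightarrow> real) \<Rightarrow> nat \<Rightarrow> nat \<Rightarrow> real set" where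
  "band a b q j = {band_edges a b q ! (2 * j)..band_edges a b q ! (2 * j + 1)}"

definition phase_fun :: "(nat \<Rightarrow> real) \<Rightarrow> (nat \<Rightarrow> real) \<Rightarrow> nat \<Rightarrow> nat \<Rightarrow> real \<Rightarrow> real" where
  "phase_fun a b q j \<phi> = the_inv_into (band a b q j) (discriminant a b q) (2 * cos \<phi>)"

(* Derivative relative to S; on a compact interval it is one-sided at the endpoints. *)
definition deriv_within :: "real set \<Rightarrow> (real \<Rightarrow> real) \<Rightarrow> real \<Rightarrow> real" where
  "deriv_within S f x = vector_derivative f (at x within S)"

end

theory Submission
  imports Defs "HOL-Complex_Analysis.Complex_Analysis"
    "HOL-Computational_Algebra.Fundamental_Theorem_Algebra"
begin

text \<open>
  Let \<open>P n\<close> be the orthonormal polynomials of \<open>J\<close>, \<open>V n = a (n - 1) * P (n - 1)\<close>, and let \<open>D\<close> be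
  the discriminant. If \<open>D x = 2 * cos \<phi>\<close>, then \<open>P (n + 2 * q) = D * P (n + q) - P n\<close> shows that
  \<open>sin \<phi> * P (l * q + r)\<close> is the imaginary part of \<open>exp (\<i> l \<phi>) * g r\<close>, where
  \<open>g r = P (q + r) - exp (- \<i> \<phi>) * P r\<close>. On the bands the polynomial \<open>W = V q * D'\<close> equals the sum of
  the \<open>\<bar>g r\<bar>\<^sup>2\<close> over \<open>r < q\<close>; this yields the band structure and the nondegeneracy of \<open>D\<close> at
  closed gaps.

  The zeros of \<open>V (N * q)\<close> are those of \<open>V q\<close> together with the points of the bands whose phase is a
  multiple of \<open>pi / N\<close>. Gauss quadrature at these zeros is a Riemann sum in \<open>\<phi>\<close>, and its limit is the
  resolution of the identity, with density \<open>2 * (sin \<phi>)\<^sup>2 / (pi * W)\<close> in \<open>\<phi>\<close> and point masses at the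
  eigenvalues. Hence the matrix elements of the evolution on the continuous subspace are finite sums of
  integrals of \<open>exp (\<i> (L \<phi> - t k \<phi>)) * g r * g r' / W\<close>, up to conjugating factors \<open>g\<close>, where \<open>k\<close> is
  a phase function. The amplitudes are bounded by \<open>1\<close> and therefore continue holomorphically even to
  the band edges where \<open>W\<close> vanishes, and the lemma of van der Corput is uniform in the linear phase.
\<close>

section \<open>Solutions of the Jacobi recursion\<close>

text \<open>The exponential is a coordinatewise power series and the projection is defined by
  orthogonality, so everything is reduced to explicit kernels: finitely many eigenvectors give the
  projection, the three-term recursion turns powers of \<open>J\<close> into powers of
  \<open>x\<close> under the integral, and uniform approximation on the bands leads from monomials
  to the exponential. The obstacle is a constant uniform in both matrix indices. In
  \<open>n = l * q + r\<close> the unbounded part \<open>l\<close> enters only the frequency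
  \<open>L\<close>, which leaves finitely many amplitudes, labelled by bands, residues and signs. As
  \<open>L\<close> can cancel any first derivative, some derivative of order at least two has to be
  nonzero at every phase; the largest order \<open>M\<close> that is needed gives the rate
  \<open>t powr (- 1 / M)\<close>. It is 3 by hypothesis in one half of the theorem and
  \<open>q + 1\<close> in the other, where \<open>D\<close> has degree \<open>q\<close>. A closed
  gap is the delicate point: \<open>D\<close> has no local inverse there, yet each of the two phases
  that meet in it is analytic. Oscillation is exploited for \<open>t \<ge> 1\<close> only, since
  boundedness of the kernels settles smaller times.\<close>

locale jacobi_coeffs =
  fixes a b :: "nat \<Rightarrow> real"
  assumes a_pos [simp]: "0 < a n"
begin

lemma a_nonzero [simp]: "a n \<noteq> 0"
  using a_pos[of n] by linarith

text \<open>The pair \<open>sol_poly f g n\<close> is \<open>(v n, a (n - 1) * v (n - 1))\<close> for the solution \<open>v\<close> with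
  initial data \<open>(f, g)\<close>, so that each step is one transfer matrix.\<close>

primrec sol_poly :: "'x::real_normed_field poly \<Rightarrow> 'x poly \<Rightarrow> nat \<Rightarrow> 'x poly \<times> 'x poly" where
  "sol_poly f g 0 = (f, g)"
| "sol_poly f g (Suc n) =
     (smult (of_real (1 / a n)) ([:- of_real (b n), 1:] * fst (sol_poly f g n) - snd (sol_poly f g n)),
      smult (of_real (a n)) (fst (sol_poly f g n)))"

text \<open>The two columns of the product of the first \<open>n\<close> transfer matrices, kept as
  polynomials over an arbitrary real normed field: the bands live on the real line, the continuation
  of the phases in the plane.\<close>

definition P_poly :: "nat \<Rightarrow> 'x::real_normed_field poly" where "P_poly n = fst (sol_poly 1 0 n)"
definition V_poly :: "nat \<Rightarrow> 'x::real_normed_field poly" where "V_poly n = snd (sol_poly 1 0 n)"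
definition R_poly :: "nat \<Rightarrow> 'x::real_normed_field poly" where "R_poly n = fst (sol_poly 0 1 n)"
definition S_poly :: "nat \<Rightarrow> 'x::real_normed_field poly" where "S_poly n = snd (sol_poly 0 1 n)"

abbreviation P :: "nat \<Rightarrow> 'x::real_normed_field \<Rightarrow> 'x" where "P n \<equiv> poly (P_poly n)"
abbreviation V :: "nat \<Rightarrow> 'x::real_normed_field \<Rightarrow> 'x" where "V n \<equiv> poly (V_poly n)"
abbreviation R :: "nat \<Rightarrow> 'x::real_normed_field \<Rightarrow> 'x" where "R n \<equiv> poly (R_poly n)"
abbreviation S :: "nat \<Rightarrow> 'x::real_normed_field \<Rightarrow> 'x" where "S n \<equiv> poly (S_poly n)"
abbreviation P' :: "nat \<Rightarrow> 'x::real_normed_field \<Rightarrow> 'x" where "P' n \<equiv> poly (pderiv (P_poly n))"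
abbreviation V' :: "nat \<Rightarrow> 'x::real_normed_field \<Rightarrow> 'x" where "V' n \<equiv> poly (pderiv (V_poly n))"
abbreviation R' :: "nat \<Rightarrow> 'x::real_normed_field \<Rightarrow> 'x" where "R' n \<equiv> poly (pderiv (R_poly n))"
abbreviation S' :: "nat \<Rightarrow> 'x::real_normed_field \<Rightarrow> 'x" where "S' n \<equiv> poly (pderiv (S_poly n))"

lemma sol_0 [simp]:
  "P_poly 0 = 1" "V_poly 0 = 0" "R_poly 0 = 0" "S_poly 0 = 1"
  by (simp_all add: P_poly_def V_poly_def R_poly_def S_poly_def)

lemma sol_Suc:
  "P_poly (Suc n) = smult (of_real (1 / a n)) ([:- of_real (b n), 1:] * P_poly n - V_poly n)"
  "V_poly (Suc n) = smult (of_real (a n)) (P_poly n)"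
  "R_poly (Suc n) = smult (of_real (1 / a n)) ([:- of_real (b n), 1:] * R_poly n - S_poly n)"
  "S_poly (Suc n) = smult (of_real (a n)) (R_poly n)"
  by (simp_all add: P_poly_def V_poly_def R_poly_def S_poly_def)

lemma eval_Suc:
  "P (Suc n) x = ((x - of_real (b n)) * P n x - V n x) / of_real (a n)"
  "V (Suc n) x = of_real (a n) * P n x"
  "R (Suc n) x = ((x - of_real (b n)) * R n x - S n x) / of_real (a n)"
  "S (Suc n) x = of_real (a n) * R n x"
  unfolding sol_Suc by (simp_all add: field_simps)

lemma deriv_Suc:
  "P' (Suc n) x = (P n x + (x - of_real (b n)) * P' n x - V' n x) / of_real (a n)"
  "V' (Suc n) x = of_real (a n) * P' n x"
  "R' (Suc n) x = (R n x + (x - of_real (b n)) * R' n x - S' n x) / of_real (a n)"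
  "S' (Suc n) x = of_real (a n) * R' n x"
proof -
  have *: "pderiv ([:- of_real (b n), 1:] * f - g) = f + [:- of_real (b n), 1:] * pderiv f - pderiv g"
    for f g :: "'a poly"
    by (simp only: pderiv_diff pderiv_mult) (simp add: pderiv_pCons)
  show "P' (Suc n) x = (P n x + (x - of_real (b n)) * P' n x - V' n x) / of_real (a n)"
    "R' (Suc n) x = (R n x + (x - of_real (b n)) * R' n x - S' n x) / of_real (a n)"
    unfolding sol_Suc pderiv_smult * by (simp_all add: field_simps)
  show "V' (Suc n) x = of_real (a n) * P' n x" "S' (Suc n) x = of_real (a n) * R' n x"
    unfolding sol_Suc pderiv_smult by simp_all
qed

lemma eval_of_real:
  fixes x :: real
  shows "P n (of_real x :: 'x::real_normed_field) = of_real (P n x) \<and>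
    V n (of_real x :: 'x) = of_real (V n x) \<and>
    R n (of_real x :: 'x) = of_real (R n x) \<and> S n (of_real x :: 'x) = of_real (S n x)"
  by (induction n) (auto simp: eval_Suc)

lemma eval_cnj: "P n (cnj x) = cnj (P n x) \<and> V n (cnj x) = cnj (V n x)"
  by (induction n) (simp_all add: eval_Suc)

lemma three_term:
  "x * P n x = V n x + of_real (b n) * P n x + of_real (a n) * P (Suc n) x"
  by (simp add: eval_Suc field_simps)

text \<open>Telescoping by the recursion. The uses differ in the choice of points: a zero and its
  conjugate (reality), two zeros (orthogonality of the quadrature vectors), two eigenvalues as
  \<open>n\<close> grows (orthogonality of eigenvectors).\<close>

lemma christoffel_darboux:
  "(x - y) * (\<Sum>k<n. P k x * P k y) = P n x * V n y - V n x * P n y"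
proof (induction n)
  case (Suc n)
  have "P (Suc n) x * V (Suc n) y - V (Suc n) x * P (Suc n) y
      = (x - y) * (P n x * P n y) + (P n x * V n y - V n x * P n y)"
    by (simp add: eval_Suc) (simp add: field_simps)
  then show ?case using Suc by (simp add: distrib_left)
qed simp

text \<open>Every transfer matrix has determinant one.\<close>

lemma wronskian: "P n x * S n x - R n x * V n x = 1"
proof (induction n)
  case (Suc n)
  have "P (Suc n) x * S (Suc n) x - R (Suc n) x * V (Suc n) x = P n x * S n x - R n x * V n x"
    by (simp add: eval_Suc) (simp add: field_simps)
  then show ?case using Suc by simp
qed simp

text \<open>Confluent Christoffel-Darboux identities for all pairs of columns. As the determinant is
  one, the four of them can be solved for the derivative of the matrix; see
  \<open>pderiv_monodromy\<close>.\<close>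

lemma deriv_wronskian:
  "P n x * V' n x - V n x * P' n x = - (\<Sum>k<n. (P k x)\<^sup>2)"
  "P n x * S' n x - V n x * R' n x = - (\<Sum>k<n. P k x * R k x)"
  "R n x * V' n x - S n x * P' n x = - (\<Sum>k<n. P k x * R k x)"
  "R n x * S' n x - S n x * R' n x = - (\<Sum>k<n. (R k x)\<^sup>2)"
proof (induction n)
  case (Suc n)
  { case 1 show ?case using Suc(1) by (simp add: eval_Suc deriv_Suc) (simp add: field_simps power2_eq_square) }
  { case 2 show ?case using Suc(2) by (simp add: eval_Suc deriv_Suc) (simp add: field_simps power2_eq_square) }
  { case 3 show ?case using Suc(3) by (simp add: eval_Suc deriv_Suc) (simp add: field_simps power2_eq_square) }
  { case 4 show ?case using Suc(4) by (simp add: eval_Suc deriv_Suc) (simp add: field_simps power2_eq_square) }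
qed simp_all

lemma degree_sol:
  "degree (P_poly n :: 'x::real_normed_field poly) = n \<and>
   lead_coeff (P_poly n :: 'x poly) = of_real (inverse (\<Prod>k<n. a k))"
proof (induction n rule: less_induct)
  case (less n)
  show ?case
  proof (cases n)
    case (Suc m)
    let ?p = "[:- of_real (b m), 1:] * P_poly m :: 'x poly"
    have IH: "degree (P_poly m :: 'x poly) = m"
        "lead_coeff (P_poly m :: 'x poly) = of_real (inverse (\<Prod>k<m. a k))"
      using less[of m] Suc by auto
    have nz: "P_poly m \<noteq> (0 :: 'x poly)"
      using IH(2) by (auto simp: prod_zero_iff)
    have dp: "degree ?p = Suc m"
      by (subst degree_mult_eq) (use nz IH in auto)
    have lp: "coeff ?p (Suc m) = of_real (inverse (\<Prod>k<m. a k))"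
      using lead_coeff_mult[of "[:- of_real (b m), 1:]" "P_poly m :: 'x poly"] dp IH by simp
    have dV: "degree (V_poly m :: 'x poly) < Suc m"
    proof (cases m)
      case (Suc l)
      then show ?thesis using less[of l] \<open>n = Suc m\<close>
        by (auto simp: sol_Suc intro!: le_less_trans[OF degree_smult_le])
    qed simp
    have d: "degree (?p - V_poly m) = Suc m"
      using dp dV by (metis degree_add_eq_left degree_minus diff_conv_add_uminus)
    have c: "coeff (?p - V_poly m) (Suc m) = of_real (inverse (\<Prod>k<m. a k))"
      using lp dV by (simp add: coeff_eq_0)
    show ?thesis
      using d c Suc by (simp add: sol_Suc(1) del: mult_pCons_left) (simp add: field_simps)
  qed simp
qed

lemma degree_R_Suc: "degree (R_poly (Suc n) :: 'x::real_normed_field poly) \<le> n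
    \<and> degree (R_poly n :: 'x poly) \<le> n"
proof (induction n rule: less_induct)
  case (less n)
  show ?case
  proof (cases n)
    case 0
    then show ?thesis by (simp add: sol_Suc)
  next
    case (Suc m)
    have R: "degree (R_poly (Suc m) :: 'x poly) \<le> m" using less[of m] Suc by auto
    have Rm: "degree (R_poly m :: 'x poly) \<le> m" using less[of m] Suc by auto
    have 1: "degree ([:- of_real (b (Suc m)), 1:] * R_poly (Suc m) :: 'x poly) \<le> Suc m"
      by (rule order_trans[OF degree_mult_le]) (use R in simp)
    have 2: "degree (S_poly (Suc m) :: 'x poly) \<le> Suc m"
      using Rm by (simp add: sol_Suc)
    have "degree (R_poly (Suc (Suc m)) :: 'x poly) \<le> Suc m"
      using degree_diff_le[OF 1 2] by (simp add: sol_Suc(3)[of "Suc m"] del: sol_Suc)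
    then show ?thesis using R Suc by simp
  qed
qed

lemma sum_P_sq_pos:
  fixes x :: real
  assumes "0 < n"
  shows "0 < (\<Sum>k<n. (P k x)\<^sup>2)"
proof -
  have "(P 0 x)\<^sup>2 \<le> (\<Sum>k<n. (P k x)\<^sup>2)"
    by (rule member_le_sum) (use assms in auto)
  then show ?thesis by simp
qed

text \<open>Christoffel-Darboux at \<open>z\<close> and \<open>cnj z\<close>: for a nonreal zero the
  sum of the squared moduli of \<open>P k z\<close> would vanish, although its term at 0 is
  1.\<close>

lemma P_root_real:
  fixes z :: complex
  assumes "P n z = 0"
  shows "z \<in> \<real>"
proof (rule ccontr)
  assume nr: "z \<notin> \<real>"
  have n: "0 < n" using assms by (cases n) auto
  have "(z - cnj z) * (\<Sum>k<n. P k z * P k (cnj z)) = 0"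
    using assms eval_cnj[of n z] by (simp add: christoffel_darboux)
  moreover have "(\<Sum>k<n. P k z * P k (cnj z)) = of_real (\<Sum>k<n. (cmod (P k z))\<^sup>2)"
    using eval_cnj by (simp add: complex_norm_square del: of_real_power)
  moreover have "(cmod (P 0 z))\<^sup>2 \<le> (\<Sum>k<n. (cmod (P k z))\<^sup>2)"
    by (rule member_le_sum) (use n in auto)
  moreover have "z - cnj z \<noteq> 0" using nr by (auto simp: Reals_cnj_iff)
  ultimately show False by (simp del: of_real_sum)
qed

text \<open>At a double zero the confluent identity would make a sum of real squares containing
  \<open>P 0 = 1\<close> vanish, so the zeros are simple. The complex zeros counted by the degree
  are then \<open>n\<close> distinct ones, all real.\<close>

lemma card_P_roots: "card {x::real. P n x = 0} = n"
proof -
  have inj: "inj (complex_of_real)" by (simp add: inj_on_def)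
  have img: "{z::complex. P n z = 0} = of_real ` {x. P n x = 0}"
  proof (intro equalityI subsetI)
    fix z :: complex assume z: "z \<in> {z. P n z = 0}"
    then obtain x where "z = of_real x" using P_root_real[of n z] by (auto elim: Reals_cases)
    then show "z \<in> of_real ` {x. P n x = 0}" using z eval_of_real[where 'x = complex, of n x] by auto
  qed (use eval_of_real[where 'x = complex] in auto)
  have "rsquarefree (P_poly n :: complex poly)"
    unfolding rsquarefree_roots
  proof (intro allI notI)
    fix z :: complex assume "P n z = 0 \<and> P' n z = 0"
    then have z: "P n z = 0" "P' n z = 0" by auto
    then have n: "0 < n" by (cases n) auto
    obtain x where x: "z = of_real x" using P_root_real[OF z(1)] by (auto elim: Reals_cases)
    have "(\<Sum>k<n. (P k z)\<^sup>2) = 0"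
      using deriv_wronskian(1)[of n z] z by simp
    then have "of_real (\<Sum>k<n. (P k x)\<^sup>2) = (0::complex)"
      using eval_of_real[where 'x = complex] by (simp add: x)
    then show False using sum_P_sq_pos[OF n, of x] by (simp del: of_real_sum)
  qed
  then have sf: "P_poly n \<noteq> (0 :: complex poly)" "order z (P_poly n) = 1" if "P n z = 0" for z :: complex
    using that rsquarefree_root_order[of "P_poly n" z] by (auto simp: rsquarefree_def)
  have nz: "P_poly n \<noteq> (0 :: complex poly)" using \<open>rsquarefree (P_poly n)\<close> by (simp add: rsquarefree_def)
  have "n = size (proots (P_poly n :: complex poly))"
    using size_proots_complex degree_sol[of n, where 'x = complex] by metis
  also have "\<dots> = (\<Sum>z\<in>{z::complex. P n z = 0}. order z (P_poly n))"
    using nz by (simp add: size_multiset_overloaded_eq)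
  also have "\<dots> = card {z::complex. P n z = 0}"
    using sf by simp
  finally have "card {z::complex. P n z = 0} = n" by simp
  then show ?thesis
    unfolding img by (subst (asm) card_image) (use inj in \<open>auto intro: inj_on_subset\<close>)
qed

lemma monodromy_eq:
  fixes x :: "'x::real_normed_field"
  shows "monodromy a b n x $ 1 $ 1 = P n x \<and> monodromy a b n x $ 1 $ 2 = R n x \<and>
    monodromy a b n x $ 2 $ 1 = V n x \<and> monodromy a b n x $ 2 $ 2 = S n x"
proof (induction n)
  case 0
  then show ?case by (simp add: mat_def)
next
  case (Suc n)
  then show ?case
    by (simp add: transfer_matrix_def matrix_matrix_mult_def sum_2 eval_Suc vector_scaleR_component)
      (simp add: scaleR_conv_of_real power2_eq_square field_simps)
qed

end

section \<open>Periodic coefficients and the discriminant\<close>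

locale periodic_coeffs = jacobi_coeffs +
  fixes q :: nat
  assumes q_pos: "1 \<le> q"
    and a_period: "a (n + q) = a n"
    and b_period: "b (n + q) = b n"
begin

definition D_poly :: "'x::real_normed_field poly" where "D_poly = P_poly q + S_poly q"
abbreviation D :: "'x::real_normed_field \<Rightarrow> 'x" where "D \<equiv> poly D_poly"
abbreviation D' :: "'x::real_normed_field \<Rightarrow> 'x" where "D' \<equiv> poly (pderiv D_poly)"
abbreviation D'' :: "'x::real_normed_field \<Rightarrow> 'x" where "D'' \<equiv> poly (pderiv (pderiv D_poly))"

lemma D_eq: "D x = P q x + S q x" and D'_eq: "D' x = P' q x + S' q x"
  by (simp_all add: D_poly_def pderiv_add)

lemma discriminant_eq: "discriminant a b q = (D :: 'x::real_normed_field \<Rightarrow> 'x)"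
  using monodromy_eq[of q, where 'x = 'x]
  by (auto simp: fun_eq_iff discriminant_def trace_def sum_2 D_eq)

lemma D_of_real: "D (of_real x :: 'x::real_normed_field) = of_real (D x)" for x :: real
  using eval_of_real[where 'x = 'x, of q x] by (simp add: D_eq)

text \<open>By periodicity the product over \<open>n + q\<close> steps is the one over
  \<open>n\<close> steps times the monodromy matrix.\<close>

lemma shift_period:
  fixes x :: "'x::real_normed_field"
  shows "P (n + q) x = P n x * P q x + R n x * V q x"
    "V (n + q) x = V n x * P q x + S n x * V q x"
    "R (n + q) x = P n x * R q x + R n x * S q x"
    "S (n + q) x = V n x * R q x + S n x * S q x"
proof (induction n)
  case (Suc n)
  { case 1 show ?case using Suc by (simp add: eval_Suc a_period b_period) (simp add: field_simps) }
  { case 2 show ?case using Suc by (simp add: eval_Suc a_period b_period) (simp add: field_simps) }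
  { case 3 show ?case using Suc by (simp add: eval_Suc a_period b_period) (simp add: field_simps) }
  { case 4 show ?case using Suc by (simp add: eval_Suc a_period b_period) (simp add: field_simps) }
qed simp_all

text \<open>Cayley-Hamilton for the monodromy matrix, whose determinant is one.\<close>

lemma shift_two_periods:
  fixes x :: "'x::real_normed_field"
  shows "P (n + 2 * q) x = D x * P (n + q) x - P n x"
    "V (n + 2 * q) x = D x * V (n + q) x - V n x"
proof -
  have w: "P q x * S q x - R q x * V q x = 1" by (rule wronskian)
  have "P (n + 2 * q) x = P ((n + q) + q) x" by (simp add: mult_2 add.assoc)
  also have "\<dots> = P (n + q) x * P q x + R (n + q) x * V q x" by (rule shift_period)
  also have "\<dots> = D x * P (n + q) x - (P q x * S q x - R q x * V q x) * P n x"
    by (simp add: shift_period D_eq) (simp add: algebra_simps)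
  finally show "P (n + 2 * q) x = D x * P (n + q) x - P n x" using w by simp
  have "V (n + 2 * q) x = V ((n + q) + q) x" by (simp add: mult_2 add.assoc)
  also have "\<dots> = V (n + q) x * P q x + S (n + q) x * V q x" by (rule shift_period)
  also have "\<dots> = D x * V (n + q) x - (P q x * S q x - R q x * V q x) * V n x"
    by (simp add: shift_period D_eq) (simp add: algebra_simps)
  finally show "V (n + 2 * q) x = D x * V (n + q) x - V n x" using w by simp
qed

text \<open>For \<open>D x = 2 * cos \<phi>\<close> each summand is the squared modulus of
  \<open>P (q + r) x - exp (- \<i> \<phi>) * P r x\<close>. Writing it through \<open>D\<close>
  keeps it a polynomial in \<open>x\<close>, hence meaningful off the bands and in the
  plane.\<close>

definition W_poly :: "'x::real_normed_field poly" where
  "W_poly = (\<Sum>r<q. P_poly (q + r) ^ 2 - D_poly * P_poly (q + r) * P_poly r + P_poly r ^ 2)"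
abbreviation W :: "'x::real_normed_field \<Rightarrow> 'x" where "W \<equiv> poly W_poly"

lemma W_eq: "W x = (\<Sum>r<q. (P (q + r) x)\<^sup>2 - D x * P (q + r) x * P r x + (P r x)\<^sup>2)"
  by (simp add: W_poly_def poly_sum poly_power)

lemma W_of_real: "W (of_real x :: 'x::real_normed_field) = of_real (W x)" for x :: real
  using eval_of_real[where 'x = 'x, of _ x] D_of_real[where 'x = 'x, of x] by (simp add: W_eq)

text \<open>Cramer's rule applied to \<open>deriv_wronskian\<close>: each derivative is multiplied
  by the Wronskian, which is 1, and regrouped.\<close>

lemma pderiv_monodromy:
  fixes x :: "'x::real_normed_field"
  defines "A \<equiv> \<Sum>k<q. (P k x)\<^sup>2" and "B \<equiv> \<Sum>k<q. P k x * R k x" and "C \<equiv> \<Sum>k<q. (R k x)\<^sup>2"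
  shows "P' q x = P q x * B - R q x * A" "R' q x = P q x * C - R q x * B"
    "V' q x = V q x * B - S q x * A" "S' q x = V q x * C - S q x * B"
proof -
  note d = deriv_wronskian[of q x, folded A_def B_def C_def]
  have w: "P q x * S q x - R q x * V q x = 1" by (rule wronskian)
  have "P' q x = (P q x * S q x - R q x * V q x) * P' q x" by (simp add: w)
  also have "\<dots> = R q x * (P q x * V' q x - V q x * P' q x) - P q x * (R q x * V' q x - S q x * P' q x)"
    by (simp add: algebra_simps)
  finally show "P' q x = P q x * B - R q x * A" by (simp add: d)
  have "R' q x = (P q x * S q x - R q x * V q x) * R' q x" by (simp add: w)
  also have "\<dots> = R q x * (P q x * S' q x - V q x * R' q x) - P q x * (R q x * S' q x - S q x * R' q x)"
    by (simp add: algebra_simps)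
  finally show "R' q x = P q x * C - R q x * B" by (simp add: d)
  have "V' q x = (P q x * S q x - R q x * V q x) * V' q x" by (simp add: w)
  also have "\<dots> = S q x * (P q x * V' q x - V q x * P' q x) - V q x * (R q x * V' q x - S q x * P' q x)"
    by (simp add: algebra_simps)
  finally show "V' q x = V q x * B - S q x * A" by (simp add: d)
  have "S' q x = (P q x * S q x - R q x * V q x) * S' q x" by (simp add: w)
  also have "\<dots> = S q x * (P q x * S' q x - V q x * R' q x) - V q x * (R q x * S' q x - S q x * R' q x)"
    by (simp add: algebra_simps)
  finally show "S' q x = V q x * C - S q x * B" by (simp add: d)
qed

lemma D'_quadratic:
  "D' x = (P q x - S q x) * (\<Sum>k<q. P k x * R k x) - R q x * (\<Sum>k<q. (P k x)\<^sup>2)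
      + V q x * (\<Sum>k<q. (R k x)\<^sup>2)"
  by (simp add: D'_eq pderiv_monodromy algebra_simps)

text \<open>On the bands \<open>W\<close> is a sum of squares, so this identity controls \<open>D'\<close> there.\<close>

lemma W_factor: "W x = V q x * D' x"
proof -
  define A B C where "A = (\<Sum>k<q. (P k x)\<^sup>2)" and "B = (\<Sum>k<q. P k x * R k x)"
    and "C = (\<Sum>k<q. (R k x)\<^sup>2)"
  have w: "P q x * S q x - R q x * V q x = 1" by (rule wronskian)
  have s: "P (q + r) x = P r x * P q x + R r x * V q x" for r
    using shift_period(1)[of r x] by (simp add: add.commute)
  have "W x = (\<Sum>r<q. ((P q x)\<^sup>2 - D x * P q x + 1) * (P r x)\<^sup>2
      + V q x * (2 * P q x - D x) * (P r x * R r x) + (V q x)\<^sup>2 * (R r x)\<^sup>2)"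
    unfolding W_eq s by (intro sum.cong refl) (simp add: power2_eq_square algebra_simps)
  also have "\<dots> = ((P q x)\<^sup>2 - D x * P q x + 1) * A + V q x * (2 * P q x - D x) * B + (V q x)\<^sup>2 * C"
    by (simp add: A_def B_def C_def sum.distrib sum_distrib_left)
  \<comment> \<open>The characteristic polynomial of the monodromy matrix at its diagonal entry
    \<open>P q x\<close>, where only the product of the off-diagonal entries survives.\<close>
  also have "(P q x)\<^sup>2 - D x * P q x + 1 = - R q x * V q x"
    using w by (simp add: D_eq power2_eq_square algebra_simps)
  finally show ?thesis
    unfolding D'_quadratic A_def[symmetric] B_def[symmetric] C_def[symmetric]
    by (simp add: D_eq power2_eq_square algebra_simps)
qed

lemma W_term_nonneg:
  fixes s p d :: real
  assumes "\<bar>d\<bar> \<le> 2"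
  shows "0 \<le> s\<^sup>2 - d * s * p + p\<^sup>2"
proof -
  have "d\<^sup>2 \<le> 2\<^sup>2" using power_mono[OF assms, of 2] by simp
  then have "0 \<le> (s - d / 2 * p)\<^sup>2 + (1 - d\<^sup>2 / 4) * p\<^sup>2" by simp
  then show ?thesis by (simp add: power2_eq_square algebra_simps)
qed

text \<open>The bound is the summand of \<open>W\<close> with \<open>r = q - 1\<close>. From
  \<open>V (2 * q) = D * V q\<close> follows \<open>P (2 * q - 1) = D * P (q - 1)\<close>, so its
  first two terms cancel. As \<open>V q\<close> is a multiple of \<open>P (q - 1)\<close>,
  positivity of \<open>W\<close> reduces to \<open>V q x \<noteq> 0\<close>.\<close>

lemma W_lower_bound:
  fixes x :: real
  assumes "\<bar>D x\<bar> \<le> 2"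
  shows "(P (q - 1) x)\<^sup>2 \<le> W x"
proof -
  have V: "V q x = a (q - 1) * P (q - 1) x" "V (q + q) x = a (q - 1) * P (q + (q - 1)) x"
    using eval_Suc(2)[of "q - 1" x] eval_Suc(2)[of "q + (q - 1)" x] q_pos a_period[of "q - 1"]
    by (simp_all add: add.commute)
  have "V (q + q) x = D x * V q x" using shift_two_periods(2)[of 0 x] by (simp add: mult_2)
  then have p: "P (q + (q - 1)) x = D x * P (q - 1) x" by (simp add: V)
  have "(P (q - 1) x)\<^sup>2 = (P (q + (q - 1)) x)\<^sup>2 - D x * P (q + (q - 1)) x * P (q - 1) x + (P (q - 1) x)\<^sup>2"
    unfolding p by (simp add: power2_eq_square)
  also have "\<dots> \<le> W x"
    unfolding W_eq
    by (rule member_le_sum[where i = "q - 1" and A = "{..<q}"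
          and f = "\<lambda>r. (P (q + r) x)\<^sup>2 - D x * P (q + r) x * P r x + (P r x)\<^sup>2"])
      (use q_pos W_term_nonneg[OF assms] in auto)
  finally show ?thesis .
qed

lemma V_period_eq: "V q x = of_real (a (q - 1)) * P (q - 1) x"
  using eval_Suc(2)[of "q - 1" x] q_pos by simp

text \<open>A zero of \<open>V q\<close> makes the monodromy matrix triangular with real diagonal
  entries of product 1, whose sum has modulus at least 2.\<close>

lemma V_nonzero_inside:
  fixes x :: real
  assumes "\<bar>D x\<bar> < 2"
  shows "V q x \<noteq> 0"
proof
  assume "V q x = 0"
  then have "P q x * S q x = 1" using wronskian[of q x] by simp
  then have "(P q x - S q x)\<^sup>2 = (D x)\<^sup>2 - 4" by (simp add: D_eq power2_eq_square algebra_simps)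
  moreover have "(D x)\<^sup>2 < 2\<^sup>2" using power_strict_mono[OF assms, of 2] by simp
  ultimately show False using zero_le_power2[of "P q x - S q x"] by simp
qed

lemma W_pos_inside:
  fixes x :: real
  assumes "\<bar>D x\<bar> < 2"
  shows "0 < W x"
proof -
  have "P (q - 1) x \<noteq> 0" using V_nonzero_inside[OF assms] by (auto simp: V_period_eq)
  then show ?thesis using W_lower_bound[of x] assms
    by (metis less_eq_real_def order_less_le_trans zero_less_power2)
qed

lemma D'_nonzero_inside:
  fixes x :: real
  assumes "\<bar>D x\<bar> < 2"
  shows "D' x \<noteq> 0"
  using W_pos_inside[OF assms] by (auto simp: W_factor)

text \<open>At a critical point with \<bar>D\<bar> = 2 the monodromy matrix is \<sigma> times the
  identity for a sign \<sigma>, and \<open>D''\<close> becomes \<open>- 2 * \<sigma>\<close> times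
  the Gram determinant of the solutions \<open>P\<close> and \<open>R\<close> over one period. The
  determinant is positive because the solutions are independent.\<close>

lemma D''_sign:
  fixes x :: real
  assumes "\<bar>D x\<bar> = 2" "D' x = 0"
  shows "D x * D'' x < 0"
proof -
  define \<sigma> where "\<sigma> = P q x"
  define A B C where "A = (\<Sum>k<q. (P k x)\<^sup>2)" and "B = (\<Sum>k<q. P k x * R k x)"
    and "C = (\<Sum>k<q. (R k x)\<^sup>2)"
  \<comment> \<open>\<open>W x = V q x * D' x\<close> vanishes and squeezes the square of
    \<open>P (q - 1) x\<close> to zero.\<close>
  have V: "V q x = 0"
    using W_lower_bound[of x] assms by (simp add: W_factor V_period_eq)
  have "(P q x - S q x)\<^sup>2 = (D x)\<^sup>2 - 4 * (P q x * S q x)"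
    by (simp add: D_eq power2_eq_square algebra_simps)
  also have "(D x)\<^sup>2 = 4" using arg_cong[OF assms(1), of "\<lambda>u. u\<^sup>2"] by simp
  finally have S: "S q x = \<sigma>" using wronskian[of q x] V by (simp add: \<sigma>_def)
  then have s1: "\<sigma>\<^sup>2 = 1" using wronskian[of q x] V by (simp add: \<sigma>_def power2_eq_square)
  have Apos: "0 < A" using sum_P_sq_pos q_pos by (simp add: A_def)
  have R: "R q x = 0"
    using assms(2) Apos V S unfolding D'_quadratic A_def[symmetric] by (simp add: \<sigma>_def)
  have d: "P' q x = \<sigma> * B" "R' q x = \<sigma> * C" "V' q x = - \<sigma> * A" "S' q x = - \<sigma> * B"
    using pderiv_monodromy[of x] V S R by (simp_all add: A_def B_def C_def \<sigma>_def)
  \<comment> \<open>Differentiates \<open>D'_quadratic\<close>. Its coefficients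
    \<open>P q - S q\<close>, \<open>R q\<close> and \<open>V q\<close> vanish at \<open>x\<close>,
    so the derivatives of the three sums drop out.\<close>
  have DD: "(D' has_real_derivative (P' q x - S' q x) * B - R' q x * A + V' q x * C) (at x)"
  proof -
    have dA: "((\<lambda>x. \<Sum>k<q. (P k x)\<^sup>2) has_real_derivative (\<Sum>k<q. 2 * P k x * P' k x)) (at x)"
      and dB: "((\<lambda>x. \<Sum>k<q. P k x * R k x) has_real_derivative (\<Sum>k<q. P k x * R' k x + P' k x * R k x)) (at x)"
      and dC: "((\<lambda>x. \<Sum>k<q. (R k x)\<^sup>2) has_real_derivative (\<Sum>k<q. 2 * R k x * R' k x)) (at x)"
      by (auto intro!: derivative_eq_intros sum.cong)
    have "((\<lambda>x. (P q x - S q x) * (\<Sum>k<q. P k x * R k x) - R q x * (\<Sum>k<q. (P k x)\<^sup>2)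
        + V q x * (\<Sum>k<q. (R k x)\<^sup>2)) has_real_derivative (P' q x - S' q x) * B - R' q x * A + V' q x * C) (at x)"
      by (rule derivative_eq_intros dA dB dC refl)+
        (simp add: V S R \<sigma>_def[symmetric] A_def B_def C_def)
    then show ?thesis by (simp add: D'_quadratic[abs_def])
  qed
  have D'': "D'' x = - 2 * \<sigma> * (A * C - B\<^sup>2)"
    using DERIV_unique[OF poly_DERIV DD] d by (simp add: power2_eq_square algebra_simps)
  \<comment> \<open>For \<open>q = 1\<close> the entry \<open>V q = a 0\<close> cannot vanish. Two
    indices are needed below for strict Cauchy-Schwarz.\<close>
  have q2: "2 \<le> q"
  proof (rule ccontr)
    assume "\<not> 2 \<le> q"
    then have "q = Suc 0" using q_pos by simp
    then show False using V by (simp add: eval_Suc)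
  qed
  have "0 < A * (A * C - B\<^sup>2)"
  proof -
    \<comment> \<open>The squared length of \<open>A * R - B * P\<close> is \<open>A\<close> times
      the Gram determinant. Its entry 0 equals \<open>- B\<close>; if that is zero, entry 1 is
      \<open>A * R 1\<close>, which is not.\<close>
    define f where "f k = (A * R k x - B * P k x)\<^sup>2" for k
    have "(\<Sum>k<q. f k) = (\<Sum>k<q. A\<^sup>2 * (R k x)\<^sup>2 - 2 * A * B * (P k x * R k x) + B\<^sup>2 * (P k x)\<^sup>2)"
      by (simp add: f_def power2_eq_square algebra_simps)
    also have "\<dots> = A\<^sup>2 * C - 2 * A * B * B + B\<^sup>2 * A"
      by (simp add: A_def B_def C_def sum.distrib sum_subtractf sum_distrib_left)
    finally have e: "(\<Sum>k<q. f k) = A * (A * C - B\<^sup>2)" by (simp add: power2_eq_square algebra_simps)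
    have "f 0 + f 1 = (\<Sum>k\<in>{0,1}. f k)" by simp
    also have "\<dots> \<le> (\<Sum>k<q. f k)"
      by (rule sum_mono2) (use q2 in \<open>auto simp: f_def\<close>)
    finally have le: "f 0 + f 1 \<le> A * (A * C - B\<^sup>2)" using e by simp
    have f0: "f 0 = B\<^sup>2" by (simp add: f_def)
    have "f 0 + f 1 > 0"
    proof (cases "B = 0")
      case True
      have "f 1 > 0" using True Apos by (simp add: f_def eval_Suc)
      then show ?thesis using f0 True by simp
    next
      case False
      then have "0 < f 0" by (simp add: f0)
      moreover have "0 \<le> f 1" by (simp add: f_def)
      ultimately show ?thesis by linarith
    qed
    then show ?thesis using le by linarith
  qed
  then have "0 < A * C - B\<^sup>2" using Apos zero_less_mult_pos by blast
  moreover have "D x * D'' x = - 4 * \<sigma>\<^sup>2 * (A * C - B\<^sup>2)"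
    using S by (simp add: D'' D_eq \<sigma>_def power2_eq_square)
  ultimately show ?thesis using s1 by simp
qed

end

section \<open>Bands\<close>

text \<open>The component around \<open>z\<close> of the set where \<bar>f\<bar> < 2. On it
  \<open>f'\<close> keeps one sign by connectedness, so \<open>f\<close> is monotone and must leave
  through -2 on one side and 2 on the other. The points \<open>x0\<close> and \<open>y0\<close>
  confine the component.\<close>

lemma maximal_monotone_piece:
  fixes f f' :: "real \<Rightarrow> real"
  assumes der: "\<And>x. (f has_real_derivative f' x) (at x)"
    and cont': "continuous_on UNIV f'"
    and nz: "\<And>x. \<bar>f x\<bar> < 2 \<Longrightarrow> f' x \<noteq> 0"
    and z: "\<bar>f z\<bar> < 2"
    and x0: "x0 < z" "2 \<le> \<bar>f x0\<bar>" and y0: "z < y0" "2 \<le> \<bar>f y0\<bar>"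
  obtains l r where "x0 \<le> l" "l < z" "z < r" "r \<le> y0" "\<bar>f l\<bar> = 2" "\<bar>f r\<bar> = 2"
    "\<And>x. l < x \<Longrightarrow> x < r \<Longrightarrow> \<bar>f x\<bar> < 2"
    "strict_mono_on {l..r} f \<or> strict_antimono_on {l..r} f" "f ` {l..r} = {-2..2}"
proof -
  have cont: "continuous_on A f" for A
    using der by (meson DERIV_continuous_on has_field_derivative_at_within)
  have "\<exists>l\<in>{x\<in>{x0..z}. 2 \<le> \<bar>f x\<bar>}. \<forall>t\<in>{x\<in>{x0..z}. 2 \<le> \<bar>f x\<bar>}. t \<le> l"
  proof (rule compact_attains_sup)
    have "closed ({x0..z} \<inter> (\<lambda>x. \<bar>f x\<bar>) -` {2..})"
      by (rule continuous_closed_preimage) (auto intro!: continuous_intros cont)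
    then have "compact ({x0..z} \<inter> (\<lambda>x. \<bar>f x\<bar>) -` {2..})"
      by (meson bounded_closed_interval bounded_subset compact_eq_bounded_closed inf_le1)
    also have "{x0..z} \<inter> (\<lambda>x. \<bar>f x\<bar>) -` {2..} = {x\<in>{x0..z}. 2 \<le> \<bar>f x\<bar>}" by auto
    finally show "compact {x\<in>{x0..z}. 2 \<le> \<bar>f x\<bar>}" .
  qed (use x0 in \<open>auto intro!: exI[of _ x0]\<close>)
  then obtain l where l: "x0 \<le> l" "l \<le> z" "2 \<le> \<bar>f l\<bar>"
    and lmax: "\<And>t. x0 \<le> t \<Longrightarrow> t \<le> z \<Longrightarrow> 2 \<le> \<bar>f t\<bar> \<Longrightarrow> t \<le> l" by auto
  have lz: "l < z" using l z by (cases "l = z") auto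
  have "\<exists>r\<in>{x\<in>{z..y0}. 2 \<le> \<bar>f x\<bar>}. \<forall>t\<in>{x\<in>{z..y0}. 2 \<le> \<bar>f x\<bar>}. r \<le> t"
  proof (rule compact_attains_inf)
    have "closed ({z..y0} \<inter> (\<lambda>x. \<bar>f x\<bar>) -` {2..})"
      by (rule continuous_closed_preimage) (auto intro!: continuous_intros cont)
    then have "compact ({z..y0} \<inter> (\<lambda>x. \<bar>f x\<bar>) -` {2..})"
      by (meson bounded_closed_interval bounded_subset compact_eq_bounded_closed inf_le1)
    also have "{z..y0} \<inter> (\<lambda>x. \<bar>f x\<bar>) -` {2..} = {x\<in>{z..y0}. 2 \<le> \<bar>f x\<bar>}" by auto
    finally show "compact {x\<in>{z..y0}. 2 \<le> \<bar>f x\<bar>}" .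
  qed (use y0 in \<open>auto intro!: exI[of _ y0]\<close>)
  then obtain r where r: "r \<le> y0" "z \<le> r" "2 \<le> \<bar>f r\<bar>"
    and rmin: "\<And>t. z \<le> t \<Longrightarrow> t \<le> y0 \<Longrightarrow> 2 \<le> \<bar>f t\<bar> \<Longrightarrow> r \<le> t" by auto
  have zr: "z < r" using r z by (cases "r = z") auto
  have inside: "\<bar>f x\<bar> < 2" if "l < x" "x < r" for x
  proof (cases "x \<le> z")
    case True
    then show ?thesis using lmax[of x] l that by force
  next
    case False
    then show ?thesis using rmin[of x] r that by force
  qed
  have fl: "\<bar>f l\<bar> = 2"
  proof -
    obtain w where w: "l \<le> w" "w \<le> z" "\<bar>f w\<bar> = 2"
      using IVT2'[of "\<lambda>x. \<bar>f x\<bar>" z 2 l] l z by (auto intro!: continuous_intros cont)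
    then have "w \<le> l" using lmax[of w] l by auto
    then show ?thesis using w by simp
  qed
  have fr: "\<bar>f r\<bar> = 2"
  proof -
    obtain w where w: "z \<le> w" "w \<le> r" "\<bar>f w\<bar> = 2"
      using IVT'[of "\<lambda>x. \<bar>f x\<bar>" z 2 r] r z by (auto intro!: continuous_intros cont)
    then have "r \<le> w" using rmin[of w] r by auto
    then show ?thesis using w by simp
  qed
  have sign: "\<exists>s::real. (s = 1 \<or> s = -1) \<and> (\<forall>x. l < x \<and> x < r \<longrightarrow> 0 < s * f' x)"
  proof (rule ccontr)
    assume no: "\<not> ?thesis"
    have "\<exists>x. l < x \<and> x < r \<and> f' x \<le> 0"
      using no by (auto dest!: spec[of _ 1] simp: not_less)
    moreover have "\<exists>y. l < y \<and> y < r \<and> 0 \<le> f' y"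
      using no by (auto dest!: spec[of _ "-1"] simp: not_less)
    ultimately obtain x y where xy: "l < x" "x < r" "f' x \<le> 0" "l < y" "y < r" "0 \<le> f' y"
      by blast
    have c: "connected (f' ` {l<..<r})"
      by (intro connected_continuous_image continuous_on_subset[OF cont']) auto
    have "0 \<in> f' ` {l<..<r}"
      using connectedD_interval[OF c, of "f' x" "f' y" 0] xy by auto
    then show False using nz inside by force
  qed
  then obtain s :: real where s: "s = 1 \<or> s = -1" and spos: "\<And>x. l < x \<Longrightarrow> x < r \<Longrightarrow> 0 < s * f' x"
    by blast
  have mono: "s * f x < s * f y" if "l \<le> x" "x < y" "y \<le> r" for x y
  proof (rule DERIV_pos_imp_increasing_open[OF \<open>x < y\<close>])
    fix w assume "x < w" "w < y"
    then show "\<exists>d. ((\<lambda>x. s * f x) has_real_derivative d) (at w) \<and> 0 < d"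
      using DERIV_cmult[OF der[of w], of s] spos[of w] that by auto
  qed (intro continuous_intros cont)
  have ends: "s * f l = -2" "s * f r = 2"
    using mono[of l r] lz zr fl fr s by (auto simp: abs_if split: if_splits)
  have m: "strict_mono_on {l..r} f \<or> strict_antimono_on {l..r} f"
    using s mono by (auto simp: monotone_on_def)
  have "f ` {l..r} = {-2..2}"
  proof (intro equalityI subsetI)
    fix y assume "y \<in> f ` {l..r}"
    then obtain x where x: "l \<le> x" "x \<le> r" "y = f x" by auto
    have "\<bar>f x\<bar> \<le> 2"
      using inside[of x] fl fr x by (cases "x = l"; cases "x = r") auto
    then show "y \<in> {-2..2}" using x by auto
  next
    fix y assume y: "y \<in> {-2..2::real}"
    have c: "continuous_on {l..r} (\<lambda>x. s * f x)" by (intro continuous_intros cont)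
    have "s * f l \<le> s * y" "s * y \<le> s * f r" using s y ends by auto
    then obtain x where "l \<le> x" "x \<le> r" "s * f x = s * y"
      using IVT'[OF _ _ _ c] lz zr by force
    then show "y \<in> f ` {l..r}" using s by auto
  qed
  then show ?thesis using that[of l r] l r lz zr fl fr inside m by blast
qed

section \<open>Zeros of the discriminant and existence of the bands\<close>

context periodic_coeffs
begin

lemma degree_D: "degree (D_poly :: 'x::real_normed_field poly) = q"
proof -
  obtain m where m: "q = Suc m" using q_pos by (cases q) auto
  have "degree (S_poly q :: 'x poly) < q"
    using degree_R_Suc[of m, where 'x = 'x] by (simp add: m sol_Suc(4) del: sol_Suc(1-3))
  then show ?thesis
    using degree_sol[of q, where 'x = 'x] by (simp add: D_poly_def degree_add_eq_left)
qed

lemma D_poly_not_const [simp]: "D_poly \<noteq> [:c:]" for c :: "'x::real_normed_field"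
proof
  assume "D_poly = [:c:]"
  then have "degree (D_poly :: 'x poly) = 0" by simp
  then show False using q_pos by (simp add: degree_D)
qed

lemma finite_D_level: "finite {x::real. D x = c}"
  and card_D_level: "card {x::real. D x = c} \<le> q"
proof -
  have e: "{x. D x = c} = {x. poly (D_poly - [:c:]) x = 0}" by auto
  show "finite {x::real. D x = c}" unfolding e by (rule poly_roots_finite) simp
  have "degree (D_poly - [:c:]) \<le> q"
    by (rule degree_diff_le) (simp_all add: degree_D)
  then show "card {x::real. D x = c} \<le> q"
    unfolding e using card_poly_roots_bound[of "D_poly - [:c:]"] by (simp only: right_minus_eq D_poly_not_const) auto
qed

lemma V_roots_eq: "{x::real. V q x = 0} = {x. P (q - 1) x = 0}"
  by (auto simp: V_period_eq)

lemma card_V_roots: "card {x::real. V q x = 0} = q - 1"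
  by (simp add: V_roots_eq card_P_roots)

lemma finite_V_roots: "finite {x::real. V q x = 0}"
  unfolding V_roots_eq
  by (rule poly_roots_finite) (use degree_sol[of "q - 1", where 'x = real] in \<open>auto simp: prod_zero_iff\<close>)

text \<open>\<open>V (2 * q) = D * V q\<close> is a multiple of \<open>P (2 * q - 1)\<close> and so
  has \<open>2 * q - 1\<close> real zeros, of which \<open>V q\<close> accounts for
  \<open>q - 1\<close>. At least \<open>q\<close> remain for \<open>D\<close>, and its degree allows
  no more.\<close>

lemma card_D_zeros: "card {x::real. D x = 0} = q"
proof -
  have "{x::real. P (2 * q - 1) x = 0} \<subseteq> {x. D x = 0} \<union> {x. P (q - 1) x = 0}"
  proof
    fix x :: real assume "x \<in> {x. P (2 * q - 1) x = 0}"
    then have "V (Suc (2 * q - 1)) x = 0" by (simp add: eval_Suc)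
    moreover have "Suc (2 * q - 1) = 0 + 2 * q" using q_pos by simp
    ultimately have "D x * V q x = 0" using shift_two_periods(2)[of 0 x] by simp
    then show "x \<in> {x. D x = 0} \<union> {x. P (q - 1) x = 0}" by (auto simp: V_period_eq)
  qed
  then have "2 * q - 1 \<le> card ({x::real. D x = 0} \<union> {x. P (q - 1) x = 0})"
    using card_mono[of "{x::real. D x = 0} \<union> {x. P (q - 1) x = 0}" "{x. P (2 * q - 1) x = 0}"]
      finite_D_level[of 0] finite_V_roots by (simp add: V_roots_eq card_P_roots)
  also have "\<dots> \<le> card {x::real. D x = 0} + (q - 1)"
    using card_Un_le[of "{x::real. D x = 0}" "{x::real. P (q - 1) x = 0}"] by (simp add: card_P_roots)
  finally show ?thesis using card_D_level[of 0] q_pos by linarith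
qed

lemma D_deriv: "(D has_field_derivative D' x) (at x)"
  by (rule poly_DERIV)

lemma D_unbounded:
  "\<exists>y<z. 2 \<le> \<bar>D y\<bar>" "\<exists>y>z. 2 \<le> \<bar>D y\<bar>" for z :: real
proof -
  obtain c where c: "\<And>x::real. c \<le> \<bar>x\<bar> \<Longrightarrow> 2 \<le> \<bar>D x\<bar>"
  proof -
    have "filterlim (D :: real \<Rightarrow> real) at_infinity at_infinity"
      by (rule filterlim_poly_at_infinity) (use q_pos degree_D[where 'x = real] in auto)
    then have "\<forall>\<^sub>F x :: real in at_infinity. 2 \<le> norm (D x)"
      by (auto simp: filterlim_at_infinity[OF order_refl])
    then show ?thesis using that by (auto simp: eventually_at_infinity)
  qed
  show "\<exists>y<z. 2 \<le> \<bar>D y\<bar>"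
    by (rule exI[of _ "min (z - 1) (- \<bar>c\<bar>)"]) (auto intro!: c)
  show "\<exists>y>z. 2 \<le> \<bar>D y\<bar>"
    by (rule exI[of _ "max (z + 1) (\<bar>c\<bar>)"]) (auto intro!: c)
qed

text \<open>One band grows around each of the \<open>q\<close> zeros of \<open>D\<close>. Between
  neighbouring zeros Rolle supplies a critical point, which cannot lie where \<bar>D\<bar> < 2;
  beyond the outermost zeros \<open>D\<close> is unbounded. These points separate the
  pieces.\<close>

lemma ex_bands:
  obtains L U :: "nat \<Rightarrow> real" where
    "\<And>j. j < q \<Longrightarrow> L j < U j" "\<And>j. Suc j < q \<Longrightarrow> U j \<le> L (Suc j)"
    "\<And>j. j < q \<Longrightarrow> \<bar>D (L j)\<bar> = 2" "\<And>j. j < q \<Longrightarrow> \<bar>D (U j)\<bar> = 2"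
    "\<And>j x. j < q \<Longrightarrow> L j < x \<Longrightarrow> x < U j \<Longrightarrow> \<bar>D x\<bar> < 2"
    "\<And>j. j < q \<Longrightarrow> strict_mono_on {L j..U j} D \<or> strict_antimono_on {L j..U j} D"
    "\<And>j. j < q \<Longrightarrow> D ` {L j..U j} = {-2..2}"
proof -
  define zs where "zs = sorted_list_of_set {x::real. D x = 0}"
  have zs: "length zs = q" "sorted_wrt (<) zs" "set zs = {x. D x = 0}"
    using finite_D_level[of 0] card_D_zeros by (auto simp: zs_def intro: strict_sorted_list_of_set)
  have Dz: "D (zs ! i) = 0" if "i < q" for i
    using zs that nth_mem[of i zs] by auto
  have zless: "zs ! i < zs ! j" if "i < j" "j < q" for i j
    using zs that by (simp add: sorted_wrt_iff_nth_less)
  have "\<exists>y. 2 \<le> \<bar>D y\<bar> \<and> (0 < i \<longrightarrow> zs ! (i - 1) < y) \<and> (i < q \<longrightarrow> y < zs ! i)" if "i \<le> q" for i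
  proof (cases "i = 0 \<or> i = q")
    case True
    then show ?thesis
      using D_unbounded(1)[of "zs ! 0"] D_unbounded(2)[of "zs ! (q - 1)"] q_pos by auto
  next
    case False
    then have i: "0 < i" "i < q" using that by auto
    have "\<exists>y>zs ! (i - 1). y < zs ! i \<and> (D has_real_derivative 0) (at y)"
    proof (rule Rolle)
      show "zs ! (i - 1) < zs ! i" using i zless by simp
      show "D (zs ! (i - 1)) = D (zs ! i)" using Dz i by simp
      show "D differentiable (at x)" for x :: real
        unfolding real_differentiable_def using D_deriv[of x] by blast
    qed (intro continuous_intros)
    then obtain y where "zs ! (i - 1) < y" "y < zs ! i" "D' y = 0"
      using DERIV_unique[OF D_deriv] by blast
    then show ?thesis using D'_nonzero_inside[of y] i by (intro exI[of _ y]) (auto simp: not_less[symmetric])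
  qed
  then obtain y where y: "\<And>i. i \<le> q \<Longrightarrow> 2 \<le> \<bar>D (y i)\<bar>"
    "\<And>i. i \<le> q \<Longrightarrow> 0 < i \<Longrightarrow> zs ! (i - 1) < y i" "\<And>i. i < q \<Longrightarrow> y i < zs ! i"
    by (metis less_imp_le)
  have "\<exists>l r. y j \<le> l \<and> l < r \<and> r \<le> y (Suc j) \<and> \<bar>D l\<bar> = 2 \<and> \<bar>D r\<bar> = 2 \<and>
      (\<forall>x. l < x \<longrightarrow> x < r \<longrightarrow> \<bar>D x\<bar> < 2) \<and>
      (strict_mono_on {l..r} D \<or> strict_antimono_on {l..r} D) \<and> D ` {l..r} = {-2..2}" if j: "j < q" for j
  proof (rule maximal_monotone_piece[of D D' "zs ! j" "y j" "y (Suc j)"])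
    show "y j < zs ! j" "zs ! j < y (Suc j)" "2 \<le> \<bar>D (y j)\<bar>" "2 \<le> \<bar>D (y (Suc j))\<bar>" "\<bar>D (zs ! j)\<bar> < 2"
      using y(1)[of j] y(1)[of "Suc j"] y(2)[of "Suc j"] y(3)[of j] Dz[of j] j by auto
    fix l r
    assume "y j \<le> l" "l < zs ! j" "zs ! j < r" "r \<le> y (Suc j)" "\<bar>D l\<bar> = 2" "\<bar>D r\<bar> = 2"
      "\<And>x. l < x \<Longrightarrow> x < r \<Longrightarrow> \<bar>D x\<bar> < 2"
      "strict_mono_on {l..r} D \<or> strict_antimono_on {l..r} D" "D ` {l..r} = {-2..2}"
    then show ?thesis by (intro exI[of _ l] exI[of _ r] conjI) auto
  qed (use D'_nonzero_inside in \<open>auto intro!: D_deriv continuous_intros\<close>)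
  then obtain L U where LU: "\<And>j. j < q \<Longrightarrow> y j \<le> L j \<and> L j < U j \<and> U j \<le> y (Suc j) \<and>
      \<bar>D (L j)\<bar> = 2 \<and> \<bar>D (U j)\<bar> = 2 \<and> (\<forall>x. L j < x \<longrightarrow> x < U j \<longrightarrow> \<bar>D x\<bar> < 2) \<and>
      (strict_mono_on {L j..U j} D \<or> strict_antimono_on {L j..U j} D) \<and> D ` {L j..U j} = {-2..2}"
    by metis
  have "U j \<le> L (Suc j)" if "Suc j < q" for j
    using LU[of j] LU[of "Suc j"] that by linarith
  then show ?thesis using that[of L U] LU by blast
qed

end

lemma ordered_intervals_le:
  fixes L U :: "nat \<Rightarrow> real"
  assumes "\<And>j. j < q \<Longrightarrow> L j < U j" "\<And>j. Suc j < q \<Longrightarrow> U j \<le> L (Suc j)"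
  shows "i < j \<Longrightarrow> j < q \<Longrightarrow> U i \<le> L j"
proof (induction j)
  case (Suc j)
  show ?case
  proof (cases "i = j")
    case False
    then have "U i \<le> L j" using Suc by auto
    then show ?thesis using assms(1)[of j] assms(2)[of j] Suc.prems by linarith
  qed (use assms Suc in auto)
qed simp

section \<open>Completeness of the bands and uniqueness of their edges\<close>

context periodic_coeffs
begin

text \<open>Otherwise \<open>D\<close>, up to sign, has a local minimum 2 at \<open>x\<close>, so
  \<open>D' x = 0\<close>; but then \<open>D''_sign\<close> turns \<open>x\<close> into a strict
  local maximum.\<close>

lemma band_edge_near_interior:
  fixes x :: real
  assumes "\<bar>D x\<bar> = 2" "open N" "x \<in> N"
  shows "\<exists>y\<in>N. \<bar>D y\<bar> < 2"
proof (rule ccontr)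
  assume "\<not> ?thesis"
  then have N: "\<And>y. y \<in> N \<Longrightarrow> 2 \<le> \<bar>D y\<bar>" by force
  obtain e where e: "0 < e" "ball x e \<subseteq> N" using assms by (meson open_contains_ball)
  define s where "s = D x / 2"
  have s: "s = 1 \<or> s = -1" using assms by (auto simp: s_def)
  have c: "isCont (\<lambda>y. s * D y) x" by (intro continuous_intros)
  have "s * D x = 2" using s by (auto simp: s_def)
  moreover have "((\<lambda>y. s * D y) \<longlongrightarrow> s * D x) (nhds x)"
    using c tendsto_at_iff_tendsto_nhds[of "\<lambda>y. s * D y" x] by (simp add: isCont_def)
  ultimately have "\<forall>\<^sub>F y in nhds x. 0 < s * D y"
    by (metis order_tendstoD(1) zero_less_numeral)
  then obtain d where d: "0 < d" "\<And>y. dist y x < d \<Longrightarrow> 0 < s * D y"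
    by (auto simp: eventually_nhds_metric)
  have ge: "2 \<le> s * D y" if "\<bar>x - y\<bar> < min d e" for y
  proof -
    have "0 < s * D y" using d(2)[of y] that by (simp add: dist_real_def abs_minus_commute)
    moreover have "2 \<le> \<bar>D y\<bar>" using N[of y] e that by (auto simp: dist_real_def)
    ultimately show ?thesis using s by auto
  qed
  have der: "((\<lambda>y. s * D y) has_real_derivative s * D' y) (at y)" for y
    by (intro DERIV_cmult D_deriv)
  have "s * D' x = 0"
    by (rule DERIV_local_min[OF der, of "min d e"]) (use d e ge \<open>s * D x = 2\<close> in auto)
  then have D'0: "D' x = 0" using s by auto
  have der2: "((\<lambda>y. s * D' y) has_real_derivative s * D'' x) (at x)"
    by (intro DERIV_cmult poly_DERIV)
  have "s * D'' x < 0" using D''_sign[OF assms(1) D'0] by (simp add: s_def)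
  from DERIV_neg_dec_right[OF der2 this] obtain d' where d': "0 < d'"
    "\<And>h. 0 < h \<Longrightarrow> h < d' \<Longrightarrow> s * D' (x + h) < 0" using D'0 by auto
  define y where "y = x + min d' (min d e) / 2"
  have y: "x < y" "y < x + d'" "y < x + min d e"
    using d d' e by (auto simp: y_def)
  have "s * D y < s * D x"
  proof (rule DERIV_neg_imp_decreasing_open[OF y(1)])
    fix w assume "x < w" "w < y"
    then show "\<exists>d. ((\<lambda>y. s * D y) has_real_derivative d) (at w) \<and> d < 0"
      using der[of w] d'(2)[of "w - x"] y by auto
  qed (intro continuous_intros)
  moreover have "\<bar>x - y\<bar> < min d e" using y by linarith
  ultimately show False using ge[of y] \<open>s * D x = 2\<close> by simp
qed

text \<open>A level strictly between -2 and 2 is taken in each of the \<open>q\<close> bands, which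
  already gives all the points that the degree allows. The levels -2 and 2 follow because the union
  is closed and such points are limits of inner ones.\<close>

lemma bands_cover:
  fixes L U :: "nat \<Rightarrow> real"
  assumes "\<And>j. j < q \<Longrightarrow> L j < U j" "\<And>j. Suc j < q \<Longrightarrow> U j \<le> L (Suc j)"
    "\<And>j. j < q \<Longrightarrow> \<bar>D (L j)\<bar> = 2" "\<And>j. j < q \<Longrightarrow> \<bar>D (U j)\<bar> = 2"
    "\<And>j. j < q \<Longrightarrow> D ` {L j..U j} = {-2..2}"
  shows "D -` {-2..2} = (\<Union>j<q. {L j..U j})"
proof (intro equalityI subsetI)
  fix x assume "x \<in> (\<Union>j<q. {L j..U j})"
  then show "x \<in> D -` {-2..2}" using assms(5) by fastforce
next
  fix x :: real assume x: "x \<in> D -` {-2..2}"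
  have inner: "y \<in> (\<Union>j<q. {L j..U j})" if y: "\<bar>D y\<bar> < 2" for y :: real
  proof -
    have "\<exists>w. L j < w \<and> w < U j \<and> D w = D y" if "j < q" for j
    proof -
      have "D y \<in> D ` {L j..U j}" using assms(5)[OF that] y by auto
      then obtain w where w: "L j \<le> w" "w \<le> U j" "D w = D y" by auto
      moreover have "w \<noteq> L j" "w \<noteq> U j" using w y assms(3,4)[OF that] by auto
      ultimately show ?thesis by (intro exI[of _ w]) auto
    qed
    then obtain w where w: "\<And>j. j < q \<Longrightarrow> L j < w j \<and> w j < U j \<and> D (w j) = D y" by metis
    have lt: "w i < w j" if "i < j" "j < q" for i j
      using ordered_intervals_le[of q L U i j] assms(1,2) that w[of i] w[of j] by fastforce
    have "inj_on w {..<q}"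
    proof (rule inj_onI)
      fix i j assume "i \<in> {..<q}" "j \<in> {..<q}" "w i = w j"
      then show "i = j" using lt[of i j] lt[of j i] by (metis lessThan_iff less_irrefl nat_neq_iff)
    qed
    then have c: "card (w ` {..<q}) = q" by (simp add: card_image)
    have sub: "w ` {..<q} \<subseteq> {x. D x = D y}" using w by auto
    have "w ` {..<q} = {x. D x = D y}"
      by (rule card_subset_eq[OF finite_D_level sub])
        (use card_mono[OF finite_D_level sub] card_D_level[of "D y"] c in auto)
    then obtain j where "j < q" "y = w j" by auto
    then show ?thesis using w[of j] by (intro UN_I[of j]) auto
  qed
  show "x \<in> (\<Union>j<q. {L j..U j})"
  proof (rule ccontr)
    assume nx: "x \<notin> (\<Union>j<q. {L j..U j})"
    have "closed (\<Union>j<q. {L j..U j})" by (intro closed_UN) auto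
    then have "open (- (\<Union>j<q. {L j..U j}))" by auto
    moreover have "\<bar>D x\<bar> = 2" using inner[of x] nx x by force
    ultimately show False using band_edge_near_interior[of x "- (\<Union>j<q. {L j..U j})"] nx inner by blast
  qed
qed

lemma is_band_edges_exists: "\<exists>l. is_band_edges a b q l"
proof (rule ex_bands)
  fix L U :: "nat \<Rightarrow> real"
  assume LU:
    "\<And>j. j < q \<Longrightarrow> L j < U j" "\<And>j. Suc j < q \<Longrightarrow> U j \<le> L (Suc j)"
    "\<And>j. j < q \<Longrightarrow> \<bar>D (L j)\<bar> = 2" "\<And>j. j < q \<Longrightarrow> \<bar>D (U j)\<bar> = 2"
    "\<And>j x. j < q \<Longrightarrow> L j < x \<Longrightarrow> x < U j \<Longrightarrow> \<bar>D x\<bar> < 2"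
    "\<And>j. j < q \<Longrightarrow> strict_mono_on {L j..U j} D \<or> strict_antimono_on {L j..U j} D"
    "\<And>j. j < q \<Longrightarrow> D ` {L j..U j} = {-2..2}"
  define l where "l = map (\<lambda>i. if even i then L (i div 2) else U (i div 2)) [0..<2 * q]"
  have nth: "l ! (2 * j) = L j" "l ! (2 * j + 1) = U j" if "j < q" for j
    using that by (auto simp: l_def)
  have four: "(D x)\<^sup>2 = 4" if "\<bar>D x\<bar> = 2" for x :: real
    using arg_cong[OF that, of "\<lambda>u. u\<^sup>2"] by simp
  have "is_band_edges a b q l"
    unfolding is_band_edges_def discriminant_eq Let_def
  proof (intro conjI allI impI)
    show "length l = 2 * q" by (simp add: l_def)
    show "\<forall>x\<in>set l. (D x)\<^sup>2 = 4" using LU(3,4) four by (auto simp: l_def)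
    have "D -` {-2..2} = (\<Union>j<q. {L j..U j})" by (rule bands_cover) (use LU in blast)+
    then show "D -` {- 2..2} = (\<Union>j<q. {l ! (2 * j)..l ! (2 * j + 1)})" using nth by auto
    show "l ! (2 * j + 1) \<le> l ! (2 * Suc j)" if "Suc j < q" for j
      using LU(2)[OF that] nth(2)[of j] nth(1)[of "Suc j"] that by simp
  qed (use LU nth in auto)
  then show ?thesis by blast
qed

lemma is_band_edges_facts:
  assumes "is_band_edges a b q l"
    and L_def: "\<And>j. l ! (2 * j) = L j" and U_def: "\<And>j. l ! (2 * j + 1) = U j"
  shows "\<And>j. j < q \<Longrightarrow> L j < U j" "\<And>j. Suc j < q \<Longrightarrow> U j \<le> L (Suc j)"
    "\<And>j. j < q \<Longrightarrow> \<bar>D (L j)\<bar> = 2" "\<And>j. j < q \<Longrightarrow> \<bar>D (U j)\<bar> = 2"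
    "\<And>j x. j < q \<Longrightarrow> L j < x \<Longrightarrow> x < U j \<Longrightarrow> \<bar>D x\<bar> < 2"
    "\<And>j. j < q \<Longrightarrow> strict_mono_on {L j..U j} D \<or> strict_antimono_on {L j..U j} D"
    "\<And>j. j < q \<Longrightarrow> D ` {L j..U j} = {-2..2}"
    "D -` {-2..2} = (\<Union>j<q. {L j..U j})"
proof -
  note * = assms(1)[unfolded is_band_edges_def discriminant_eq Let_def L_def U_def]
  show LU: "L j < U j" if "j < q" for j using * that by simp
  show "U j \<le> L (Suc j)" if "Suc j < q" for j using * that by simp
  have two: "\<bar>D x\<bar> = 2" if "x \<in> set l" for x
  proof -
    have "\<bar>D x\<bar>\<^sup>2 = 2\<^sup>2" using * that by simp
    then show ?thesis by (metis abs_ge_zero power2_eq_iff_nonneg zero_le_numeral)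
  qed
  show DL: "\<bar>D (L j)\<bar> = 2" and DU: "\<bar>D (U j)\<bar> = 2" if "j < q" for j
    using * that by (auto simp flip: L_def U_def intro!: two nth_mem)
  show mono: "strict_mono_on {L j..U j} D \<or> strict_antimono_on {L j..U j} D" if "j < q" for j
    using * that by simp
  show img: "D ` {L j..U j} = {-2..2}" if "j < q" for j using * that by simp
  show "\<bar>D x\<bar> < 2" if j: "j < q" and x: "L j < x" "x < U j" for j x
  proof -
    have "D (L j) < D x \<and> D x < D (U j) \<or> D (U j) < D x \<and> D x < D (L j)"
      using mono[OF j] x by (auto simp: monotone_on_def)
    then show ?thesis using DL[OF j] DU[OF j] by linarith
  qed
  show "D -` {-2..2} = (\<Union>j<q. {L j..U j})" using * by simp
qed

text \<open>Every band contains one zero of \<open>D\<close> in its interior, and both families list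
  all \<open>q\<close> zeros in increasing order; bands of equal index therefore share a zero. Their
  edges are the nearest points on either side with \<bar>D\<bar> = 2.\<close>

lemma is_band_edges_unique:
  assumes "is_band_edges a b q l" "is_band_edges a b q l'"
  shows "l = l'"
proof -
  define L U L' U' where d: "L = (\<lambda>j. l ! (2 * j))" "U = (\<lambda>j. l ! (2 * j + 1))"
    "L' = (\<lambda>j. l' ! (2 * j))" "U' = (\<lambda>j. l' ! (2 * j + 1))"
  have d': "\<And>j. l ! (2 * j) = L j" "\<And>j. l ! (2 * j + 1) = U j"
    "\<And>j. l' ! (2 * j) = L' j" "\<And>j. l' ! (2 * j + 1) = U' j" by (simp_all add: d)
  note f = is_band_edges_facts[OF assms(1) d'(1,2)] and f' = is_band_edges_facts[OF assms(2) d'(3,4)]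
  have zeros: "\<exists>w. (\<forall>j<q. M j < w j \<and> w j < N j) \<and> map w [0..<q] = sorted_list_of_set {x::real. D x = 0}"
    if "is_band_edges a b q m" "\<And>j. m ! (2 * j) = M j" "\<And>j. m ! (2 * j + 1) = N j" for m M N
  proof -
    note g = is_band_edges_facts[OF that]
    have "\<exists>w. M j < w \<and> w < N j \<and> D w = 0" if "j < q" for j
    proof -
      have "0 \<in> D ` {M j..N j}" unfolding g(7)[OF that] by auto
      then obtain w where w: "M j \<le> w" "w \<le> N j" "D w = 0" by auto
      moreover have "w \<noteq> M j" "w \<noteq> N j" using w g(3,4)[OF that] by auto
      ultimately show ?thesis by (intro exI[of _ w]) auto
    qed
    then obtain w where w: "\<And>j. j < q \<Longrightarrow> M j < w j \<and> w j < N j \<and> D (w j) = 0" by metis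
    have lt: "w i < w j" if "i < j" "j < q" for i j
      using ordered_intervals_le[of q M N i j] g(1,2) that w[of i] w[of j] by fastforce
    have ss: "sorted_wrt (<) (map w [0..<q])"
      using lt by (auto simp: sorted_wrt_iff_nth_less)
    then have "card (set (map w [0..<q])) = q"
      by (simp add: distinct_card strict_sorted_iff del: set_map)
    then have "set (map w [0..<q]) = {x. D x = 0}"
      by (intro card_subset_eq[OF finite_D_level]) (use w card_D_zeros in auto)
    then have "map w [0..<q] = sorted_list_of_set {x. D x = 0}"
      using ss by (metis sorted_list_of_set.idem_if_sorted_distinct strict_sorted_iff)
    then show ?thesis using w by blast
  qed
  obtain w where w: "\<And>j. j < q \<Longrightarrow> L j < w j \<and> w j < U j" "map w [0..<q] = sorted_list_of_set {x. D x = 0}"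
    using zeros[OF assms(1) d'(1,2)] by auto
  obtain w' where w': "\<And>j. j < q \<Longrightarrow> L' j < w' j \<and> w' j < U' j" "map w' [0..<q] = sorted_list_of_set {x. D x = 0}"
    using zeros[OF assms(2) d'(3,4)] by auto
  have ww: "w j = w' j" if "j < q" for j
    using w(2) w'(2) that by (metis atLeastLessThan_iff le0 map_eq_conv set_upt)
  have L: "L j = L' j" and U: "U j = U' j" if j: "j < q" for j
  proof -
    show "L j = L' j"
      using f(5)[of j "L' j"] f'(5)[of j "L j"] f(3)[of j] f'(3)[of j] w(1)[of j] w'(1)[of j] ww[of j] j
      by (cases "L j" "L' j" rule: linorder_cases) auto
    show "U j = U' j"
      using f(5)[of j "U' j"] f'(5)[of j "U j"] f(4)[of j] f'(4)[of j] w(1)[of j] w'(1)[of j] ww[of j] j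
      by (cases "U j" "U' j" rule: linorder_cases) auto
  qed
  have len: "length l = 2 * q" "length l' = 2 * q" using assms by (auto simp: is_band_edges_def)
  show ?thesis
  proof (rule nth_equalityI)
    fix i assume "i < length l"
    then have i: "i div 2 < q" using len by auto
    show "l ! i = l' ! i"
      using L[OF i] U[OF i] by (cases "even i") (auto simp: d elim!: evenE oddE)
  qed (use len in simp)
qed

lemma band_edges: "is_band_edges a b q (band_edges a b q)"
  unfolding band_edges_def
  by (rule theI') (use is_band_edges_exists is_band_edges_unique in blast)

section \<open>Phase functions\<close>

definition lower :: "nat \<Rightarrow> real" where "lower j = band_edges a b q ! (2 * j)"
definition upper :: "nat \<Rightarrow> real" where "upper j = band_edges a b q ! (2 * j + 1)"

lemma band_eq: "band a b q j = {lower j..upper j}"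
  by (simp add: band_def lower_def upper_def)

lemmas band_facts = is_band_edges_facts[OF band_edges lower_def[symmetric] upper_def[symmetric]]

abbreviation phase :: "nat \<Rightarrow> real \<Rightarrow> real" where "phase \<equiv> phase_fun a b q"

lemma inj_on_D: "j < q \<Longrightarrow> inj_on D {lower j..upper j}"
proof (rule inj_onI)
  fix x y assume j: "j < q" and xy: "x \<in> {lower j..upper j}" "y \<in> {lower j..upper j}" "D x = D y"
  show "x = y"
    using band_facts(6)[OF j] xy unfolding monotone_on_def
    by (metis linorder_neqE_linordered_idom less_irrefl)
qed

lemma phase_in: "j < q \<Longrightarrow> phase j \<phi> \<in> {lower j..upper j}"
  and D_phase: "j < q \<Longrightarrow> D (phase j \<phi>) = 2 * cos \<phi>"
proof -
  assume j: "j < q"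
  have c: "2 * cos \<phi> \<in> D ` {lower j..upper j}"
    unfolding band_facts(7)[OF j] using cos_ge_minus_one[of \<phi>] cos_le_one[of \<phi>] by auto
  show "phase j \<phi> \<in> {lower j..upper j}"
    unfolding phase_fun_def band_eq discriminant_eq
    by (rule the_inv_into_into[OF inj_on_D[OF j] c order_refl])
  show "D (phase j \<phi>) = 2 * cos \<phi>"
    unfolding phase_fun_def band_eq discriminant_eq
    by (rule f_the_inv_into_f[OF inj_on_D[OF j] c])
qed

text \<open>The inverse of a continuous injection on a compact band is continuous. Only the cosine
  enters, so this holds on the whole line and not just on \<open>{-pi..0}\<close>.\<close>

lemma continuous_phase: "j < q \<Longrightarrow> continuous_on A (phase j)"
proof -
  assume j: "j < q"
  have "continuous_on (D ` {lower j..upper j}) (the_inv_into {lower j..upper j} D)"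
    by (rule continuous_on_inv)
      (auto intro!: continuous_intros the_inv_into_f_f[OF inj_on_D[OF j]])
  then have "continuous_on {-2..2} (the_inv_into {lower j..upper j} D)"
    by (simp add: band_facts(7)[OF j])
  then have "continuous_on A (\<lambda>\<phi>. the_inv_into {lower j..upper j} D (2 * cos \<phi>))"
    by (rule continuous_on_compose2) (auto intro!: continuous_intros simp: cos_ge_minus_one)
  then show ?thesis by (simp add: phase_fun_def[abs_def] band_eq discriminant_eq)
qed

lemma phase_inside:
  assumes j: "j < q" and "sin \<phi> \<noteq> 0"
  shows "lower j < phase j \<phi>" "phase j \<phi> < upper j" "\<bar>D (phase j \<phi>)\<bar> < 2"
proof -
  have "(cos \<phi>)\<^sup>2 < 1" using assms(2) by (simp add: cos_squared_eq)
  then have "\<bar>cos \<phi>\<bar> < 1" by (simp add: abs_square_less_1)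
  then show "\<bar>D (phase j \<phi>)\<bar> < 2" using D_phase[OF j, of \<phi>] by simp
  then show "lower j < phase j \<phi>" "phase j \<phi> < upper j"
    using band_facts(3,4)[OF j] phase_in[OF j, of \<phi>] by (auto simp: less_le)
qed

text \<open>Neighbouring bands may touch, so strictness requires one of the two points to be
  interior to its band.\<close>

lemma phase_mono_index:
  assumes "i < j" "j < q" "sin \<phi> \<noteq> 0"
  shows "phase i \<phi> < phase j \<theta>"
proof -
  have "upper i \<le> lower j"
    using ordered_intervals_le[of q lower upper i j] band_facts(1,2) assms by auto
  then show ?thesis
    using phase_inside(2)[of i \<phi>] phase_in[of j \<theta>] assms by auto
qed

end

section \<open>Resolution of the identity\<close>

text \<open>The left-hand sides form a symmetric projection of trace \<open>M\<close>, hence a matrix at squared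
  Hilbert-Schmidt distance \<open>M - 2 M + M = 0\<close> from the identity.\<close>

lemma orthogonal_system_complete:
  fixes f :: "'a \<Rightarrow> nat \<Rightarrow> real"
  assumes fin: "finite Z" and card: "card Z = M"
    and orth: "\<And>x y. x \<in> Z \<Longrightarrow> y \<in> Z \<Longrightarrow> x \<noteq> y \<Longrightarrow> (\<Sum>k<M. f x k * f y k) = 0"
    and pos: "\<And>x. x \<in> Z \<Longrightarrow> 0 < (\<Sum>k<M. (f x k)\<^sup>2)"
    and nm: "n < M" "m < M"
  shows "(\<Sum>x\<in>Z. f x n * f x m / (\<Sum>k<M. (f x k)\<^sup>2)) = (if n = m then 1 else 0)"
proof -
  define S where "S x = (\<Sum>k<M. (f x k)\<^sup>2)" for x
  define e where "e n m = (\<Sum>x\<in>Z. f x n * f x m / S x)" for n m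
  define d where "d n m = (if n = m then 1 else 0 :: real)" for n m :: nat
  have Spos: "0 < S x" if "x \<in> Z" for x using pos[OF that] by (simp add: S_def)
  have tr: "(\<Sum>n<M. e n n) = M"
  proof -
    have "(\<Sum>n<M. e n n) = (\<Sum>x\<in>Z. \<Sum>n<M. f x n * f x n / S x)"
      unfolding e_def by (rule sum.swap)
    also have "\<dots> = (\<Sum>x\<in>Z. 1)"
    proof (rule sum.cong[OF refl])
      fix x assume "x \<in> Z"
      then show "(\<Sum>n<M. f x n * f x n / S x) = 1"
        using Spos[of x] by (simp add: S_def power2_eq_square flip: sum_divide_distrib)
    qed
    finally show ?thesis using card by simp
  qed
  have sq: "(\<Sum>n<M. \<Sum>m<M. (e n m)\<^sup>2) = M"
  proof -
    have "(\<Sum>n<M. \<Sum>m<M. (e n m)\<^sup>2)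
        = (\<Sum>n<M. \<Sum>m<M. \<Sum>x\<in>Z. \<Sum>y\<in>Z. (f x n * f y n) * (f x m * f y m) / (S x * S y))"
      unfolding e_def power2_eq_square sum_product
      by (intro sum.cong refl) (simp add: mult_ac)
    also have "\<dots> = (\<Sum>n<M. \<Sum>x\<in>Z. \<Sum>m<M. \<Sum>y\<in>Z. (f x n * f y n) * (f x m * f y m) / (S x * S y))"
      by (intro sum.cong refl sum.swap)
    also have "\<dots> = (\<Sum>x\<in>Z. \<Sum>n<M. \<Sum>m<M. \<Sum>y\<in>Z. (f x n * f y n) * (f x m * f y m) / (S x * S y))"
      by (rule sum.swap)
    also have "\<dots> = (\<Sum>x\<in>Z. \<Sum>n<M. \<Sum>y\<in>Z. \<Sum>m<M. (f x n * f y n) * (f x m * f y m) / (S x * S y))"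
      by (intro sum.cong refl sum.swap)
    also have "\<dots> = (\<Sum>x\<in>Z. \<Sum>y\<in>Z. \<Sum>n<M. \<Sum>m<M. (f x n * f y n) * (f x m * f y m) / (S x * S y))"
      by (intro sum.cong refl sum.swap)
    also have "\<dots> = (\<Sum>x\<in>Z. \<Sum>y\<in>Z. (\<Sum>n<M. f x n * f y n)\<^sup>2 / (S x * S y))"
      by (intro sum.cong refl)
        (simp add: power2_eq_square sum_product sum_divide_distrib)
    also have "\<dots> = (\<Sum>x\<in>Z. \<Sum>y\<in>Z. if y = x then 1 else 0)"
    proof (intro sum.cong refl)
      fix x y assume xy: "x \<in> Z" "y \<in> Z"
      show "(\<Sum>n<M. f x n * f y n)\<^sup>2 / (S x * S y) = (if y = x then 1 else 0)"
      proof (cases "x = y")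
        case True
        have "(\<Sum>n<M. f x n * f y n) = S x" by (simp add: True S_def power2_eq_square)
        then show ?thesis using Spos[OF xy(1)] True by (simp add: power2_eq_square)
      qed (use orth xy in auto)
    qed
    finally show ?thesis using fin card by simp
  qed
  have "(\<Sum>n<M. \<Sum>m<M. (e n m - d n m)\<^sup>2)
      = (\<Sum>n<M. \<Sum>m<M. (e n m)\<^sup>2) + (\<Sum>n<M. \<Sum>m<M. if m = n then 1 - 2 * e n n else 0)"
    unfolding sum.distrib[symmetric]
    by (intro sum.cong refl) (auto simp: d_def power2_eq_square algebra_simps)
  also have "\<dots> = real M + (real M - 2 * real M)"
    using tr by (simp add: sq sum_subtractf flip: sum_distrib_left)
  finally have "(\<Sum>n<M. \<Sum>m<M. (e n m - d n m)\<^sup>2) = 0" by simp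
  then have "\<forall>n\<in>{..<M}. (\<Sum>m<M. (e n m - d n m)\<^sup>2) = 0"
    by (subst (asm) sum_nonneg_eq_0_iff) (auto intro: sum_nonneg)
  then have "(\<Sum>m<M. (e n m - d n m)\<^sup>2) = 0" using nm by simp
  then have "\<forall>m\<in>{..<M}. (e n m - d n m)\<^sup>2 = 0"
    by (subst (asm) sum_nonneg_eq_0_iff) auto
  then have "e n m = d n m" using nm by simp
  then show ?thesis by (simp add: e_def d_def S_def)
qed

text \<open>Multiplied by \<open>2 * sin \<phi>\<close> the sum telescopes, and the arguments at its
  two ends differ by \<open>2 * N * \<phi>\<close>, a period.\<close>

lemma sum_cos_arith_zero:
  assumes "sin (real N * \<phi>) = 0" "sin \<phi> \<noteq> 0"
  shows "(\<Sum>l<N. cos (2 * real l * \<phi> + c)) = 0"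
proof -
  have "2 * sin \<phi> * (\<Sum>l<n. cos (2 * real l * \<phi> + c))
      = sin ((2 * real n - 1) * \<phi> + c) - sin (- \<phi> + c)" for n
  proof (induction n)
    case (Suc n)
    have "2 * sin \<phi> * cos (2 * real n * \<phi> + c)
        = sin ((2 * real n * \<phi> + c) + \<phi>) - sin ((2 * real n * \<phi> + c) - \<phi>)"
      by (simp only: sin_add sin_diff) simp
    moreover have "(2 * real n * \<phi> + c) + \<phi> = (2 * real (Suc n) - 1) * \<phi> + c"
      "(2 * real n * \<phi> + c) - \<phi> = (2 * real n - 1) * \<phi> + c"
      by (simp_all add: algebra_simps)
    ultimately show ?case using Suc by (simp only: sum.lessThan_Suc distrib_left)
  qed (simp add: algebra_simps)
  from this[of N] have "2 * sin \<phi> * (\<Sum>l<N. cos (2 * real l * \<phi> + c))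
      = sin (2 * (real N * \<phi>) + (c - \<phi>)) - sin (c - \<phi>)"
    by (simp add: algebra_simps)
  moreover have "cos (2 * (real N * \<phi>)) = 1" "sin (2 * (real N * \<phi>)) = 0"
    using assms(1) by (simp_all add: cos_double_sin sin_double)
  ultimately have "2 * sin \<phi> * (\<Sum>l<N. cos (2 * real l * \<phi> + c)) = 0" by (simp add: sin_add)
  then show ?thesis using assms(2) by simp
qed

text \<open>Expanding the square into double angles leaves a mean value and three oscillating sums,
  which vanish by \<open>sum_cos_arith_zero\<close>.\<close>

lemma sum_sin_combination:
  assumes "sin (real N * \<phi>) = 0" "sin \<phi> \<noteq> 0"
  shows "(\<Sum>l<N. (sin (real l * \<phi>) * s - sin ((real l - 1) * \<phi>) * p)\<^sup>2)
    = real N / 2 * (s\<^sup>2 - 2 * cos \<phi> * s * p + p\<^sup>2)"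
proof -
  have pt: "(sin (real l * \<phi>) * s - sin ((real l - 1) * \<phi>) * p)\<^sup>2
      = (s\<^sup>2 - 2 * cos \<phi> * s * p + p\<^sup>2) / 2 - s\<^sup>2 / 2 * cos (2 * real l * \<phi> + 0)
        - p\<^sup>2 / 2 * cos (2 * real l * \<phi> + (- 2 * \<phi>)) + s * p * cos (2 * real l * \<phi> + (- \<phi>))" for l
  proof -
    define u v where "u = real l * \<phi>" and "v = (real l - 1) * \<phi>"
    have e: "2 * real l * \<phi> + 0 = 2 * u" "2 * real l * \<phi> + (- 2 * \<phi>) = 2 * v"
      "2 * real l * \<phi> + (- \<phi>) = u + v" and c: "\<phi> = u - v"
      by (simp_all add: u_def v_def algebra_simps)
    have c': "cos \<phi> = cos u * cos v + sin u * sin v" by (simp add: c cos_diff)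
    show ?thesis
      unfolding e c' unfolding cos_double_sin cos_add u_def[symmetric] v_def[symmetric]
      by (simp add: power2_eq_square field_simps)
  qed
  show ?thesis
    by (simp only: pt sum.distrib sum_subtractf sum_distrib_left[symmetric] sum_cos_arith_zero[OF assms]
        sum_constant) simp
qed

text \<open>Continuity is available in the open interval only, because the spectral density may jump
  at the band edges. The Riemann sums are therefore written as integrals of step functions and
  handled by dominated convergence.\<close>

lemma riemann_sum_tendsto:
  fixes f :: "real \<Rightarrow> real"
  assumes cd: "c < d" and cont: "continuous_on {c<..<d} f" and bd: "\<And>x. \<bar>f x\<bar> \<le> B"
  shows "f integrable_on {c..d}"
    "(\<lambda>N. (d - c) / N * (\<Sum>k=1..<N. f (c + (d - c) * real k / real N))) \<longlonglongrightarrow> integral {c..d} f"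
proof -
  \<comment> \<open>\<open>g\<close> vanishes at both ends, so the node \<open>k = N\<close> may be
    added to the sum. \<open>s N\<close> takes the value of \<open>g\<close> at the first grid point
    not to the left of \<open>x\<close>, which the ceiling computes.\<close>
  define g where "g x = (if c < x \<and> x < d then f x else 0)" for x
  define s where "s N x = g (c + (d - c) / N * \<lceil>(x - c) / ((d - c) / N)\<rceil>)" for N :: nat and x
  have step: "(s N has_integral (d - c) / N * (\<Sum>k<K. g (c + (d - c) / N * (Suc k))))
      {c..c + (d - c) / N * K}" if N: "0 < N" for N K
  proof (induction K)
    case (Suc K)
    define h where "h = (d - c) / N"
    have h: "0 < h" using N cd by (simp add: h_def)
    have "(s N has_integral (h * g (c + h * Suc K))) {c + h * K..c + h * Suc K}"
    proof (rule has_integral_spike_finite[of "{c + h * K}"])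
      show "((\<lambda>x. g (c + h * Suc K)) has_integral h * g (c + h * Suc K)) {c + h * K..c + h * Suc K}"
        using has_integral_const_real[of "g (c + h * Suc K)" "c + h * K" "c + h * Suc K"] h
        by (simp add: algebra_simps)
      fix x assume x: "x \<in> {c + h * K..c + h * Suc K} - {c + h * K}"
      then have "real K < (x - c) / h" "(x - c) / h \<le> real K + 1"
        using h by (auto simp: field_simps)
      then have "\<lceil>(x - c) / h\<rceil> = int (Suc K)"
        by (simp add: ceiling_eq_iff)
      then show "s N x = g (c + h * Suc K)" by (simp add: s_def h_def[symmetric])
    qed simp
    from has_integral_combine[OF _ _ Suc this[unfolded h_def]] show ?case
      using h by (simp add: h_def[symmetric] distrib_left mult_left_mono)
  qed (simp add: has_integral_refl)
  have int_s: "(s N has_integral (d - c) / N * (\<Sum>k=1..<N. f (c + (d - c) * real k / real N))) {c..d}"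
    if N: "0 < N" for N
  proof -
    have "(\<Sum>k<N. g (c + (d - c) / N * (Suc k))) = (\<Sum>k=1..<Suc N. g (c + (d - c) / N * real k))"
      by (simp only: One_nat_def sum.shift_bounds_Suc_ivl lessThan_atLeast0)
    also have "\<dots> = (\<Sum>k=1..<N. g (c + (d - c) / N * real k)) + g (c + (d - c) / N * N)"
      using N by simp
    also have "g (c + (d - c) / N * N) = 0" using N by (simp add: g_def)
    also have "(\<Sum>k=1..<N. g (c + (d - c) / N * real k)) = (\<Sum>k=1..<N. f (c + (d - c) * real k / real N))"
    proof (rule sum.cong[OF refl])
      fix k assume k: "k \<in> {1..<N}"
      then have "0 < (d - c) * (k / N)" using cd by simp
      moreover have "(d - c) * (k / N) < (d - c) * 1"
        by (rule mult_strict_left_mono) (use cd k in auto)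
      ultimately show "g (c + (d - c) / N * real k) = f (c + (d - c) * real k / real N)" by (simp add: g_def)
    qed
    finally show ?thesis using step[OF N, of N] N by simp
  qed
  have B0: "0 \<le> B" using bd[of 0] by simp
  have lim: "(\<lambda>N. s (Suc N) x) \<longlonglongrightarrow> g x" if x: "x \<in> {c..d}" for x
  proof (cases "c < x \<and> x < d")
    case False
    then consider "x = c" | "x = d" using x by force
    then have "s (Suc N) x = g x" for N
    proof cases
      case 2
      have "(d - c) / ((d - c) / Suc N) = of_int (int (Suc N))" using cd by simp
      then have "\<lceil>(d - c) / ((d - c) / Suc N)\<rceil> = int (Suc N)" by (metis ceiling_of_int)
      then show ?thesis using 2 by (simp add: s_def del: of_nat_Suc)
    qed (simp add: s_def)
    then show ?thesis by simp
  next
    case True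
    define p where "p N = c + (d - c) / Suc N * \<lceil>(x - c) / ((d - c) / Suc N)\<rceil>" for N
    have "p \<longlonglongrightarrow> x"
    proof (rule tendsto_sandwich)
      have h: "0 < (d - c) / Suc N" for N using cd by simp
      show "\<forall>\<^sub>F N in sequentially. x \<le> p N"
      proof (intro always_eventually allI)
        fix N
        have "x - c = (d - c) / Suc N * ((x - c) / ((d - c) / Suc N))" using h[of N] cd by simp
        also have "\<dots> \<le> (d - c) / Suc N * \<lceil>(x - c) / ((d - c) / Suc N)\<rceil>"
          using h[of N] by (intro mult_left_mono) (auto simp: le_of_int_ceiling)
        finally show "x \<le> p N" by (simp add: p_def)
      qed
      show "\<forall>\<^sub>F N in sequentially. p N \<le> x + (d - c) / Suc N"
      proof (intro always_eventually allI)
        fix N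
        have "(d - c) / Suc N * \<lceil>(x - c) / ((d - c) / Suc N)\<rceil>
            \<le> (d - c) / Suc N * ((x - c) / ((d - c) / Suc N) + 1)"
          using h[of N] by (intro mult_left_mono) (auto intro: of_int_ceiling_le_add_one)
        also have "\<dots> = (x - c) + (d - c) / Suc N" using h[of N] cd by (simp add: distrib_left del: of_nat_Suc)
        finally show "p N \<le> x + (d - c) / Suc N" by (simp add: p_def)
      qed
      have "(\<lambda>N. x + (d - c) * inverse (real (Suc N))) \<longlonglongrightarrow> x + (d - c) * 0"
        by (intro tendsto_intros LIMSEQ_inverse_real_of_nat)
      then show "(\<lambda>N. x + (d - c) / Suc N) \<longlonglongrightarrow> x" by (simp add: divide_inverse)
    qed simp
    moreover have "isCont g x"
    proof -
      have "isCont f x" using cont True by (simp add: continuous_on_eq_continuous_at)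
      moreover have "\<forall>\<^sub>F y in nhds x. g y = f y"
        using eventually_nhds_in_open[of "{c<..<d}" x] True
        by (auto elim!: eventually_mono simp: g_def)
      ultimately show ?thesis by (simp add: isCont_cong)
    qed
    ultimately have "(\<lambda>N. g (p N)) \<longlonglongrightarrow> g x" by (rule isCont_tendsto_compose[rotated])
    then show ?thesis by (simp add: s_def p_def)
  qed
  have gB: "\<bar>g x\<bar> \<le> B" for x using bd[of x] B0 by (simp add: g_def)
  have "\<And>N. s (Suc N) integrable_on {c..d}"
    using int_s by (meson has_integral_integrable zero_less_Suc)
  moreover have "(\<lambda>_. B) integrable_on {c..d}" by (rule integrable_const_ivl)
  moreover have "\<And>N x. norm (s (Suc N) x) \<le> B" unfolding s_def real_norm_def by (rule gB)
  ultimately have dom: "g integrable_on {c..d}"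
    "(\<lambda>N. integral {c..d} (s (Suc N))) \<longlonglongrightarrow> integral {c..d} g"
    using dominated_convergence[of "\<lambda>N. s (Suc N)" "{c..d}" "\<lambda>_. B" g] lim by blast+
  have gf: "integral {c..d} g = integral {c..d} f"
    by (rule integral_spike[of "{c, d}"]) (auto simp: g_def)
  show "f integrable_on {c..d}"
    by (rule integrable_spike[OF dom(1), of "{c, d}"]) (auto simp: g_def)
  have "(\<lambda>N. (d - c) / Suc N * (\<Sum>k=1..<Suc N. f (c + (d - c) * real k / real (Suc N)))) \<longlonglongrightarrow> integral {c..d} f"
    using dom(2) integral_unique[OF int_s[of "Suc _"]] by (simp add: gf)
  then show "(\<lambda>N. (d - c) / N * (\<Sum>k=1..<N. f (c + (d - c) * real k / real N))) \<longlonglongrightarrow> integral {c..d} f"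
    by (rule LIMSEQ_imp_Suc)
qed

section \<open>Solutions on the bands and the spectral density\<close>

context periodic_coeffs
begin

text \<open>Both sides obey \<open>u (l + 2) = 2 * cos \<phi> * u (l + 1) - u l\<close> and agree
  for \<open>l = 0\<close> and \<open>l = 1\<close>. The factor \<open>sin \<phi>\<close> stays on
  the left so that band edges are included.\<close>

lemma sin_mult_sol:
  fixes x :: real
  assumes x: "D x = 2 * cos \<phi>"
  shows "sin \<phi> * P (l * q + r) x = sin (real l * \<phi>) * P (q + r) x - sin ((real l - 1) * \<phi>) * P r x"
    "sin \<phi> * V (l * q) x = sin (real l * \<phi>) * V q x"
proof (induction l rule: induct_nat_012)
  case (ge2 n)
  have s: "2 * cos \<phi> * sin u = sin (u + \<phi>) + sin (u - \<phi>)" for u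
    by (simp add: sin_add sin_diff)
  have u: "2 * cos \<phi> * sin (real (Suc n) * \<phi>) = sin (real (Suc (Suc n)) * \<phi>) + sin (real n * \<phi>)"
    using s[of "real (Suc n) * \<phi>"] by (simp add: algebra_simps)
  have v: "2 * cos \<phi> * sin (real n * \<phi>) = sin (real (Suc n) * \<phi>) + sin ((real n - 1) * \<phi>)"
    using s[of "real n * \<phi>"] by (simp add: algebra_simps)
  {
    case 1
    have "P (Suc (Suc n) * q + r) x = D x * P (Suc n * q + r) x - P (n * q + r) x"
    proof -
      have "Suc (Suc n) * q + r = (n * q + r) + 2 * q" "Suc n * q + r = (n * q + r) + q" by simp_all
      then show ?thesis using shift_two_periods(1)[of "n * q + r" x] by (simp only:)
    qed
    then have "sin \<phi> * P (Suc (Suc n) * q + r) x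
        = 2 * cos \<phi> * (sin \<phi> * P (Suc n * q + r) x) - sin \<phi> * P (n * q + r) x"
      by (simp only: x right_diff_distrib mult_ac)
    also have "\<dots> = (2 * cos \<phi> * sin (real (Suc n) * \<phi>) - sin (real n * \<phi>)) * P (q + r) x
        - (2 * cos \<phi> * sin (real n * \<phi>) - sin ((real n - 1) * \<phi>)) * P r x"
      unfolding ge2 by (simp add: algebra_simps)
    finally show ?case unfolding u v by simp
  next
    case 2
    have "V (Suc (Suc n) * q) x = D x * V (Suc n * q) x - V (n * q) x"
    proof -
      have "Suc (Suc n) * q = n * q + 2 * q" "Suc n * q = n * q + q" by simp_all
      then show ?thesis using shift_two_periods(2)[of "n * q" x] by (simp only:)
    qed
    then have "sin \<phi> * V (Suc (Suc n) * q) x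
        = 2 * cos \<phi> * (sin \<phi> * V (Suc n * q) x) - sin \<phi> * V (n * q) x"
      by (simp only: x right_diff_distrib mult_ac)
    also have "\<dots> = (2 * cos \<phi> * sin (real (Suc n) * \<phi>) - sin (real n * \<phi>)) * V q x"
      unfolding ge2 by (simp add: algebra_simps)
    finally show ?case unfolding u by simp
  }
qed simp_all

text \<open>These are the reciprocal Christoffel numbers of the quadrature, times the squared sine:
  the sum over \<open>N\<close> periods averages the squares and the sum over one period assembles
  \<open>W\<close>.\<close>

lemma sum_P_sq_at_level:
  fixes x :: real
  assumes x: "D x = 2 * cos \<phi>" and N: "sin (real N * \<phi>) = 0" "sin \<phi> \<noteq> 0"
  shows "(sin \<phi>)\<^sup>2 * (\<Sum>i<N * q. (P i x)\<^sup>2) = real N / 2 * W x"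
proof -
  have "(\<Sum>i<N * q. (P i x)\<^sup>2) = (\<Sum>l<N. \<Sum>r<q. (P (l * q + r) x)\<^sup>2)"
  proof -
    have "(\<Sum>i\<in>{l * q..<l * q + q}. g i) = (\<Sum>r<q. g (l * q + r))" for g :: "nat \<Rightarrow> real" and l
      using sum.shift_bounds_nat_ivl[of g 0 "l * q" q] by (simp add: lessThan_atLeast0 add.commute)
    then show ?thesis by (simp flip: sum.nat_group)
  qed
  then have "(sin \<phi>)\<^sup>2 * (\<Sum>i<N * q. (P i x)\<^sup>2) = (\<Sum>l<N. \<Sum>r<q. (sin \<phi> * P (l * q + r) x)\<^sup>2)"
    by (simp add: sum_distrib_left power_mult_distrib)
  also have "\<dots> = (\<Sum>r<q. \<Sum>l<N. (sin (real l * \<phi>) * P (q + r) x - sin ((real l - 1) * \<phi>) * P r x)\<^sup>2)"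
    unfolding sin_mult_sol[OF x] by (rule sum.swap)
  also have "\<dots> = real N / 2 * W x"
    unfolding sum_sin_combination[OF N] W_eq x by (simp add: sum_distrib_left)
  finally show ?thesis .
qed

text \<open>\<open>sin \<phi> * P n x\<close> is the scalar product of the unit vector with entries
  \<open>sin (l * \<phi>)\<close>, \<open>cos (l * \<phi>)\<close> and a vector whose squared length
  is a summand of \<open>W\<close>. The bound is uniform in \<open>n\<close> and needs no lower
  bound for \<open>W\<close> near the band edges.\<close>

lemma sin_P_bound:
  fixes x :: real
  assumes x: "D x = 2 * cos \<phi>"
  shows "(sin \<phi> * P n x)\<^sup>2 \<le> W x"
proof -
  define l r where "l = n div q" and "r = n mod q"
  define s p where "s = P (q + r) x" and "p = P r x"
  have r: "r < q" using q_pos by (simp add: r_def)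
  have "(sin \<phi> * P n x)\<^sup>2 = (sin (real l * \<phi>) * s - sin ((real l - 1) * \<phi>) * p)\<^sup>2"
    using sin_mult_sol(1)[OF x, of l r] by (simp add: l_def r_def s_def p_def)
  also have "sin ((real l - 1) * \<phi>) = sin (real l * \<phi>) * cos \<phi> - cos (real l * \<phi>) * sin \<phi>"
    by (simp add: left_diff_distrib sin_diff)
  also have "(sin (real l * \<phi>) * s - (sin (real l * \<phi>) * cos \<phi> - cos (real l * \<phi>) * sin \<phi>) * p)\<^sup>2
      \<le> s\<^sup>2 - 2 * cos \<phi> * s * p + p\<^sup>2"
  proof -
    define S C X Y where d: "S = sin (real l * \<phi>)" "C = cos (real l * \<phi>)" "X = s - cos \<phi> * p" "Y = sin \<phi> * p"
    have "S\<^sup>2 + C\<^sup>2 = 1" by (simp add: d)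
    then have "X\<^sup>2 + Y\<^sup>2 - (S * X + C * Y)\<^sup>2 = (C * X - S * Y)\<^sup>2"
      by (simp add: power2_eq_square) algebra
    moreover have "X\<^sup>2 + Y\<^sup>2 = s\<^sup>2 - 2 * cos \<phi> * s * p + ((cos \<phi>)\<^sup>2 + (sin \<phi>)\<^sup>2) * p\<^sup>2"
      by (simp only: d power2_eq_square) algebra
    moreover have "S * s - (S * cos \<phi> - C * sin \<phi>) * p = S * X + C * Y"
      by (simp add: d algebra_simps)
    ultimately have "(S * s - (S * cos \<phi> - C * sin \<phi>) * p)\<^sup>2
        = s\<^sup>2 - 2 * cos \<phi> * s * p + p\<^sup>2 - (C * X - S * Y)\<^sup>2" by simp
    then show ?thesis unfolding d(1,2)[symmetric] by simp
  qed
  also have "\<dots> \<le> W x"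
  proof -
    have D2: "\<bar>D x\<bar> \<le> 2" using abs_cos_le_one[of \<phi>] unfolding x abs_mult by simp
    have "(P (q + r) x)\<^sup>2 - D x * P (q + r) x * P r x + (P r x)\<^sup>2 \<le> W x"
      unfolding W_eq
      by (rule member_le_sum[where A = "{..<q}"
            and f = "\<lambda>r. (P (q + r) x)\<^sup>2 - D x * P (q + r) x * P r x + (P r x)\<^sup>2"])
        (use r W_term_nonneg[OF D2] in auto)
    then show ?thesis by (simp add: x s_def p_def)
  qed
  finally show ?thesis .
qed

text \<open>Density in \<open>\<phi>\<close>, up to the factor \<open>2 / pi\<close>, of the
  spectral measure of the index pair \<open>n\<close>, \<open>m\<close>. Where \<open>W\<close>
  vanishes the division yields 0, which concerns only multiples of pi.\<close>

definition spectral_density :: "nat \<Rightarrow> nat \<Rightarrow> nat \<Rightarrow> real \<Rightarrow> real" where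
  "spectral_density j n m \<phi> = (sin \<phi>)\<^sup>2 * P n (phase j \<phi>) * P m (phase j \<phi>) / W (phase j \<phi>)"

lemma density_bound:
  assumes j: "j < q"
  shows "\<bar>spectral_density j n m \<phi>\<bar> \<le> 1"
proof (cases "sin \<phi> = 0")
  case False
  define x where "x = phase j \<phi>"
  have W: "0 < W x" using W_pos_inside phase_inside[OF j False] by (simp add: x_def)
  have b: "\<bar>sin \<phi> * P k x\<bar> \<le> sqrt (W x)" for k
    using sin_P_bound[of x \<phi> k] D_phase[OF j] real_sqrt_le_mono by (fastforce simp: x_def)
  have "\<bar>(sin \<phi> * P n x) * (sin \<phi> * P m x)\<bar> \<le> sqrt (W x) * sqrt (W x)"
    unfolding abs_mult[of "sin \<phi> * P n x"] by (intro mult_mono b) (use W in auto)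
  then show ?thesis
    using W by (simp add: spectral_density_def x_def[symmetric] power2_eq_square mult_ac abs_divide)
qed (simp add: spectral_density_def)

lemma continuous_density:
  assumes j: "j < q"
  shows "continuous_on {-pi<..<0} (spectral_density j n m)"
proof -
  have "W (phase j \<phi>) \<noteq> 0" if "\<phi> \<in> {-pi<..<0}" for \<phi>
  proof -
    have "sin \<phi> \<noteq> 0" using that sin_gt_zero[of "- \<phi>"] by auto
    then show ?thesis using W_pos_inside phase_inside[OF j] by fastforce
  qed
  then show ?thesis
    unfolding spectral_density_def[abs_def] by (intro continuous_intros continuous_phase[OF j]) auto
qed

text \<open>Mass of the point \<open>y\<close>. A zero of \<open>V q\<close> at which the solution
  is not square summable gets 0, so the quadrature points common to all \<open>N\<close> can be kept
  in one sum.\<close>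

definition weight :: "real \<Rightarrow> real" where
  "weight y = (if summable (\<lambda>k. (P k y)\<^sup>2) then 1 / (\<Sum>k. (P k y)\<^sup>2) else 0)"

text \<open>In the divergent case the partial sums increase to infinity, which matches the value
  0.\<close>

lemma weight_limit: "(\<lambda>n. 1 / (\<Sum>k<n. (P k y)\<^sup>2)) \<longlonglongrightarrow> weight y"
proof (cases "summable (\<lambda>k. (P k y)\<^sup>2)")
  case True
  have "0 < (\<Sum>k<1. (P k y)\<^sup>2)" by simp
  also have "\<dots> \<le> (\<Sum>k. (P k y)\<^sup>2)" by (rule sum_le_suminf[OF True]) auto
  finally show ?thesis
    using summable_LIMSEQ[OF True] True by (auto simp: weight_def intro!: tendsto_intros)
next
  case False
  have "filterlim (\<lambda>n. \<Sum>k<n. (P k y)\<^sup>2) at_top sequentially"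
    unfolding filterlim_at_top
  proof
    fix Z
    obtain n where n: "Z < (\<Sum>k<n. (P k y)\<^sup>2)"
    proof (rule ccontr)
      assume no: "\<not> thesis"
      then have "(\<Sum>k<n. (P k y)\<^sup>2) \<le> Z" for n using that by (meson not_less)
      then show False using False summableI_nonneg_bounded[of "\<lambda>k. (P k y)\<^sup>2" Z] by simp
    qed
    have "Z \<le> (\<Sum>k<N. (P k y)\<^sup>2)" if "n \<le> N" for N
      using n sum_mono2[of "{..<N}" "{..<n}" "\<lambda>k. (P k y)\<^sup>2"] that by auto
    then show "\<forall>\<^sub>F N in sequentially. Z \<le> (\<Sum>k<N. (P k y)\<^sup>2)"
      by (auto simp: eventually_sequentially)
  qed
  from tendsto_divide_0[OF tendsto_const filterlim_at_top_imp_at_infinity[OF this], of 1]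
  show ?thesis using False by (simp add: weight_def)
qed

text \<open>The vectors attached to distinct zeros of \<open>P (N * q - 1)\<close> are orthogonal by
  Christoffel-Darboux, and there are as many as coordinates. The form \<open>0 - - pi\<close> is
  that of \<open>d - c\<close> in \<open>riemann_sum_tendsto\<close>.\<close>

lemma finite_resolution:
  assumes N: "0 < N" and nm: "n < N * q - 1" "m < N * q - 1"
  shows "(\<Sum>y | V q y = 0. P n y * P m y / (\<Sum>k<N * q - 1. (P k y)\<^sup>2))
    + 2 / pi * (\<Sum>j<q. (0 - - pi) / N * (\<Sum>k=1..<N. spectral_density j n m (- pi + (0 - - pi) * real k / real N)))
    = (if n = m then 1 else 0)"
proof -
  \<comment> \<open>\<open>V (N * q)\<close> is \<open>a M * P M\<close>, hence the shift by
    one.\<close>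
  define M where "M = N * q - 1"
  define \<theta> where "\<theta> k = - pi + (0 - - pi) * real k / N" for k
  define X where "X = (\<lambda>(j, k). phase j (\<theta> k))"
  define G where "G = {y::real. V q y = 0}"
  define I where "I = {..<q} \<times> {1..<N}"
  define S where "S x = (\<Sum>k<M. (P k x)\<^sup>2)" for x :: real
  have M: "Suc M = N * q" using N q_pos by (simp add: M_def)
  have \<theta>: "- pi < \<theta> k" "\<theta> k < 0" if "k \<in> {1..<N}" for k
  proof -
    have "0 < pi * (real k / N)" using that by simp
    moreover have "pi * (real k / N) < pi * 1"
      by (rule mult_strict_left_mono) (use that in auto)
    ultimately show "- pi < \<theta> k" "\<theta> k < 0" by (simp_all add: \<theta>_def)
  qed
  have sin\<theta>: "sin (\<theta> k) \<noteq> 0" if "k \<in> {1..<N}" for k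
    using \<theta>[OF that] sin_gt_zero[of "- \<theta> k"] by auto
  have sinN: "sin (real N * \<theta> k) = 0" for k
  proof -
    have "real N * \<theta> k = of_int (int k - int N) * pi"
      using N by (simp add: \<theta>_def field_simps)
    then show ?thesis using sin_zero_iff_int2 by blast
  qed
  have VP: "P M x = 0" if "V (N * q) x = 0" for x :: real
    using that eval_Suc(2)[of M x] by (simp add: M)
  have G0: "V (N * q) x = 0" if "x \<in> G" for x
  proof -
    have "V (l * q) x = 0" for l
    proof (induction l rule: induct_nat_012)
      case (ge2 n)
      have e: "Suc (Suc n) * q = n * q + 2 * q" "Suc n * q = n * q + q" by simp_all
      show ?case using ge2[unfolded e] shift_two_periods(2)[of "n * q" x] unfolding e by simp
    qed (use that in \<open>auto simp: G_def\<close>)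
    then show ?thesis .
  qed
  have X0: "V (N * q) (X i) = 0" if "i \<in> I" for i
    using that sin_mult_sol(2)[OF D_phase, of "fst i" "\<theta> (snd i)" N] sinN sin\<theta>
    by (auto simp: X_def I_def)
  have injX: "inj_on X I"
  proof (rule inj_onI)
    fix i i' assume i: "i \<in> I" "i' \<in> I" "X i = X i'"
    obtain j k j' k' where jk: "i = (j, k)" "i' = (j', k')" by (metis surj_pair)
    have *: "j < q" "j' < q" "k \<in> {1..<N}" "k' \<in> {1..<N}" using i jk by (auto simp: I_def)
    have e: "phase j (\<theta> k) = phase j' (\<theta> k')" using i jk by (simp add: X_def)
    have "j = j'"
      using phase_mono_index[of j j' "\<theta> k" "\<theta> k'"] phase_mono_index[of j' j "\<theta> k'" "\<theta> k"] sin\<theta> * e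
      by (cases j j' rule: linorder_cases) auto
    moreover have "cos (- \<theta> k) = cos (- \<theta> k')" using D_phase[of j] D_phase[of j'] * e by (metis cos_minus mult_cancel_left zero_neq_numeral)
    then have "- \<theta> k = - \<theta> k'"
      using cos_inj_pi[of "- \<theta> k" "- \<theta> k'"] \<theta>[of k] \<theta>[of k'] * by auto
    then have "k = k'" using N by (simp add: \<theta>_def)
    ultimately show "i = i'" using jk by simp
  qed
  have disj: "G \<inter> X ` I = {}"
    using V_nonzero_inside phase_inside(3) sin\<theta> by (fastforce simp: G_def X_def I_def)
  have finG: "finite G" and finI: "finite I" using finite_V_roots by (simp_all add: G_def I_def)
  \<comment> \<open>The count is exact: \<open>q - 1\<close> zeros of \<open>V q\<close> and
    \<open>N - 1\<close> inner phases in each of \<open>q\<close> bands.\<close>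
  have card: "card (G \<union> X ` I) = M"
  proof -
    have "card (G \<union> X ` I) = (q - 1) + q * (N - 1)"
      using card_Un_disjoint[OF finG _ disj] finI card_V_roots card_image[OF injX]
      by (simp add: G_def I_def)
    also have "\<dots> = M" using N q_pos by (cases N; cases q) (simp_all add: M_def)
    finally show ?thesis .
  qed
  have root: "P M x = 0" if "x \<in> G \<union> X ` I" for x using that G0 X0 VP by auto
  have M0: "0 < M" using nm by (simp add: M_def)
  have "(\<Sum>x\<in>G \<union> X ` I. P n x * P m x / (\<Sum>k<M. (P k x)\<^sup>2)) = (if n = m then 1 else 0)"
  proof (rule orthogonal_system_complete[where f = "\<lambda>x k. P k x", OF _ card])
    fix x y assume xy: "x \<in> G \<union> X ` I" "y \<in> G \<union> X ` I" "x \<noteq> y"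
    have "(x - y) * (\<Sum>k<M. P k x * P k y) = 0"
      unfolding christoffel_darboux using root xy by simp
    then show "(\<Sum>k<M. P k x * P k y) = 0" using xy by simp
  qed (use nm sum_P_sq_pos[OF M0] finG finI in \<open>auto simp: M_def\<close>)
  moreover have "(\<Sum>x\<in>G \<union> X ` I. P n x * P m x / (\<Sum>k<M. (P k x)\<^sup>2))
      = (\<Sum>x\<in>G. P n x * P m x / S x) + (\<Sum>x\<in>X ` I. P n x * P m x / S x)"
    using sum.union_disjoint[OF finG _ disj] finI by (simp add: S_def)
  moreover have "(\<Sum>x\<in>X ` I. P n x * P m x / S x)
      = 2 / pi * (\<Sum>j<q. (0 - - pi) / N * (\<Sum>k=1..<N. spectral_density j n m (\<theta> k)))"
  proof -
    have "(\<Sum>x\<in>X ` I. P n x * P m x / S x) = (\<Sum>(j, k)\<in>I. 2 / N * spectral_density j n m (\<theta> k))"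
      unfolding sum.reindex[OF injX]
    proof (intro sum.cong refl)
      fix i assume i: "i \<in> I"
      obtain j k where jk: "i = (j, k)" by fastforce
      have *: "j < q" "k \<in> {1..<N}" using i jk by (auto simp: I_def)
      define x where "x = phase j (\<theta> k)"
      \<comment> \<open>The term \<open>k = M\<close> may be added because \<open>x\<close> is a
        zero of \<open>P M\<close>; the sum then runs over full periods, as
        \<open>sum_P_sq_at_level\<close> requires.\<close>
      have "S x = (\<Sum>k<Suc M. (P k x)\<^sup>2)"
        using root[of x] i jk by (simp add: S_def x_def X_def image_iff) (metis case_prod_conv)
      then have "(sin (\<theta> k))\<^sup>2 * S x = real N / 2 * W x"
        using sum_P_sq_at_level[OF D_phase[OF *(1)] sinN sin\<theta>[OF *(2)]] unfolding M by (simp add: x_def)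
      moreover have "0 < W x" using W_pos_inside phase_inside(3)[OF *(1) sin\<theta>[OF *(2)]] by (simp add: x_def)
      moreover have "0 < S x" using sum_P_sq_pos[OF M0] by (simp add: S_def)
      ultimately have "1 / S x = 2 / N * (sin (\<theta> k))\<^sup>2 / W x"
        using N by (simp add: field_simps)
      then have "P n x * P m x / S x = P n x * P m x * (2 / N * (sin (\<theta> k))\<^sup>2 / W x)"
        by (metis mult.right_neutral times_divide_eq_right)
      then show "((\<lambda>x. P n x * P m x / S x) \<circ> X) i = (case i of (j, k) \<Rightarrow> 2 / N * spectral_density j n m (\<theta> k))"
        by (simp add: jk X_def x_def spectral_density_def mult_ac)
    qed
    also have "\<dots> = (\<Sum>j<q. \<Sum>k=1..<N. 2 / N * spectral_density j n m (\<theta> k))"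
      unfolding I_def by (rule sum.cartesian_product[symmetric])
    finally show ?thesis by (simp add: sum_distrib_left)
  qed
  ultimately show ?thesis by (simp add: G_def S_def M_def \<theta>_def)
qed

lemma density_integrable:
  assumes "j < q"
  shows "spectral_density j n m integrable_on {-pi..0}"
  using riemann_sum_tendsto(1)[OF _ continuous_density[OF assms] density_bound[OF assms]] by simp

text \<open>The Gauss quadratures \<open>finite_resolution\<close> are Riemann sums in the phase.\<close>

lemma resolution_of_identity:
  "(\<Sum>y | V q y = 0. weight y * (P n y * P m y)) + 2 / pi * (\<Sum>j<q. integral {-pi..0} (spectral_density j n m))
    = (if n = m then 1 else 0)"
proof -
  let ?s = "\<lambda>N. (\<Sum>y | V q y = 0. P n y * P m y / (\<Sum>k<N * q - 1. (P k y)\<^sup>2))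
    + 2 / pi * (\<Sum>j<q. (0 - - pi) / N * (\<Sum>k=1..<N. spectral_density j n m (- pi + (0 - - pi) * real k / real N)))"
  have sub: "filterlim (\<lambda>N. N * q - 1) at_top sequentially"
  proof (rule filterlim_at_top_mono[OF filterlim_minus_const_nat_at_top[of 1]])
    show "\<forall>\<^sub>F N in sequentially. N - 1 \<le> N * q - 1"
      using q_pos by (auto intro!: always_eventually diff_le_mono)
  qed
  have "(\<lambda>N. P n y * P m y * (1 / (\<Sum>k<N * q - 1. (P k y)\<^sup>2))) \<longlonglongrightarrow> P n y * P m y * weight y" for y
    by (intro tendsto_intros filterlim_compose[OF weight_limit sub])
  then have "?s \<longlonglongrightarrow> (\<Sum>y | V q y = 0. P n y * P m y * weight y)
      + 2 / pi * (\<Sum>j<q. integral {-pi..0} (spectral_density j n m))"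
    by (intro tendsto_add tendsto_mult tendsto_sum tendsto_const
        riemann_sum_tendsto(2)[OF _ continuous_density density_bound]) auto
  moreover have "\<forall>\<^sub>F N in sequentially. ?s N = (if n = m then 1 else 0)"
  proof (rule eventually_mono)
    show "\<forall>\<^sub>F N in sequentially. max n m + 1 \<le> N * q - 1 \<and> 0 < N"
      using sub unfolding filterlim_at_top by (intro eventually_conj eventually_gt_at_top) blast
  qed (rule finite_resolution, auto)
  ultimately have "(\<Sum>y | V q y = 0. P n y * P m y * weight y)
      + 2 / pi * (\<Sum>j<q. integral {-pi..0} (spectral_density j n m)) = (if n = m then 1 else 0)"
    by (rule LIMSEQ_unique[OF _ tendsto_eventually])
  then show ?thesis by (simp add: mult_ac)
qed

end

section \<open>The sequence space and orthogonal projections\<close>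

lemma ell2_iff: "v \<in> ell2 \<longleftrightarrow> summable (\<lambda>n. (cmod (v n))\<^sup>2)"
  by (simp add: ell2_def)

lemma cmod_add_sq_le: "(cmod (x + y))\<^sup>2 \<le> 2 * (cmod x)\<^sup>2 + 2 * (cmod y)\<^sup>2"
proof -
  have "(cmod (x + y))\<^sup>2 \<le> (cmod x + cmod y)\<^sup>2"
    by (intro power_mono norm_triangle_ineq) auto
  also have "\<dots> \<le> 2 * (cmod x)\<^sup>2 + 2 * (cmod y)\<^sup>2"
    using zero_le_power2[of "cmod x - cmod y"] by (simp add: power2_eq_square algebra_simps)
  finally show ?thesis .
qed

lemma ell2_add: "v \<in> ell2 \<Longrightarrow> w \<in> ell2 \<Longrightarrow> (\<lambda>n. v n + w n) \<in> ell2"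
  unfolding ell2_iff
  by (rule summable_comparison_test'[where N = 0 and g = "\<lambda>n. 2 * (cmod (v n))\<^sup>2 + 2 * (cmod (w n))\<^sup>2"])
    (auto intro!: summable_add summable_mult simp: cmod_add_sq_le)

lemma ell2_scale: "v \<in> ell2 \<Longrightarrow> (\<lambda>n. c * v n) \<in> ell2"
  unfolding ell2_iff by (simp add: norm_mult power_mult_distrib summable_mult)

lemma ell2_diff: "v \<in> ell2 \<Longrightarrow> w \<in> ell2 \<Longrightarrow> (\<lambda>n. v n - w n) \<in> ell2"
  using ell2_add[of v "\<lambda>n. (- 1) * w n"] ell2_scale[of w "- 1"] by simp

lemma ell2_sum: "(\<And>i. i \<in> F \<Longrightarrow> f i \<in> ell2) \<Longrightarrow> (\<lambda>n. \<Sum>i\<in>F. c i * f i n) \<in> ell2"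
proof (induction F rule: infinite_finite_induct)
  case (insert x F)
  then show ?case using ell2_add[OF ell2_scale[of "f x" "c x"]] by simp
qed (simp_all add: ell2_iff)

lemma ell1_imp_ell2:
  assumes "u \<in> ell1"
  shows "u \<in> ell2"
proof -
  have s: "summable (\<lambda>n. cmod (u n))" using assms by (simp add: ell1_def)
  have "\<forall>\<^sub>F n in sequentially. cmod (u n) < 1"
    using summable_LIMSEQ_zero[OF s] by (rule order_tendstoD) simp
  then obtain N where N: "\<And>n. N \<le> n \<Longrightarrow> cmod (u n) < 1" by (auto simp: eventually_sequentially)
  show ?thesis
    unfolding ell2_iff
  proof (rule summable_comparison_test'[OF s])
    fix n assume "N \<le> n"
    then show "norm ((cmod (u n))\<^sup>2) \<le> cmod (u n)"
      using N[of n] by (simp add: power2_eq_square mult_left_le)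
  qed
qed

lemma summable_ell2_inner:
  assumes "v \<in> ell2" "w \<in> ell2"
  shows "summable (\<lambda>n. cmod (cnj (v n) * w n))" "summable (\<lambda>n. cnj (v n) * w n)"
proof -
  show "summable (\<lambda>n. cmod (cnj (v n) * w n))"
  proof (rule summable_comparison_test')
    show "summable (\<lambda>n. (cmod (v n))\<^sup>2 + (cmod (w n))\<^sup>2)"
      using assms by (auto simp: ell2_iff intro: summable_add)
    show "norm (cmod (cnj (v n) * w n)) \<le> (cmod (v n))\<^sup>2 + (cmod (w n))\<^sup>2" for n
    proof -
      have "0 \<le> cmod (v n) * cmod (w n)" by simp
      then show ?thesis using sum_squares_bound[of "cmod (v n)" "cmod (w n)"]
        unfolding real_norm_def norm_mult complex_mod_cnj abs_mult abs_norm_cancel by linarith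
    qed
  qed
  then show "summable (\<lambda>n. cnj (v n) * w n)" by (rule summable_norm_cancel)
qed

lemma ell2_inner_diff_right:
  "v \<in> ell2 \<Longrightarrow> w \<in> ell2 \<Longrightarrow> x \<in> ell2 \<Longrightarrow>
    ell2_inner v (\<lambda>n. w n - x n) = ell2_inner v w - ell2_inner v x"
  unfolding ell2_inner_def right_diff_distrib
  by (rule suminf_diff[symmetric]) (auto intro: summable_ell2_inner)

lemma ell2_inner_sum_right:
  assumes "v \<in> ell2" "\<And>i. i \<in> F \<Longrightarrow> f i \<in> ell2"
  shows "ell2_inner v (\<lambda>n. \<Sum>i\<in>F. c i * f i n) = (\<Sum>i\<in>F. c i * ell2_inner v (f i))"
proof -
  have "ell2_inner v (\<lambda>n. \<Sum>i\<in>F. c i * f i n) = (\<Sum>n. \<Sum>i\<in>F. c i * (cnj (v n) * f i n))"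
    by (simp add: ell2_inner_def sum_distrib_left mult_ac)
  also have "\<dots> = (\<Sum>i\<in>F. \<Sum>n. c i * (cnj (v n) * f i n))"
    by (rule suminf_sum) (intro summable_mult summable_ell2_inner assms)
  also have "\<dots> = (\<Sum>i\<in>F. c i * ell2_inner v (f i))"
    unfolding ell2_inner_def
    by (intro sum.cong refl suminf_mult summable_ell2_inner assms)
  finally show ?thesis .
qed

lemma ell2_inner_cnj:
  assumes "v \<in> ell2" "w \<in> ell2"
  shows "ell2_inner w v = cnj (ell2_inner v w)"
proof -
  have "(\<lambda>n. cnj (cnj (v n) * w n)) sums cnj (ell2_inner v w)"
    unfolding ell2_inner_def sums_cnj by (rule summable_sums[OF summable_ell2_inner(2)[OF assms]])
  then have "(\<lambda>n. cnj (w n) * v n) sums cnj (ell2_inner v w)" by (simp add: mult.commute)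
  then show ?thesis unfolding ell2_inner_def[of w] by (rule sums_unique[symmetric])
qed

lemma ell2_inner_self_eq_0:
  assumes "v \<in> ell2" "ell2_inner v v = 0"
  shows "v = (\<lambda>n. 0)"
proof -
  have s: "summable (\<lambda>n. (cmod (v n))\<^sup>2)" using assms by (simp add: ell2_iff)
  have "ell2_inner v v = of_real (\<Sum>n. (cmod (v n))\<^sup>2)"
    unfolding ell2_inner_def suminf_of_real[OF s]
    by (simp add: complex_norm_square mult.commute del: of_real_power)
  then have "(\<Sum>n. (cmod (v n))\<^sup>2) = 0" using assms by simp
  then have "\<forall>n. (cmod (v n))\<^sup>2 = 0"
    by (subst (asm) suminf_eq_zero_iff[OF s]) auto
  then show ?thesis by auto
qed

lemma ell2_cauchy_schwarz:
  assumes "v \<in> ell2" "w \<in> ell2"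
  shows "cmod (ell2_inner v w) \<le> ell2_norm v * ell2_norm w"
proof (rule Lim_bounded)
  have "(\<lambda>N. \<Sum>n<N. cnj (v n) * w n) \<longlonglongrightarrow> ell2_inner v w"
    unfolding ell2_inner_def by (rule summable_LIMSEQ[OF summable_ell2_inner(2)[OF assms]])
  then show "(\<lambda>N. cmod (\<Sum>n<N. cnj (v n) * w n)) \<longlonglongrightarrow> cmod (ell2_inner v w)"
    by (rule tendsto_norm)
  show "\<forall>N\<ge>0. cmod (\<Sum>n<N. cnj (v n) * w n) \<le> ell2_norm v * ell2_norm w"
  proof (intro allI impI)
    fix N
    have n: "sqrt (\<Sum>n<N. (cmod (x n))\<^sup>2) \<le> ell2_norm x" if "x \<in> ell2" for x
      unfolding ell2_norm_def
      by (intro real_sqrt_le_mono sum_le_suminf) (use that in \<open>auto simp: ell2_iff\<close>)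
    have "cmod (\<Sum>n<N. cnj (v n) * w n) \<le> (\<Sum>n<N. \<bar>cmod (v n)\<bar> * \<bar>cmod (w n)\<bar>)"
      by (rule order_trans[OF norm_sum]) (simp add: norm_mult)
    also have "\<dots> \<le> sqrt (\<Sum>n<N. (cmod (v n))\<^sup>2) * sqrt (\<Sum>n<N. (cmod (w n))\<^sup>2)"
      using L2_set_mult_ineq[of "\<lambda>n. cmod (v n)" "\<lambda>n. cmod (w n)" "{..<N}"] by (simp add: L2_set_def)
    also have "\<dots> \<le> ell2_norm v * ell2_norm w"
      by (intro mult_mono n assms) (auto simp: ell2_norm_def intro!: sum_nonneg suminf_nonneg assms(1)[unfolded ell2_iff])
    finally show "cmod (\<Sum>n<N. cnj (v n) * w n) \<le> ell2_norm v * ell2_norm w" .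
  qed
qed

lemma closed_span_superset: "S \<subseteq> ell2 \<Longrightarrow> v \<in> lin_span S \<Longrightarrow> v \<in> closed_span S"
proof -
  assume S: "S \<subseteq> ell2" and v: "v \<in> lin_span S"
  then obtain F c where "finite F" "F \<subseteq> S" "v = (\<lambda>n. \<Sum>w\<in>F. c w * w n)" by (auto simp: lin_span_def)
  then have "v \<in> ell2" using ell2_sum[of F "\<lambda>w. w" c] S by auto
  then show ?thesis using v by (auto simp: closed_span_def ell2_norm_def intro!: bexI[of _ v])
qed

lemma orth_closed_span:
  assumes S: "S \<subseteq> ell2" and w: "w \<in> ell2" and orth: "\<And>v. v \<in> S \<Longrightarrow> ell2_inner w v = 0"
    and v: "v \<in> closed_span S"
  shows "ell2_inner w v = 0"
proof (rule ccontr)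
  assume nz: "ell2_inner w v \<noteq> 0"
  have v2: "v \<in> ell2" using v by (simp add: closed_span_def)
  \<comment> \<open>The added 1 makes the final comparison strict and avoids a division by a norm
    that may be 0.\<close>
  define e where "e = cmod (ell2_inner w v) / (ell2_norm w + 1)"
  have nw: "0 \<le> ell2_norm w"
    unfolding ell2_norm_def using w by (auto simp: ell2_iff intro: suminf_nonneg)
  have "0 < e" using nz nw by (simp add: e_def)
  then obtain x where x: "x \<in> lin_span S" "ell2_norm (\<lambda>n. v n - x n) < e"
    using v by (auto simp: closed_span_def)
  obtain F c where F: "finite F" "F \<subseteq> S" "x = (\<lambda>n. \<Sum>y\<in>F. c y * y n)"
    using x by (auto simp: lin_span_def)
  have x2: "x \<in> ell2" using ell2_sum[of F "\<lambda>y. y" c] S F by auto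
  have "ell2_inner w x = (\<Sum>y\<in>F. c y * ell2_inner w y)"
    unfolding F(3) by (rule ell2_inner_sum_right) (use w S F in auto)
  also have "\<dots> = 0" by (rule sum.neutral) (use orth F(2) in auto)
  finally have "ell2_inner w x = 0" .
  then have "ell2_inner w v = ell2_inner w (\<lambda>n. v n - x n)"
    by (simp add: ell2_inner_diff_right w v2 x2)
  then have "cmod (ell2_inner w v) \<le> ell2_norm w * ell2_norm (\<lambda>n. v n - x n)"
    using ell2_cauchy_schwarz[OF w ell2_diff[OF v2 x2]] by simp
  also have "\<dots> \<le> ell2_norm w * e" using x(2) nw by (intro mult_left_mono) auto
  also have "\<dots> < (ell2_norm w + 1) * e" using \<open>0 < e\<close> by simp
  also have "\<dots> = cmod (ell2_inner w v)" using nw by (simp add: e_def)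
  finally show False by simp
qed

text \<open>Two candidates differ by an element of \<open>S\<close> orthogonal to itself, so the
  definite description is settled by exhibiting one.\<close>

lemma orth_proj_eqI:
  assumes S: "S \<subseteq> ell2" "\<And>x y. x \<in> S \<Longrightarrow> y \<in> S \<Longrightarrow> (\<lambda>n. x n - y n) \<in> S"
    and v: "v \<in> ell2" and w: "w \<in> S" "\<And>s. s \<in> S \<Longrightarrow> ell2_inner s (\<lambda>n. v n - w n) = 0"
  shows "orth_proj S v = w"
  unfolding orth_proj_def
proof (rule the_equality)
  fix w' assume w': "w' \<in> S \<and> (\<forall>s\<in>S. ell2_inner s (\<lambda>n. v n - w' n) = 0)"
  define d where "d n = w' n - w n" for n
  have d: "d \<in> S" using S(2)[of w' w] w w' by (simp add: d_def[abs_def])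
  have l2: "d \<in> ell2" "w \<in> ell2" "w' \<in> ell2" using d w w' S by auto
  have "ell2_inner d d = ell2_inner d (\<lambda>n. (v n - w n) - (v n - w' n))"
    by (simp add: d_def[abs_def])
  also have "\<dots> = ell2_inner d (\<lambda>n. v n - w n) - ell2_inner d (\<lambda>n. v n - w' n)"
    by (rule ell2_inner_diff_right) (use l2 v in \<open>auto intro: ell2_diff\<close>)
  also have "\<dots> = 0" using w w' d by simp
  finally have "d = (\<lambda>n. 0)" using ell2_inner_self_eq_0 l2 by blast
  then show "w' = w" by (auto simp: d_def fun_eq_iff)
qed (use w in auto)

section \<open>Eigenvectors and the projection onto the continuous subspace\<close>

context periodic_coeffs
begin

abbreviation J :: "(nat \<Rightarrow> complex) \<Rightarrow> nat \<Rightarrow> complex" where "J \<equiv> jacobi a b"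

definition eig_points :: "real set" where
  "eig_points = {y. V q y = 0 \<and> summable (\<lambda>k. (P k y)\<^sup>2)}"

abbreviation eigvec :: "real \<Rightarrow> nat \<Rightarrow> complex" where "eigvec y \<equiv> (\<lambda>n. of_real (P n y))"

lemma a_bound: obtains A where "\<And>n. a n \<le> A" "0 < A"
proof -
  have "a n = a (n mod q)" for n
  proof (induction n rule: less_induct)
    case (less n)
    show ?case
    proof (cases "n < q")
      case False
      then have "a n = a (n - q)" using a_period[of "n - q"] by simp
      also have "\<dots> = a ((n - q) mod q)" using less[of "n - q"] False q_pos by simp
      also have "(n - q) mod q = n mod q" using False by (simp add: le_mod_geq not_less)
      finally show ?thesis .
    qed simp
  qed
  moreover have "a (n mod q) \<le> Max (a ` {..<q})" for n
    using q_pos by (intro Max_ge) auto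
  ultimately have le: "a n \<le> Max (a ` {..<q})" for n by metis
  have "0 < Max (a ` {..<q})" using le[of 0] a_pos[of 0] by linarith
  then show ?thesis using that le by blast
qed

lemma jacobi_P: "J (\<lambda>n. P n z) = (\<lambda>n. z * P n z)"
proof
  fix n
  show "J (\<lambda>n. P n z) n = z * P n z"
  proof (cases n)
    case 0
    then show ?thesis using three_term[of z 0] by simp
  next
    case (Suc m)
    then show ?thesis using three_term[of z "Suc m"] by (simp add: eval_Suc(2))
  qed
qed

text \<open>The recursion determines a solution from its first entry; eigenspaces are
  one-dimensional.\<close>

lemma jacobi_eigen:
  assumes "J v = (\<lambda>n. z * v n)"
  shows "v = (\<lambda>n. v 0 * P n z)"
proof -
  have J: "J v n = z * v n" for n using assms by (rule fun_cong)
  have ind: "v n = v 0 * P n z \<and> v (Suc n) = v 0 * P (Suc n) z" for n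
  proof (induction n)
    case 0
    have "of_real (a 0) * v 1 = (z - of_real (b 0)) * v 0" using J[of 0] by (simp add: algebra_simps)
    then have "v 1 = ((z - of_real (b 0)) * v 0) / of_real (a 0)" by (simp add: field_simps)
    then show ?case by (simp add: eval_Suc)
  next
    case (Suc n)
    have "of_real (a (Suc n)) * v (Suc (Suc n))
        = (z - of_real (b (Suc n))) * v (Suc n) - of_real (a n) * v n"
      using J[of "Suc n"] by (simp add: algebra_simps)
    also have "\<dots> = v 0 * (z * P (Suc n) z - of_real (b (Suc n)) * P (Suc n) z - V (Suc n) z)"
      using Suc by (simp add: eval_Suc(2) algebra_simps)
    also have "\<dots> = of_real (a (Suc n)) * (v 0 * P (Suc (Suc n)) z)"
      using three_term[of z "Suc n"] by (simp add: algebra_simps)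
    finally have "v (Suc (Suc n)) = v 0 * P (Suc (Suc n)) z" by simp
    then show ?case using Suc by simp
  qed
  show ?thesis using ind by (intro ext) blast
qed

lemma tendsto_V_zero:
  fixes z :: "'x::real_normed_field"
  assumes "(\<lambda>n. P n z) \<longlonglongrightarrow> 0"
  shows "(\<lambda>n. V n z) \<longlonglongrightarrow> 0"
proof -
  obtain A where A: "\<And>n. a n \<le> A" "0 < A" using a_bound by metis
  have "(\<lambda>n. V (Suc n) z) \<longlonglongrightarrow> 0"
  proof (rule Lim_null_comparison)
    show "\<forall>\<^sub>F n in sequentially. norm (V (Suc n) z) \<le> A * norm (P n z)"
      using A by (auto intro!: always_eventually mult_right_mono simp: eval_Suc norm_mult abs_of_pos)
    show "(\<lambda>n. A * norm (P n z)) \<longlonglongrightarrow> 0"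
      using tendsto_mult_right_zero[OF tendsto_norm_zero[OF assms]] by simp
  qed
  then show ?thesis by (rule LIMSEQ_imp_Suc)
qed

text \<open>The Wronskian of the solution with its translate by one period does not depend on the
  index: it equals \<open>V q z\<close>. Decay makes it tend to 0.\<close>

lemma V_zero_of_decay:
  fixes z :: "'x::real_normed_field"
  assumes P: "(\<lambda>n. P n z) \<longlonglongrightarrow> 0"
  shows "V q z = 0"
proof -
  have "P n z * V (n + q) z - V n z * P (n + q) z = V q z" for n
  proof -
    have "P n z * V (n + q) z - V n z * P (n + q) z = V q z * (P n z * S n z - R n z * V n z)"
      unfolding shift_period by (simp add: algebra_simps)
    then show ?thesis by (simp add: wronskian)
  qed
  moreover have "(\<lambda>n. P n z * V (n + q) z - V n z * P (n + q) z) \<longlonglongrightarrow> 0 * 0 - 0 * 0"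
    by (intro tendsto_intros P tendsto_V_zero[OF P] LIMSEQ_ignore_initial_segment)
  ultimately show ?thesis by (simp add: LIMSEQ_const_iff)
qed

lemma summable_imp_decay:
  fixes y :: real
  assumes "summable (\<lambda>k. (P k y)\<^sup>2)"
  shows "(\<lambda>n. P n y) \<longlonglongrightarrow> 0"
  using tendsto_real_sqrt[OF summable_LIMSEQ_zero[OF assms]]
  by (simp add: tendsto_rabs_zero_iff)

lemma finite_eig_points: "finite eig_points"
  by (rule finite_subset[OF _ finite_V_roots]) (auto simp: eig_points_def)

lemma eigvec_ell2: "y \<in> eig_points \<Longrightarrow> eigvec y \<in> ell2"
  by (simp add: eig_points_def ell2_iff)

lemma eigvec_eigenvector:
  assumes "y \<in> eig_points"
  shows "eigvec y \<in> eigenvectors J"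
proof -
  have e: "eigvec y = (\<lambda>n. P n (complex_of_real y))" using eval_of_real[where 'x = complex] by simp
  have "eigvec y 0 \<noteq> 0" by simp
  then have "eigvec y \<noteq> (\<lambda>n. 0)" by metis
  moreover have "J (eigvec y) = (\<lambda>n. of_real y * eigvec y n)" using jacobi_P[of "complex_of_real y"] eval_of_real[where 'x = complex, of _ y] by simp
  ultimately show ?thesis using eigvec_ell2[OF assms] by (auto simp: eigenvectors_def)
qed

text \<open>An eigenvalue is a zero of \<open>V q\<close>, hence of \<open>P (q - 1)\<close>, so
  that an eigenvalue which is complex a priori turns out real.\<close>

lemma eigenvector_cases:
  assumes "v \<in> eigenvectors J"
  obtains y c where "y \<in> eig_points" "v = (\<lambda>n. c * eigvec y n)"
proof -
  obtain z where v: "v \<in> ell2" "v \<noteq> (\<lambda>n. 0)" "J v = (\<lambda>n. z * v n)"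
    using assms by (auto simp: eigenvectors_def)
  have vP: "v = (\<lambda>n. v 0 * P n z)" by (rule jacobi_eigen[OF v(3)])
  then have v0: "v 0 \<noteq> 0" using v(2) by auto
  have "(\<lambda>n. P n z) = (\<lambda>n. (1 / v 0) * v n)" using v0 by (subst vP) simp
  then have P2: "(\<lambda>n. P n z) \<in> ell2" using ell2_scale[OF v(1), of "1 / v 0"] by simp
  then have "(\<lambda>n. (cmod (P n z))\<^sup>2) \<longlonglongrightarrow> 0" by (intro summable_LIMSEQ_zero) (simp add: ell2_iff)
  from tendsto_real_sqrt[OF this] have "(\<lambda>n. cmod (P n z)) \<longlonglongrightarrow> 0" by simp
  then have "(\<lambda>n. P n z) \<longlonglongrightarrow> 0" by (rule tendsto_norm_zero_cancel)
  then have V: "V q z = 0" by (rule V_zero_of_decay)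
  then have "P (q - 1) z = 0" by (simp add: V_period_eq)
  then obtain y where y: "z = of_real y" using P_root_real[of "q - 1" z] by (auto elim: Reals_cases)
  have "y \<in> eig_points"
    using V P2 eval_of_real[where 'x = complex] by (simp add: y eig_points_def ell2_iff)
  moreover have "v = (\<lambda>n. v 0 * eigvec y n)"
    by (subst vP) (simp add: y eval_of_real[where 'x = complex])
  ultimately show ?thesis using that by blast
qed

text \<open>Christoffel-Darboux with boundary terms tending to 0.\<close>

lemma eigvec_orthogonal:
  assumes "x \<in> eig_points" "y \<in> eig_points" "x \<noteq> y"
  shows "ell2_inner (eigvec x) (eigvec y) = 0"
proof -
  have dec: "(\<lambda>n. P n w) \<longlonglongrightarrow> 0" if "w \<in> eig_points" for w
    using that by (intro summable_imp_decay) (simp add: eig_points_def)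
  have "(\<lambda>n. P n x * V n y - V n x * P n y) \<longlonglongrightarrow> 0 * 0 - 0 * 0"
    by (intro tendsto_intros dec tendsto_V_zero assms)
  then have "(\<lambda>n. (x - y) * (\<Sum>k<n. P k x * P k y) / (x - y)) \<longlonglongrightarrow> 0 / (x - y)"
    unfolding christoffel_darboux by (intro tendsto_divide) (use assms in auto)
  then have "(\<lambda>n. \<Sum>k<n. P k x * P k y) \<longlonglongrightarrow> 0" using assms by simp
  then have "(\<lambda>k. P k x * P k y) sums 0" by (simp add: sums_def)
  then have "(\<lambda>k. complex_of_real (P k x * P k y)) sums of_real 0" by (simp only: sums_of_real_iff)
  then show ?thesis by (simp add: ell2_inner_def sums_iff)
qed

lemma eigvec_inner_self:
  assumes "y \<in> eig_points"
  shows "of_real (weight y) * ell2_inner (eigvec y) (eigvec y) = 1"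
proof -
  have s: "summable (\<lambda>k. (P k y)\<^sup>2)" using assms by (simp add: eig_points_def)
  have "0 < (\<Sum>k<1. (P k y)\<^sup>2)" by simp
  also have "\<dots> \<le> (\<Sum>k. (P k y)\<^sup>2)" by (rule sum_le_suminf[OF s]) auto
  finally have pos: "0 < (\<Sum>k. (P k y)\<^sup>2)" .
  have "ell2_inner (eigvec y) (eigvec y) = of_real (\<Sum>k. (P k y)\<^sup>2)"
    unfolding ell2_inner_def suminf_of_real[OF s] by (simp add: power2_eq_square)
  then show ?thesis using pos s by (simp add: weight_def flip: of_real_mult)
qed

lemma eigenvectors_ell2: "eigenvectors J \<subseteq> ell2"
  by (auto simp: eigenvectors_def)

text \<open>Up to scalars there are finitely many eigenvectors, pairwise orthogonal, and
  \<open>weight y\<close> is the inverse of the squared norm. Subtracting the projections onto them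
  gives a vector with the two properties that characterise the orthogonal projection.\<close>

lemma cont_proj_eq:
  assumes u: "u \<in> ell2"
  shows "cont_proj J u
    = (\<lambda>n. u n - (\<Sum>y\<in>eig_points. (of_real (weight y) * ell2_inner (eigvec y) u) * eigvec y n))"
proof -
  define c where "c y = of_real (weight y) * ell2_inner (eigvec y) u" for y
  define s where "s n = (\<Sum>y\<in>eig_points. c y * eigvec y n)" for n
  have s2: "s \<in> ell2" unfolding s_def[abs_def] by (rule ell2_sum) (rule eigvec_ell2)
  have w2: "(\<lambda>n. u n - s n) \<in> ell2" by (rule ell2_diff[OF u s2])
  have s_span: "s \<in> closed_span (eigenvectors J)"
  proof (rule closed_span_superset[OF eigenvectors_ell2])
    \<comment> \<open>\<open>lin_span\<close> indexes coefficients by vectors, not by eigenvalues,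
      so the sum is transported along this injection.\<close>
    have inj: "inj_on eigvec eig_points"
    proof (rule inj_onI, rule ccontr)
      fix x y assume xy: "x \<in> eig_points" "y \<in> eig_points" "eigvec x = eigvec y" "x \<noteq> y"
      then have "ell2_inner (eigvec x) (eigvec x) = 0" using eigvec_orthogonal[of x y] by simp
      then show False using eigvec_inner_self[OF xy(1)] by simp
    qed
    have "s = (\<lambda>n. \<Sum>w\<in>eigvec ` eig_points. c (the_inv_into eig_points eigvec w) * w n)"
      by (auto simp: s_def fun_eq_iff sum.reindex[OF inj] the_inv_into_f_f[OF inj] intro!: sum.cong)
    moreover have "finite (eigvec ` eig_points)" "eigvec ` eig_points \<subseteq> eigenvectors J"
      using finite_eig_points eigvec_eigenvector by auto
    ultimately show "s \<in> lin_span (eigenvectors J)"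
      unfolding lin_span_def mem_Collect_eq
      by (intro exI[of _ "eigvec ` eig_points"] exI[of _ "\<lambda>w. c (the_inv_into eig_points eigvec w)"] conjI)
  qed
  have orth: "ell2_inner (\<lambda>n. u n - s n) v = 0" if v: "v \<in> eigenvectors J" for v
  proof -
    obtain y d where y: "y \<in> eig_points" "v = (\<lambda>n. d * eigvec y n)" using eigenvector_cases[OF v] .
    have y2: "eigvec y \<in> ell2" using y(1) by (rule eigvec_ell2)
    have "ell2_inner (eigvec y) s = (\<Sum>x\<in>eig_points. c x * ell2_inner (eigvec y) (eigvec x))"
      unfolding s_def[abs_def] by (rule ell2_inner_sum_right) (use y2 eigvec_ell2 in auto)
    also have "\<dots> = (\<Sum>x\<in>eig_points. if x = y then c y * ell2_inner (eigvec y) (eigvec y) else 0)"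
      by (intro sum.cong refl) (use eigvec_orthogonal y in auto)
    also have "\<dots> = (of_real (weight y) * ell2_inner (eigvec y) (eigvec y)) * ell2_inner (eigvec y) u"
      using finite_eig_points y(1) by (simp add: c_def)
    finally have "ell2_inner (eigvec y) s = ell2_inner (eigvec y) u"
      using eigvec_inner_self[OF y(1)] by simp
    then have "ell2_inner (eigvec y) (\<lambda>n. u n - s n) = 0"
      by (simp add: ell2_inner_diff_right y2 u s2)
    then have "ell2_inner (\<lambda>n. u n - s n) (eigvec y) = 0"
      using ell2_inner_cnj[OF y2 w2] by simp
    then show ?thesis
      using ell2_inner_sum_right[OF w2, of "{()}" "\<lambda>_. eigvec y" "\<lambda>_. d"] y2 by (simp add: y(2))
  qed
  have "orth_proj (cont_subspace J) u = (\<lambda>n. u n - s n)"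
  proof (rule orth_proj_eqI)
    show "cont_subspace J \<subseteq> ell2" by (auto simp: cont_subspace_def orth_compl_def)
    show "(\<lambda>n. x n - y n) \<in> cont_subspace J" if "x \<in> cont_subspace J" "y \<in> cont_subspace J" for x y
      using that by (auto simp: cont_subspace_def orth_compl_def ell2_diff closed_span_def ell2_inner_diff_right)
    have "ell2_inner v (\<lambda>n. u n - s n) = 0" if "v \<in> closed_span (eigenvectors J)" for v
    proof -
      have "v \<in> ell2" using that by (simp add: closed_span_def)
      then show ?thesis
        using ell2_inner_cnj[OF w2] orth_closed_span[OF eigenvectors_ell2 w2 orth that] by simp
    qed
    then show "(\<lambda>n. u n - s n) \<in> cont_subspace J"
      using w2 by (auto simp: cont_subspace_def orth_compl_def)
    show "ell2_inner x (\<lambda>n. u n - (u n - s n)) = 0" if "x \<in> cont_subspace J" for x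
    proof -
      have "x \<in> ell2" "ell2_inner s x = 0"
        using that s_span by (auto simp: cont_subspace_def orth_compl_def)
      then show ?thesis using ell2_inner_cnj[OF s2] by simp
    qed
  qed (rule u)
  then show ?thesis by (simp add: cont_proj_def s_def c_def)
qed

end

section \<open>Functions of the operator on the continuous subspace\<close>

lemma bounded_continuous_integrable:
  fixes f :: "real \<Rightarrow> complex"
  assumes "c < d" "continuous_on {c<..<d} f" "\<And>x. cmod (f x) \<le> B"
  shows "f integrable_on {c..d}"
proof -
  have "(\<lambda>x. Re (f x)) integrable_on {c..d}"
    using assms(2) order_trans[OF abs_Re_le_cmod assms(3)]
    by (intro riemann_sum_tendsto(1)[OF assms(1), of _ B] continuous_intros)
  from integrable_linear[OF this bounded_linear_of_real]
  have re: "(\<lambda>x. complex_of_real (Re (f x))) integrable_on {c..d}" by (simp add: o_def)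
  have "(\<lambda>x. Im (f x)) integrable_on {c..d}"
    using assms(2) order_trans[OF abs_Im_le_cmod assms(3)]
    by (intro riemann_sum_tendsto(1)[OF assms(1), of _ B] continuous_intros)
  from integrable_linear[OF this bounded_linear_of_real]
  have im: "(\<lambda>x. complex_of_real (Im (f x))) integrable_on {c..d}" by (simp add: o_def)
  have "(\<lambda>x. complex_of_real (Re (f x)) + \<i> * complex_of_real (Im (f x))) integrable_on {c..d}"
    by (intro integrable_add re integrable_on_mult_right im)
  then show ?thesis by (simp add: complex_eq[symmetric])
qed

text \<open>The tail of the series is dominated termwise by the tail at the real number
  \<open>r\<close>, an error independent of \<open>w\<close>.\<close>

lemma exp_partial_sum_bound:
  fixes w :: complex
  assumes "cmod w \<le> r"
  shows "cmod (exp w - (\<Sum>k<K. w ^ k / fact k)) \<le> exp r - (\<Sum>k<K. r ^ k / fact k)"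
proof -
  have r0: "0 \<le> r" using norm_ge_zero assms by (rule order_trans)
  have w: "(\<lambda>k. w ^ k / fact k) sums exp w"
    using exp_converges[of w] by (simp add: scaleR_conv_of_real divide_inverse mult.commute)
  have r: "(\<lambda>k. r ^ k / fact k) sums exp r"
    using exp_converges[of r] by (simp add: divide_inverse mult.commute)
  note sw = sums_split_initial_segment[OF w, of K] and sr = sums_split_initial_segment[OF r, of K]
  have "cmod (\<Sum>k. w ^ (k + K) / fact (k + K)) \<le> (\<Sum>k. r ^ (k + K) / fact (k + K))"
  proof (rule norm_suminf_le)
    show "summable (\<lambda>k. r ^ (k + K) / fact (k + K))" using sr by (rule sums_summable)
    show "cmod (w ^ (k + K) / fact (k + K)) \<le> r ^ (k + K) / fact (k + K)" for k
      using power_mono[OF assms, of "k + K"] by (simp add: norm_divide norm_power divide_right_mono)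
  qed
  then show ?thesis using sums_unique[OF sw] sums_unique[OF sr] by simp
qed

lemma suminf_norm_le_mult:
  fixes u K :: "nat \<Rightarrow> complex"
  assumes u: "summable (\<lambda>m. cmod (u m))" and K: "\<And>m. cmod (K m) \<le> C"
  shows "summable (\<lambda>m. u m * K m)" "cmod (\<Sum>m. u m * K m) \<le> (\<Sum>m. cmod (u m)) * C"
proof -
  have s: "summable (\<lambda>m. cmod (u m) * C)" using u by (rule summable_mult2)
  have le: "cmod (u m * K m) \<le> cmod (u m) * C" for m
    by (simp add: norm_mult mult_left_mono K)
  show "summable (\<lambda>m. u m * K m)"
    by (rule summable_comparison_test'[OF s]) (rule le)
  have "cmod (\<Sum>m. u m * K m) \<le> (\<Sum>m. cmod (u m) * C)"
    using le s by (rule norm_suminf_le)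
  then show "cmod (\<Sum>m. u m * K m) \<le> (\<Sum>m. cmod (u m)) * C"
    by (simp add: suminf_mult2[OF u])
qed

text \<open>A row of the matrix has at most three nonzero entries, so only finitely many convergent
  series are combined.\<close>

lemma (in jacobi_coeffs) jacobi_suminf:
  assumes "\<And>n. summable (\<lambda>m. u m * K n m)"
  shows "jacobi a b (\<lambda>n. \<Sum>m. u m * K n m) n = (\<Sum>m. u m * jacobi a b (\<lambda>n. K n m) n)"
proof (cases n)
  case 0
  have "(\<lambda>m. of_real (b 0) * (u m * K 0 m) + of_real (a 0) * (u m * K 1 m)) sums
      (of_real (b 0) * (\<Sum>m. u m * K 0 m) + of_real (a 0) * (\<Sum>m. u m * K 1 m))"
    by (intro sums_add sums_mult summable_sums assms)
  then show ?thesis using 0 by (simp add: sums_iff algebra_simps)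
next
  case (Suc i)
  have "(\<lambda>m. of_real (a i) * (u m * K i m) + of_real (b (Suc i)) * (u m * K (Suc i) m)
        + of_real (a (Suc i)) * (u m * K (Suc (Suc i)) m)) sums
      (of_real (a i) * (\<Sum>m. u m * K i m) + of_real (b (Suc i)) * (\<Sum>m. u m * K (Suc i) m)
        + of_real (a (Suc i)) * (\<Sum>m. u m * K (Suc (Suc i)) m))"
    by (intro sums_add sums_mult summable_sums assms)
  then show ?thesis using Suc by (simp add: sums_iff algebra_simps)
qed

section \<open>Kernels on the continuous subspace\<close>

context periodic_coeffs
begin

text \<open>Matrix entry at \<open>n\<close>, \<open>m\<close> of the function \<open>h\<close> of
  the operator, restricted to the continuous subspace.\<close>

definition spectral_kernel :: "(real \<Rightarrow> complex) \<Rightarrow> nat \<Rightarrow> nat \<Rightarrow> complex" where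
  "spectral_kernel h n m = of_real (2 / pi) *
     (\<Sum>j<q. integral {-pi..0} (\<lambda>\<phi>. h (phase j \<phi>) * of_real (spectral_density j n m \<phi>)))"

lemma phase_bounded: obtains r where "0 < r" "\<And>j \<phi>. j < q \<Longrightarrow> \<bar>phase j \<phi>\<bar> \<le> r"
proof
  define r where "r = (\<Sum>j<q. \<bar>lower j\<bar> + \<bar>upper j\<bar>) + 1"
  show "0 < r" unfolding r_def by (rule add_nonneg_pos) (auto intro!: sum_nonneg)
  fix j \<phi> assume j: "j < q"
  have "\<bar>phase j \<phi>\<bar> \<le> \<bar>lower j\<bar> + \<bar>upper j\<bar>" using phase_in[OF j, of \<phi>] by auto
  also have "\<dots> \<le> (\<Sum>j<q. \<bar>lower j\<bar> + \<bar>upper j\<bar>)"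
    by (rule member_le_sum[where f = "\<lambda>j. \<bar>lower j\<bar> + \<bar>upper j\<bar>"]) (use j in auto)
  finally show "\<bar>phase j \<phi>\<bar> \<le> r" by (simp add: r_def)
qed

lemma integrand_bound:
  fixes h :: "real \<Rightarrow> complex"
  assumes "j < q" "\<And>x. \<bar>x\<bar> \<le> r \<Longrightarrow> cmod (h x) \<le> C" "\<And>j \<phi>. j < q \<Longrightarrow> \<bar>phase j \<phi>\<bar> \<le> r"
  shows "cmod (h (phase j \<phi>) * of_real (spectral_density j n m \<phi>)) \<le> C"
proof -
  have "cmod (h (phase j \<phi>)) * \<bar>spectral_density j n m \<phi>\<bar> \<le> C * 1"
    by (intro mult_mono density_bound assms) (use order_trans[OF norm_ge_zero assms(2)[OF assms(3)]] assms in auto)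
  then show ?thesis by (simp add: norm_mult)
qed

lemma integrand_integrable:
  fixes h :: "real \<Rightarrow> complex"
  assumes j: "j < q" and h: "continuous_on UNIV h"
  shows "(\<lambda>\<phi>. h (phase j \<phi>) * of_real (spectral_density j n m \<phi>)) integrable_on {-pi..0}"
proof -
  obtain r where r: "0 < r" "\<And>j \<phi>. j < q \<Longrightarrow> \<bar>phase j \<phi>\<bar> \<le> r" using phase_bounded by metis
  have "compact (h ` {-r..r})"
    by (intro compact_continuous_image continuous_on_subset[OF h]) auto
  then obtain C where C: "\<forall>x\<in>{-r..r}. cmod (h x) \<le> C"
    using compact_imp_bounded[of "h ` {-r..r}"] unfolding bounded_iff by auto
  have "cmod (h (phase j \<phi>) * of_real (spectral_density j n m \<phi>)) \<le> C" for \<phi>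
    by (rule integrand_bound[OF j _ r(2)]) (use C in \<open>simp add: abs_le_iff\<close>)
  moreover have "continuous_on {-pi<..<0} (\<lambda>\<phi>. h (phase j \<phi>) * of_real (spectral_density j n m \<phi>))"
    by (intro continuous_intros continuous_density[OF j] continuous_on_compose2[OF h] continuous_phase[OF j]) auto
  ultimately show ?thesis by (intro bounded_continuous_integrable) auto
qed

text \<open>Uniform in both indices because the density is bounded by 1; the factor is
  \<open>2 / pi\<close> times \<open>q\<close> intervals of length pi.\<close>

lemma kernel_bound:
  assumes h: "continuous_on UNIV h" and C: "\<And>x. \<bar>x\<bar> \<le> r \<Longrightarrow> cmod (h x) \<le> C"
    and r: "\<And>j \<phi>. j < q \<Longrightarrow> \<bar>phase j \<phi>\<bar> \<le> r"
  shows "cmod (spectral_kernel h n m) \<le> 2 * real q * C"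
proof -
  have C0: "0 \<le> C" using order_trans[OF norm_ge_zero C[OF r[of 0 0]]] q_pos by auto
  have "cmod (integral {-pi..0} (\<lambda>\<phi>. h (phase j \<phi>) * of_real (spectral_density j n m \<phi>))) \<le> C * pi" if j: "j < q" for j
  proof -
    have "cmod (h (phase j \<phi>) * of_real (spectral_density j n m \<phi>)) \<le> C" for \<phi>
      by (rule integrand_bound[where r = r, OF j C r])
    then show ?thesis
      using has_integral_bound_real[OF C0 finite.emptyI integrable_integral[OF integrand_integrable[OF j h, of n m]]]
      by simp
  qed
  then have "cmod (\<Sum>j<q. integral {-pi..0} (\<lambda>\<phi>. h (phase j \<phi>) * of_real (spectral_density j n m \<phi>))) \<le> real q * (C * pi)"
    by (intro order_trans[OF sum_norm_le[of "{..<q}" _ "\<lambda>_. C * pi"]]) auto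
  then have "2 / pi * cmod (\<Sum>j<q. integral {-pi..0} (\<lambda>\<phi>. h (phase j \<phi>) * of_real (spectral_density j n m \<phi>)))
      \<le> 2 / pi * (real q * (C * pi))" by (intro mult_left_mono) auto
  then show ?thesis by (simp add: spectral_kernel_def norm_mult norm_divide)
qed

lemma kernel_sum:
  assumes "finite I" "\<And>i. i \<in> I \<Longrightarrow> continuous_on UNIV (h i)"
  shows "spectral_kernel (\<lambda>x. \<Sum>i\<in>I. c i * h i x) n m = (\<Sum>i\<in>I. c i * spectral_kernel (h i) n m)"
proof -
  have "integral {-pi..0} (\<lambda>\<phi>. (\<Sum>i\<in>I. c i * h i (phase j \<phi>)) * of_real (spectral_density j n m \<phi>))
      = (\<Sum>i\<in>I. c i * integral {-pi..0} (\<lambda>\<phi>. h i (phase j \<phi>) * of_real (spectral_density j n m \<phi>)))" if "j < q" for j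
  proof -
    have "((\<lambda>\<phi>. \<Sum>i\<in>I. c i * (h i (phase j \<phi>) * of_real (spectral_density j n m \<phi>))) has_integral
      (\<Sum>i\<in>I. c i * integral {-pi..0} (\<lambda>\<phi>. h i (phase j \<phi>) * of_real (spectral_density j n m \<phi>)))) {-pi..0}"
      by (intro has_integral_sum assms has_integral_mult_right integrable_integral integrand_integrable that)
    then show ?thesis by (simp add: sum_distrib_right mult.assoc integral_unique)
  qed
  then show ?thesis
    by (simp add: spectral_kernel_def sum_distrib_left mult_ac) (rule sum.swap)
qed

lemma kernel_diff:
  assumes "continuous_on UNIV g" "continuous_on UNIV h"
  shows "spectral_kernel (\<lambda>x. g x - h x) n m = spectral_kernel g n m - spectral_kernel h n m"
  using kernel_sum[of "{True, False}" "\<lambda>i. if i then g else h" "\<lambda>i. if i then 1 else - 1" n m] assms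
  by simp

text \<open>The index \<open>n\<close> enters the density through \<open>P n\<close> alone, and
  there the action of \<open>J\<close> is multiplication by \<open>x\<close>.\<close>

lemma kernel_mult_x:
  assumes h: "continuous_on UNIV h"
  shows "J (\<lambda>n. spectral_kernel h n m) n = spectral_kernel (\<lambda>x. of_real x * h x) n m"
proof -
  define F where "F j n \<phi> = h (phase j \<phi>) * of_real (spectral_density j n m \<phi>)" for j n \<phi>
  have F: "F j n integrable_on {-pi..0}" if "j < q" for j n
    unfolding F_def[abs_def] by (rule integrand_integrable[OF that h])
  have kF: "spectral_kernel h n m = (\<Sum>j<q. of_real (2 / pi) * integral {-pi..0} (F j n))" for n
    by (simp add: spectral_kernel_def F_def[abs_def] sum_distrib_left)
  have kx: "spectral_kernel (\<lambda>x. of_real x * h x) n m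
      = (\<Sum>j<q. of_real (2 / pi) * integral {-pi..0} (\<lambda>\<phi>. of_real (phase j \<phi>) * F j n \<phi>))" for n
    by (simp add: spectral_kernel_def F_def[abs_def] sum_distrib_left mult.assoc)
  have d: "spectral_density j n m \<phi> = P n (phase j \<phi>) * spectral_density j 0 m \<phi>" for j n \<phi>
    by (simp add: spectral_density_def)
  show ?thesis
  proof (cases n)
    case 0
    have "of_real (phase j \<phi>) * F j 0 \<phi> = of_real (b 0) * F j 0 \<phi> + of_real (a 0) * F j 1 \<phi>" for j \<phi>
    proof -
      have "phase j \<phi> * spectral_density j 0 m \<phi> = b 0 * spectral_density j 0 m \<phi> + a 0 * spectral_density j 1 m \<phi>"
        unfolding d[of j 1] using arg_cong[OF three_term[of "phase j \<phi>" 0], of "\<lambda>x. x * spectral_density j 0 m \<phi>"]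
        by (simp add: algebra_simps)
      from arg_cong[OF this, of "\<lambda>x. h (phase j \<phi>) * of_real x"]
      show ?thesis by (simp add: F_def algebra_simps)
    qed
    then have "integral {-pi..0} (\<lambda>\<phi>. of_real (phase j \<phi>) * F j 0 \<phi>)
        = of_real (b 0) * integral {-pi..0} (F j 0) + of_real (a 0) * integral {-pi..0} (F j 1)" if "j < q" for j
      using F[OF that] by (simp add: integral_add integrable_on_mult_right)
    then show ?thesis unfolding 0 jacobi.simps kF kx
      by (simp add: sum_distrib_left sum.distrib[symmetric] algebra_simps)
  next
    case (Suc i)
    have "of_real (phase j \<phi>) * F j (Suc i) \<phi> = of_real (a i) * F j i \<phi> + of_real (b (Suc i)) * F j (Suc i) \<phi>
        + of_real (a (Suc i)) * F j (Suc (Suc i)) \<phi>" for j \<phi>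
    proof -
      have "phase j \<phi> * spectral_density j (Suc i) m \<phi> = (phase j \<phi> * P (Suc i) (phase j \<phi>)) * spectral_density j 0 m \<phi>"
        by (subst d) simp
      also have "\<dots> = a i * spectral_density j i m \<phi> + b (Suc i) * spectral_density j (Suc i) m \<phi>
          + a (Suc i) * spectral_density j (Suc (Suc i)) m \<phi>"
        unfolding three_term d[of j i] d[of j "Suc i"] d[of j "Suc (Suc i)"] eval_Suc(2)[of i]
        by (simp add: algebra_simps)
      finally have "h (phase j \<phi>) * complex_of_real (phase j \<phi> * spectral_density j (Suc i) m \<phi>)
          = h (phase j \<phi>) * of_real (a i * spectral_density j i m \<phi> + b (Suc i) * spectral_density j (Suc i) m \<phi>
            + a (Suc i) * spectral_density j (Suc (Suc i)) m \<phi>)" by (rule arg_cong)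
      then show ?thesis by (simp add: F_def algebra_simps)
    qed
    then have "integral {-pi..0} (\<lambda>\<phi>. of_real (phase j \<phi>) * F j (Suc i) \<phi>)
        = of_real (a i) * integral {-pi..0} (F j i) + of_real (b (Suc i)) * integral {-pi..0} (F j (Suc i))
          + of_real (a (Suc i)) * integral {-pi..0} (F j (Suc (Suc i)))" if "j < q" for j
      using F[OF that] by (simp add: integral_add integrable_on_mult_right integrable_add)
    then show ?thesis unfolding Suc jacobi.simps kF kx
      by (simp add: sum_distrib_left sum.distrib[symmetric] algebra_simps)
  qed
qed

lemma kernel_one:
  "spectral_kernel (\<lambda>_. 1) n m = of_real (2 / pi * (\<Sum>j<q. integral {-pi..0} (spectral_density j n m)))"
proof -
  have "integral {-pi..0} (\<lambda>\<phi>. complex_of_real (spectral_density j n m \<phi>)) = of_real (integral {-pi..0} (spectral_density j n m))"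
    if "j < q" for j
    using integral_linear[OF density_integrable[OF that] bounded_linear_of_real] by (simp add: o_def)
  then show ?thesis by (simp add: spectral_kernel_def)
qed

text \<open>\<open>resolution_of_identity\<close> without its point masses is the kernel of the
  projection computed in \<open>cont_proj_eq\<close>.\<close>

lemma cont_proj_kernel:
  assumes u: "u \<in> ell1"
  shows "cont_proj J u n = (\<Sum>m. u m * spectral_kernel (\<lambda>_. 1) n m)"
proof -
  define w where "w y = complex_of_real (weight y)" for y
  have u2: "u \<in> ell2" by (rule ell1_imp_ell2[OF u])
  have "(\<lambda>m. (if m = n then u m else 0)
        - (\<Sum>y\<in>eig_points. (w y * eigvec y n) * (cnj (eigvec y m) * u m))) sums
      (u n - (\<Sum>y\<in>eig_points. (w y * eigvec y n) * ell2_inner (eigvec y) u))"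
    by (intro sums_diff sums_sum sums_mult sums_single)
      (unfold ell2_inner_def, rule summable_sums, rule summable_ell2_inner(2)[OF eigvec_ell2 u2])
  moreover have "(if m = n then u m else 0)
        - (\<Sum>y\<in>eig_points. (w y * eigvec y n) * (cnj (eigvec y m) * u m)) = u m * spectral_kernel (\<lambda>_. 1) n m" for m
  proof -
    \<comment> \<open>Zeros of \<open>V q\<close> that are not eigenvalues carry weight 0.\<close>
    have "(\<Sum>y\<in>eig_points. weight y * (P n y * P m y)) = (\<Sum>y | V q y = 0. weight y * (P n y * P m y))"
      by (rule sum.mono_neutral_left[OF finite_V_roots]) (auto simp: eig_points_def weight_def)
    then have "2 / pi * (\<Sum>j<q. integral {-pi..0} (spectral_density j n m))
        = (if n = m then 1 else 0) - (\<Sum>y\<in>eig_points. weight y * (P n y * P m y))"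
      using resolution_of_identity[of n m] by linarith
    from arg_cong[OF this, of complex_of_real]
    have k: "spectral_kernel (\<lambda>_. 1) n m = (if n = m then 1 else 0)
        - (\<Sum>y\<in>eig_points. w y * (eigvec y n * eigvec y m))"
      unfolding kernel_one by (simp add: w_def)
    show ?thesis unfolding k by (simp add: sum_distrib_left right_diff_distrib mult_ac)
  qed
  ultimately have "(\<lambda>m. u m * spectral_kernel (\<lambda>_. 1) n m) sums
      (u n - (\<Sum>y\<in>eig_points. (w y * eigvec y n) * ell2_inner (eigvec y) u))" by simp
  then show ?thesis unfolding cont_proj_eq[OF u2] by (simp add: sums_iff w_def mult_ac)
qed

text \<open>For summable \<open>u\<close>, bounded kernels suffice to interchange \<open>J\<close>
  with the sum over \<open>m\<close>.\<close>

lemma power_cont_proj: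
  assumes u: "u \<in> ell1"
  shows "(J ^^ k) (cont_proj J u) = (\<lambda>n. \<Sum>m. u m * spectral_kernel (\<lambda>x. of_real x ^ k) n m)"
proof (induction k)
  case 0
  then show ?case using cont_proj_kernel[OF u] by auto
next
  case (Suc k)
  obtain r where r: "0 < r" "\<And>j \<phi>. j < q \<Longrightarrow> \<bar>phase j \<phi>\<bar> \<le> r" using phase_bounded by metis
  have c: "continuous_on UNIV (\<lambda>x::real. complex_of_real x ^ k)" by (intro continuous_intros)
  have "cmod (spectral_kernel (\<lambda>x. of_real x ^ k) n m) \<le> 2 * real q * r ^ k" for n m
    by (rule kernel_bound[OF c _ r(2)]) (auto simp: norm_power power_mono)
  then have s: "summable (\<lambda>m. u m * spectral_kernel (\<lambda>x. of_real x ^ k) n m)" for n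
    using u by (intro suminf_norm_le_mult(1)) (auto simp: ell1_def)
  have "(J ^^ Suc k) (cont_proj J u) = J (\<lambda>n. \<Sum>m. u m * spectral_kernel (\<lambda>x. of_real x ^ k) n m)"
    using Suc by simp
  also have "\<dots> = (\<lambda>n. \<Sum>m. u m * spectral_kernel (\<lambda>x. of_real x ^ Suc k) n m)"
    using jacobi_suminf[OF s] kernel_mult_x[OF c] by auto
  finally show ?case .
qed

text \<open>The partial sums of the exponential series have the kernels of the polynomials
  \<open>h K\<close>, which converge to the exponential uniformly on the range of the phases. Hence
  these kernels are bounded by \<open>B + \<epsilon> K\<close>, and the limit is taken in one
  coordinate.\<close>

lemma exp_op_bound:
  assumes u: "u \<in> ell1" and B: "\<And>n m. cmod (spectral_kernel (\<lambda>x. exp (z * of_real x)) n m) \<le> B"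
  shows "ellinf_norm (exp_op z J (cont_proj J u)) \<le> ereal (B * ell1_norm u)"
  unfolding ellinf_norm_def
proof (rule SUP_least)
  fix n
  obtain r where r: "0 < r" "\<And>j \<phi>. j < q \<Longrightarrow> \<bar>phase j \<phi>\<bar> \<le> r" using phase_bounded by metis
  have us: "summable (\<lambda>m. cmod (u m))" using u by (simp add: ell1_def)
  define h where "h K x = (\<Sum>k<K. z ^ k / fact k * of_real x ^ k)" for K and x :: real
  define M where "M k = (\<Sum>m. u m * spectral_kernel (\<lambda>x. of_real x ^ k) n m)" for k
  have c: "continuous_on UNIV (\<lambda>x::real. complex_of_real x ^ k)" for k by (intro continuous_intros)
  have cexp: "continuous_on UNIV (\<lambda>x::real. exp (z * of_real x))" by (intro continuous_intros)
  have ch: "continuous_on UNIV (h K)" for K unfolding h_def[abs_def] by (intro continuous_intros)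
  have kb: "cmod (spectral_kernel (\<lambda>x. of_real x ^ k) n m) \<le> 2 * real q * r ^ k" for k m
    by (rule kernel_bound[OF c _ r(2)]) (auto simp: norm_power power_mono)
  note Ms = suminf_norm_le_mult(1)[OF us kb] and Mb = suminf_norm_le_mult(2)[OF us kb]
  \<comment> \<open>All phases have modulus at most \<open>r\<close>, so \<open>\<rho>\<close>
    bounds the argument of the exponential and \<open>\<epsilon> K\<close> is the tail of its
    series, scaled as in \<open>kernel_bound\<close>.\<close>
  define \<rho> where "\<rho> = cmod z * r"
  define \<epsilon> where "\<epsilon> K = 2 * real q * (exp \<rho> - (\<Sum>k<K. \<rho> ^ k / fact k))" for K
  have rs: "(\<lambda>k. \<rho> ^ k / fact k) sums exp \<rho>"
    using exp_converges[of \<rho>] by (simp add: divide_inverse mult.commute)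
  have \<epsilon>: "\<epsilon> \<longlonglongrightarrow> 0"
  proof -
    have "\<epsilon> \<longlonglongrightarrow> 2 * real q * (exp \<rho> - exp \<rho>)"
      unfolding \<epsilon>_def[abs_def] by (intro tendsto_intros rs[unfolded sums_def])
    then show ?thesis by simp
  qed
  have partial: "(\<Sum>k<K. z ^ k / fact k * M k) = (\<Sum>m. u m * spectral_kernel (h K) n m)" for K
  proof -
    have "(\<Sum>k<K. z ^ k / fact k * M k)
        = (\<Sum>k<K. \<Sum>m. z ^ k / fact k * (u m * spectral_kernel (\<lambda>x. of_real x ^ k) n m))"
      unfolding M_def by (intro sum.cong refl suminf_mult[symmetric] Ms)
    also have "\<dots> = (\<Sum>m. \<Sum>k<K. z ^ k / fact k * (u m * spectral_kernel (\<lambda>x. of_real x ^ k) n m))"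
      by (intro suminf_sum[symmetric] summable_mult Ms)
    also have "\<dots> = (\<Sum>m. u m * spectral_kernel (h K) n m)"
      unfolding h_def[abs_def] kernel_sum[OF finite_lessThan c] by (simp add: sum_distrib_left mult_ac)
    finally show ?thesis .
  qed
  have kh: "cmod (spectral_kernel (h K) n m) \<le> B + \<epsilon> K" for K m
  proof -
    have "cmod (spectral_kernel (\<lambda>x. exp (z * of_real x) - h K x) n m) \<le> \<epsilon> K"
      unfolding \<epsilon>_def
    proof (rule kernel_bound[OF _ _ r(2)])
      fix x :: real assume "\<bar>x\<bar> \<le> r"
      then have "cmod (z * of_real x) \<le> \<rho>" by (simp add: \<rho>_def norm_mult mult_left_mono)
      from exp_partial_sum_bound[OF this, of K]
      show "cmod (exp (z * of_real x) - h K x) \<le> exp \<rho> - (\<Sum>k<K. \<rho> ^ k / fact k)"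
        by (simp add: h_def power_mult_distrib mult_ac)
    qed (intro continuous_intros ch)
    then have "cmod (spectral_kernel (\<lambda>x. exp (z * of_real x)) n m - spectral_kernel (h K) n m) \<le> \<epsilon> K"
      by (simp add: kernel_diff[OF cexp ch])
    then show ?thesis
      using B[of n m] norm_triangle_ineq2[of "spectral_kernel (h K) n m" "spectral_kernel (\<lambda>x. exp (z * of_real x)) n m"]
      by (simp add: norm_minus_commute)
  qed
  have "summable (\<lambda>k. z ^ k / fact k * M k)"
  proof (rule summable_comparison_test')
    show "summable (\<lambda>k. (\<rho> ^ k / fact k) * ((\<Sum>m. cmod (u m)) * (2 * real q)))"
      by (rule summable_mult2[OF sums_summable[OF rs]])
    fix k
    have "cmod (z ^ k / fact k * M k) \<le> cmod z ^ k / fact k * ((\<Sum>m. cmod (u m)) * (2 * real q * r ^ k))"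
      unfolding norm_mult M_def by (rule mult_mono[OF _ Mb]) (auto simp: norm_divide norm_power)
    also have "\<dots> = (\<rho> ^ k / fact k) * ((\<Sum>m. cmod (u m)) * (2 * real q))"
      by (simp add: \<rho>_def power_mult_distrib)
    finally show "norm (z ^ k / fact k * M k) \<le> (\<rho> ^ k / fact k) * ((\<Sum>m. cmod (u m)) * (2 * real q))" .
  qed
  then have "(\<lambda>K. \<Sum>k<K. z ^ k / fact k * M k) \<longlonglongrightarrow> exp_op z J (cont_proj J u) n"
    unfolding exp_op_def power_cont_proj[OF u] M_def[symmetric] by (rule summable_LIMSEQ)
  then have lim: "(\<lambda>K. cmod (\<Sum>k<K. z ^ k / fact k * M k)) \<longlonglongrightarrow> cmod (exp_op z J (cont_proj J u) n)"
    by (rule tendsto_norm)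
  have "cmod (exp_op z J (cont_proj J u) n) \<le> (\<Sum>m. cmod (u m)) * (B + 0)"
  proof (rule LIMSEQ_le[OF lim])
    show "(\<lambda>K. (\<Sum>m. cmod (u m)) * (B + \<epsilon> K)) \<longlonglongrightarrow> (\<Sum>m. cmod (u m)) * (B + 0)"
      by (intro tendsto_intros \<epsilon>)
    show "\<exists>N. \<forall>K\<ge>N. cmod (\<Sum>k<K. z ^ k / fact k * M k) \<le> (\<Sum>m. cmod (u m)) * (B + \<epsilon> K)"
      unfolding partial by (intro exI[of _ 0] allI impI suminf_norm_le_mult(2)[OF us kh])
  qed
  then show "ereal (cmod (exp_op z J (cont_proj J u) n)) \<le> ereal (B * ell1_norm u)"
    by (simp add: ell1_norm_def mult.commute)
qed

end

section \<open>Oscillatory integrals\<close>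

text \<open>Integration by parts with the function \<open>exp (\<i> f) / (\<i> f')\<close>. Since
  \<open>f''\<close> has the fixed sign \<tau>, the remaining integral is dominated by that of the
  derivative of \<open>1 / f'\<close>, again a boundary term. Four endpoint values of size at most
  \<open>1 / \<mu>\<close> add up.\<close>

lemma van_der_corput_first:
  fixes f f' f'' :: "real \<Rightarrow> real"
  assumes cd: "c \<le> d" and \<mu>: "0 < \<mu>"
    and f: "\<And>x. x \<in> {c..d} \<Longrightarrow> (f has_real_derivative f' x) (at x within {c..d})"
    and f': "\<And>x. x \<in> {c..d} \<Longrightarrow> (f' has_real_derivative f'' x) (at x within {c..d})"
    and ge: "\<And>x. x \<in> {c..d} \<Longrightarrow> \<mu> \<le> \<bar>f' x\<bar>"
    and sign: "\<And>x. x \<in> {c..d} \<Longrightarrow> 0 \<le> \<tau> * f'' x" and \<tau>: "\<bar>\<tau>\<bar> = 1"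
  shows "cmod (integral {c..d} (\<lambda>x. exp (\<i> * of_real (f x)))) \<le> 4 / \<mu>"
proof -
  define E where "E x = exp (\<i> * complex_of_real (f x))" for x
  define G where "G x = E x * of_real (f'' x) / (\<i> * of_real ((f' x)\<^sup>2))" for x
  have nz: "f' x \<noteq> 0" if "x \<in> {c..d}" for x using ge[OF that] \<mu> by auto
  have contf: "continuous_on {c..d} f" using f by (rule DERIV_continuous_on)
  have Eint: "E integrable_on {c..d}"
    unfolding E_def by (intro integrable_continuous_interval continuous_intros contf)
  have "((\<lambda>x. E x - G x) has_integral E d / (\<i> * of_real (f' d)) - E c / (\<i> * of_real (f' c))) {c..d}"
  proof (rule fundamental_theorem_of_calculus[OF cd])
    fix x assume x: "x \<in> {c..d}"
    have df: "((\<lambda>x. complex_of_real (f x)) has_vector_derivative of_real (f' x)) (at x within {c..d})"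
      and df': "((\<lambda>x. complex_of_real (f' x)) has_vector_derivative of_real (f'' x)) (at x within {c..d})"
      using f[OF x] f'[OF x] by (auto intro!: has_vector_derivative_of_real
          simp: has_real_derivative_iff_has_vector_derivative)
    have dE: "(E has_vector_derivative \<i> * of_real (f' x) * E x) (at x within {c..d})"
    proof -
      have "((exp \<circ> (\<lambda>x. \<i> * complex_of_real (f x))) has_vector_derivative
          (\<i> * of_real (f' x)) * exp (\<i> * complex_of_real (f x))) (at x within {c..d})"
        by (rule field_vector_diff_chain_within)
          (auto intro!: has_vector_derivative_mult_right df DERIV_exp[THEN has_field_derivative_at_within])
      then show ?thesis by (simp add: E_def[abs_def] o_def)
    qed
    have di: "((\<lambda>x. inverse (complex_of_real (f' x))) has_vector_derivative
        of_real (f'' x) * (- ((inverse (of_real (f' x)))\<^sup>2))) (at x within {c..d})"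
    proof -
      have "((inverse \<circ> (\<lambda>x. complex_of_real (f' x))) has_vector_derivative
          of_real (f'' x) * (- ((inverse (of_real (f' x)))\<^sup>2))) (at x within {c..d})"
        by (rule field_vector_diff_chain_within[OF df'])
          (use nz[OF x] in \<open>auto intro!: derivative_eq_intros simp: power2_eq_square\<close>)
      then show ?thesis by (simp add: o_def)
    qed
    have "((\<lambda>x. - \<i> * (E x * inverse (complex_of_real (f' x)))) has_vector_derivative
        - \<i> * (E x * (of_real (f'' x) * (- ((inverse (of_real (f' x)))\<^sup>2)))
          + \<i> * of_real (f' x) * E x * inverse (complex_of_real (f' x)))) (at x within {c..d})"
      by (intro has_vector_derivative_mult_right has_vector_derivative_mult dE di)
    moreover have "- \<i> * (E x * (of_real (f'' x) * (- ((inverse (of_real (f' x)))\<^sup>2)))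
          + \<i> * of_real (f' x) * E x * inverse (complex_of_real (f' x))) = E x - G x"
      using nz[OF x] by (simp add: G_def field_simps power2_eq_square)
    moreover have "(\<lambda>x. - \<i> * (E x * inverse (complex_of_real (f' x)))) = (\<lambda>x. E x / (\<i> * of_real (f' x)))"
      by (simp add: fun_eq_iff divide_inverse mult_ac)
    ultimately show "((\<lambda>x. E x / (\<i> * of_real (f' x))) has_vector_derivative E x - G x) (at x within {c..d})"
      by simp
  qed
  from has_integral_diff[OF integrable_integral[OF Eint] this]
  have G: "(G has_integral integral {c..d} E
      - (E d / (\<i> * of_real (f' d)) - E c / (\<i> * of_real (f' c)))) {c..d}" by simp
  have bnd: "((\<lambda>x. \<tau> * (f'' x / (f' x)\<^sup>2)) has_integral \<tau> * (1 / f' c - 1 / f' d)) {c..d}"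
  proof -
    have "((\<lambda>x. f'' x / (f' x)\<^sup>2) has_integral - inverse (f' d) - - inverse (f' c)) {c..d}"
    proof (rule fundamental_theorem_of_calculus[OF cd])
      fix x assume x: "x \<in> {c..d}"
      show "((\<lambda>x. - inverse (f' x)) has_vector_derivative f'' x / (f' x)\<^sup>2) (at x within {c..d})"
        unfolding has_real_derivative_iff_has_vector_derivative[symmetric]
        by (rule derivative_eq_intros f'[OF x] nz[OF x] refl)+
          (use nz[OF x] in \<open>simp add: field_simps power2_eq_square\<close>)
    qed
    from has_integral_mult_right[OF this, of \<tau>] show ?thesis by (simp add: divide_inverse)
  qed
  have inv: "\<bar>1 / f' x\<bar> \<le> 1 / \<mu>" if "x \<in> {c..d}" for x
    using ge[OF that] \<mu> by (simp add: abs_divide frac_le)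
  have E1: "cmod (E x / (\<i> * of_real (f' x))) \<le> 1 / \<mu>" if "x \<in> {c..d}" for x
    using inv[OF that] by (simp add: E_def norm_divide norm_mult abs_divide)
  have "cmod (integral {c..d} G) \<le> integral {c..d} (\<lambda>x. \<tau> * (f'' x / (f' x)\<^sup>2))"
  proof (rule integral_norm_bound_integral)
    show "G integrable_on {c..d}" "(\<lambda>x. \<tau> * (f'' x / (f' x)\<^sup>2)) integrable_on {c..d}"
      using G bnd by blast+
    fix x assume x: "x \<in> {c..d}"
    have "\<bar>f'' x\<bar> = \<tau> * f'' x" using sign[OF x] \<tau> by (auto simp: abs_if split: if_splits)
    then show "cmod (G x) \<le> \<tau> * (f'' x / (f' x)\<^sup>2)"
      by (simp add: G_def E_def norm_divide norm_mult norm_power)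
  qed
  also have "\<dots> = \<tau> * (1 / f' c - 1 / f' d)" using bnd by (rule integral_unique)
  also have "\<dots> \<le> \<bar>\<tau> * (1 / f' c - 1 / f' d)\<bar>" by (rule abs_ge_self)
  also have "\<dots> \<le> \<bar>1 / f' c\<bar> + \<bar>1 / f' d\<bar>" unfolding abs_mult \<tau> mult_1 by (rule abs_triangle_ineq4)
  also have "\<dots> \<le> 1 / \<mu> + 1 / \<mu>" by (intro add_mono inv) (use cd in auto)
  also have "\<dots> = 2 / \<mu>" by simp
  finally have "cmod (integral {c..d} G) \<le> 2 / \<mu>" .
  moreover have "integral {c..d} E = integral {c..d} G + E d / (\<i> * of_real (f' d)) - E c / (\<i> * of_real (f' c))"
    using integral_unique[OF G] by simp
  ultimately have "cmod (integral {c..d} E) \<le> 2 / \<mu> + 1 / \<mu> + 1 / \<mu>"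
    using norm_triangle_ineq4[of "integral {c..d} G + E d / (\<i> * of_real (f' d))" "E c / (\<i> * of_real (f' c))"]
      norm_triangle_ineq[of "integral {c..d} G" "E d / (\<i> * of_real (f' d))"] E1[of c] E1[of d] cd by simp
  then show ?thesis by (simp add: E_def[abs_def])
qed

text \<open>If \<open>g' \<ge> \<mu>\<close>, then \<open>g\<close> has modulus at least
  \<open>\<delta> * \<mu>\<close> outside a window of length at most \<open>2 * \<delta>\<close>.
  The window is estimated trivially, its two sides by \<open>piece\<close>. Stated for any
  integrand, this serves the base and the step of the induction alike.\<close>

lemma split_at_stationary_point:
  fixes h :: "real \<Rightarrow> complex" and g g' :: "real \<Rightarrow> real"
  assumes cd: "c \<le> d" and \<mu>: "0 < \<mu>" and \<delta>: "0 < \<delta>" and K: "0 \<le> K"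
    and g: "\<And>x. x \<in> {c..d} \<Longrightarrow> (g has_real_derivative g' x) (at x within {c..d})"
    and ge: "\<And>x. x \<in> {c..d} \<Longrightarrow> \<mu> \<le> g' x"
    and h: "continuous_on {c..d} h" "\<And>x. x \<in> {c..d} \<Longrightarrow> cmod (h x) \<le> 1"
    and piece: "\<And>c' d' \<sigma>. c \<le> c' \<Longrightarrow> c' \<le> d' \<Longrightarrow> d' \<le> d \<Longrightarrow> \<bar>\<sigma>\<bar> = 1 \<Longrightarrow>
      (\<And>x. x \<in> {c'..d'} \<Longrightarrow> \<delta> * \<mu> \<le> \<sigma> * g x) \<Longrightarrow> cmod (integral {c'..d'} h) \<le> K"
  shows "cmod (integral {c..d} h) \<le> 2 * K + 2 * \<delta>"
proof -
  have incr: "\<mu> * (y - x) \<le> g y - g x" if "c \<le> x" "x \<le> y" "y \<le> d" for x y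
  proof (cases "x < y")
    case True
    have "\<exists>z\<in>{x<..<y}. g y - g x = g' z * (y - x)"
    proof (rule mvt_simple[OF True, where f' = "\<lambda>x h. g' x * h"])
      fix z assume "x \<le> z" "z \<le> y"
      then have "(g has_real_derivative g' z) (at z within {x..y})"
        using g[of z] that by (auto intro: has_field_derivative_subset)
      then show "(g has_derivative (*) (g' z)) (at z within {x..y})"
        by (simp add: has_field_derivative_def)
    qed
    then obtain z where "x < z" "z < y" "g y - g x = (y - x) * g' z" by (auto simp: mult.commute)
    moreover have "(y - x) * \<mu> \<le> (y - x) * g' z"
      using ge[of z] that calculation by (intro mult_left_mono) auto
    ultimately show ?thesis by (simp add: mult.commute)
  qed (use that in simp)
  have cont_g: "continuous_on {c..d} g" using g by (rule DERIV_continuous_on)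
  \<comment> \<open>A zero of \<open>g\<close>, or the end of the interval at which \<open>g\<close>
    is closest to 0 if it has none.\<close>
  obtain x0 where x0: "c \<le> x0" "x0 \<le> d"
    and right: "\<And>x. x0 < x \<Longrightarrow> x \<le> d \<Longrightarrow> \<mu> * (x - x0) \<le> g x"
    and left: "\<And>x. c \<le> x \<Longrightarrow> x < x0 \<Longrightarrow> \<mu> * (x0 - x) \<le> - g x"
  proof -
    consider "0 \<le> g c" | "g d \<le> 0" | "g c \<le> 0" "0 \<le> g d" by linarith
    then show ?thesis
    proof cases
      case 1
      have "\<mu> * (x - c) \<le> g x" if "c < x" "x \<le> d" for x using incr[of c x] 1 that by simp
      then show ?thesis using that[of c] cd by force
    next
      case 2
      have "\<mu> * (d - x) \<le> - g x" if "c \<le> x" "x < d" for x using incr[of x d] 2 that by simp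
      then show ?thesis using that[of d] cd by force
    next
      case 3
      then obtain x0 where "c \<le> x0" "x0 \<le> d" "g x0 = 0"
        using IVT'[of g c 0 d] cd cont_g by auto
      moreover from this have "\<mu> * (x - x0) \<le> g x" if "x0 < x" "x \<le> d" for x
        using incr[of x0 x] that by simp
      moreover have "\<mu> * (x0 - x) \<le> - g x" if "c \<le> x" "x < x0" for x
        using incr[of x x0] that calculation by simp
      ultimately show ?thesis using that[of x0] by blast
    qed
  qed
  define l r where "l = max c (x0 - \<delta>)" and "r = min d (x0 + \<delta>)"
  have lr: "c \<le> l" "l \<le> r" "r \<le> d" "r - l \<le> 2 * \<delta>" using x0 cd \<delta> by (auto simp: l_def r_def)
  have hi: "h integrable_on {x..y}" if "c \<le> x" "y \<le> d" for x y
    using that by (intro integrable_continuous_interval continuous_on_subset[OF h(1)]) auto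
  have 1: "cmod (integral {c..l} h) \<le> K"
  proof (cases "l = c")
    case False
    then have l: "l = x0 - \<delta>" by (auto simp: l_def max_def split: if_splits)
    show ?thesis
    proof (rule piece[of c l "- 1"])
      fix x assume x: "x \<in> {c..l}"
      have "\<delta> * \<mu> \<le> \<mu> * (x0 - x)" using x l \<mu> by (simp add: mult.commute)
      also have "\<dots> \<le> - g x" using left[of x] x l \<delta> by auto
      finally show "\<delta> * \<mu> \<le> - 1 * g x" by simp
    qed (use lr in auto)
  qed (use K in auto)
  have 2: "cmod (integral {r..d} h) \<le> K"
  proof (cases "r = d")
    case False
    then have r: "r = x0 + \<delta>" by (auto simp: r_def min_def split: if_splits)
    show ?thesis
    proof (rule piece[of r d 1])
      fix x assume x: "x \<in> {r..d}"
      have "\<delta> * \<mu> \<le> \<mu> * (x - x0)" using x r \<mu> by (simp add: mult.commute)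
      also have "\<dots> \<le> g x" using right[of x] x r \<delta> by auto
      finally show "\<delta> * \<mu> \<le> 1 * g x" by simp
    qed (use lr in auto)
  qed (use K in auto)
  have 3: "cmod (integral {l..r} h) \<le> 2 * \<delta>"
    using has_integral_bound_real[OF zero_le_one finite.emptyI integrable_integral[OF hi[of l r]]] lr h(2) by force
  have "integral {c..d} h = integral {c..l} h + integral {l..r} h + integral {r..d} h"
    using Henstock_Kurzweil_Integration.integral_combine[of c l r h]
      Henstock_Kurzweil_Integration.integral_combine[of c r d h] lr hi by auto
  then show ?thesis
    using 1 2 3 norm_triangle_ineq[of "integral {c..l} h + integral {l..r} h" "integral {r..d} h"]
      norm_triangle_ineq[of "integral {c..l} h" "integral {l..r} h"] by simp
qed

text \<open>The recursion is the outcome of \<open>split_at_stationary_point\<close>: two outer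
  pieces and the window. The value 4 is that of \<open>van_der_corput_first\<close>.\<close>

fun corput_const :: "nat \<Rightarrow> real" where
  "corput_const 0 = 1"
| "corput_const (Suc 0) = 4"
| "corput_const (Suc (Suc m)) = 2 * corput_const (Suc m) + 2"

lemma corput_const_pos: "0 < corput_const m"
  by (induction m rule: corput_const.induct) auto

text \<open>Induction on the order of the derivative. Order one would require a monotone
  \<open>f'\<close> as well, so it starts at order two, where the bound on the second derivative
  supplies the monotonicity.\<close>

lemma van_der_corput:
  fixes f :: "nat \<Rightarrow> real \<Rightarrow> real"
  assumes "c \<le> d" "0 < \<mu>" "2 \<le> m" "\<bar>\<sigma>\<bar> = 1"
    and "\<And>i x. i < m \<Longrightarrow> x \<in> {c..d} \<Longrightarrow> (f i has_real_derivative f (Suc i) x) (at x within {c..d})"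
    and "\<And>x. x \<in> {c..d} \<Longrightarrow> \<mu> \<le> \<sigma> * f m x"
  shows "cmod (integral {c..d} (\<lambda>x. exp (\<i> * of_real (f 0 x)))) \<le> corput_const m * \<mu> powr (- 1 / real m)"
  using assms(3,1,2,4-6)
proof (induction m arbitrary: c d \<mu> \<sigma> rule: dec_induct)
  case base
  \<comment> \<open>Balances the window against the outer pieces:
    \<open>1 / (\<delta> * \<mu>) = \<delta>\<close>.\<close>
  define \<delta> where "\<delta> = \<mu> powr (- 1 / 2)"
  have \<delta>: "0 < \<delta>" using base by (simp add: \<delta>_def)
  have \<delta>\<mu>: "1 / (\<delta> * \<mu>) = \<delta>"
  proof -
    have "\<delta> * \<delta> = \<mu> powr (- 1)" unfolding \<delta>_def powr_add[symmetric] by simp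
    then have "\<delta> * \<delta> * \<mu> = 1" using base by (simp add: powr_minus)
    then show ?thesis using \<delta> base by (simp add: field_simps)
  qed
  have d: "(f i has_real_derivative f (Suc i) x) (at x within {c'..d'})"
    if "c \<le> c'" "d' \<le> d" "x \<in> {c'..d'}" "i < 2" for c' d' x i
    using base.prems(4)[of i x] that by (auto intro: has_field_derivative_subset)
  have "cmod (integral {c..d} (\<lambda>x. exp (\<i> * of_real (f 0 x)))) \<le> 2 * (4 / (\<delta> * \<mu>)) + 2 * \<delta>"
  proof (rule split_at_stationary_point[where g = "\<lambda>x. \<sigma> * f 1 x" and g' = "\<lambda>x. \<sigma> * f 2 x"])
    show "((\<lambda>x. \<sigma> * f 1 x) has_real_derivative \<sigma> * f 2 x) (at x within {c..d})" if "x \<in> {c..d}" for x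
      using d[of c d x 1] that by (intro DERIV_cmult) (simp add: numeral_2_eq_2)
    show "continuous_on {c..d} (\<lambda>x. exp (\<i> * complex_of_real (f 0 x)))"
      by (intro continuous_intros DERIV_continuous_on[where D = "f (Suc 0)"]) (use d[of c d _ 0] in auto)
    fix c' d' \<sigma>' :: real
    assume *: "c \<le> c'" "c' \<le> d'" "d' \<le> d" "\<bar>\<sigma>'\<bar> = 1" "\<And>x. x \<in> {c'..d'} \<Longrightarrow> \<delta> * \<mu> \<le> \<sigma>' * (\<sigma> * f 1 x)"
    show "cmod (integral {c'..d'} (\<lambda>x. exp (\<i> * of_real (f 0 x)))) \<le> 4 / (\<delta> * \<mu>)"
    proof (rule van_der_corput_first[where f' = "f 1" and f'' = "f 2" and \<tau> = \<sigma>])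
      show "\<delta> * \<mu> \<le> \<bar>f 1 x\<bar>" if "x \<in> {c'..d'}" for x
        using *(5)[OF that] *(4) base.prems(3) abs_ge_self[of "\<sigma>' * (\<sigma> * f 1 x)"] by (simp add: abs_mult)
      show "0 \<le> \<sigma> * f 2 x" if "x \<in> {c'..d'}" for x
        using base.prems(5)[of x] base.prems(2) that * by auto
    qed (use * d[of c' d' _ 0] d[of c' d' _ 1] \<delta> base.prems in \<open>auto simp: numeral_2_eq_2\<close>)
  qed (use base.prems \<delta> in auto)
  also have "\<dots> = 10 * \<delta>" using \<delta>\<mu> by (simp add: divide_inverse)
  finally show ?case by (simp add: \<delta>_def numeral_2_eq_2)
next
  case (step m)
  \<comment> \<open>Balanced so that the bound of order \<open>m\<close> with
    \<open>\<delta> * \<mu>\<close> in place of \<open>\<mu>\<close> is again a multiple of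
    \<open>\<delta>\<close>.\<close>
  define \<delta> where "\<delta> = \<mu> powr (- 1 / real (Suc m))"
  have \<delta>: "0 < \<delta>" using step.prems by (simp add: \<delta>_def)
  have m: "0 < real m" using step.hyps by simp
  have \<delta>\<mu>: "(\<delta> * \<mu>) powr (- 1 / real m) = \<delta>"
  proof -
    have "\<delta> * \<mu> = \<mu> powr (- 1 / real (Suc m) + 1)"
      unfolding \<delta>_def powr_add using step.prems by simp
    also have "- 1 / real (Suc m) + 1 = real m / real (Suc m)" by (simp add: field_simps)
    finally show ?thesis using m by (simp add: powr_powr \<delta>_def)
  qed
  have d: "(f i has_real_derivative f (Suc i) x) (at x within {c'..d'})"
    if "c \<le> c'" "d' \<le> d" "x \<in> {c'..d'}" "i < Suc m" for c' d' x i
    using step.prems(4)[of i x] that by (auto intro: has_field_derivative_subset)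
  have "cmod (integral {c..d} (\<lambda>x. exp (\<i> * of_real (f 0 x)))) \<le> 2 * (corput_const m * \<delta>) + 2 * \<delta>"
  proof (rule split_at_stationary_point[where g = "\<lambda>x. \<sigma> * f m x" and g' = "\<lambda>x. \<sigma> * f (Suc m) x"])
    show "((\<lambda>x. \<sigma> * f m x) has_real_derivative \<sigma> * f (Suc m) x) (at x within {c..d})" if "x \<in> {c..d}" for x
      using d[of c d x m] that by (intro DERIV_cmult) simp
    show "continuous_on {c..d} (\<lambda>x. exp (\<i> * complex_of_real (f 0 x)))"
      by (intro continuous_intros DERIV_continuous_on[where D = "f (Suc 0)"]) (use d[of c d _ 0] in auto)
    fix c' d' \<sigma>' :: real
    assume *: "c \<le> c'" "c' \<le> d'" "d' \<le> d" "\<bar>\<sigma>'\<bar> = 1" "\<And>x. x \<in> {c'..d'} \<Longrightarrow> \<delta> * \<mu> \<le> \<sigma>' * (\<sigma> * f m x)"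
    have "cmod (integral {c'..d'} (\<lambda>x. exp (\<i> * of_real (f 0 x))))
        \<le> corput_const m * (\<delta> * \<mu>) powr (- 1 / real m)"
    proof (rule step.IH[of c' d' "\<delta> * \<mu>" "\<sigma>' * \<sigma>"])
      show "\<delta> * \<mu> \<le> \<sigma>' * \<sigma> * f m x" if "x \<in> {c'..d'}" for x
        using *(5)[OF that] by (simp add: mult.assoc)
      show "(f i has_real_derivative f (Suc i) x) (at x within {c'..d'})"
        if "i < m" "x \<in> {c'..d'}" for i x
        using d[of c' d' x i] * that by simp
    qed (use * \<delta> step.prems(2,3) in \<open>simp_all add: abs_mult\<close>)
    then show "cmod (integral {c'..d'} (\<lambda>x. exp (\<i> * of_real (f 0 x)))) \<le> corput_const m * \<delta>"
      unfolding \<delta>\<mu> .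
  qed (use step.prems \<delta> corput_const_pos[of m] in auto)
  also have "\<dots> = corput_const (Suc m) * \<delta>"
    using step.hyps by (cases m) (auto simp: algebra_simps)
  finally show ?case by (simp add: \<delta>_def)
qed

text \<open>Integration by parts moves the oscillation into the primitive of \<open>h\<close>, which
  is at most \<open>K\<close> on every initial interval.\<close>

lemma integral_amplitude_bound:
  fixes h A A' :: "real \<Rightarrow> complex"
  assumes cd: "c \<le> d" and h: "continuous_on {c..d} h"
    and A: "\<And>x. x \<in> {c..d} \<Longrightarrow> (A has_vector_derivative A' x) (at x within {c..d})"
    and M: "\<And>x. x \<in> {c..d} \<Longrightarrow> cmod (A x) \<le> M0" "\<And>x. x \<in> {c..d} \<Longrightarrow> cmod (A' x) \<le> M1"
    and K: "\<And>x. x \<in> {c..d} \<Longrightarrow> cmod (integral {c..x} h) \<le> K"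
  shows "cmod (integral {c..d} (\<lambda>x. h x * A x)) \<le> K * (M0 + M1 * (d - c))"
proof -
  define H where "H x = integral {c..x} h" for x
  have H: "(H has_vector_derivative h x) (at x within {c..d})" if "x \<in> {c..d}" for x
    unfolding H_def[abs_def] by (rule integral_has_vector_derivative[OF h that])
  have K0: "0 \<le> K" using order_trans[OF norm_ge_zero K[of c]] cd by simp
  have contA: "continuous_on {c..d} A"
    using A by (meson continuous_on_vector_derivative)
  have 1: "((\<lambda>x. h x * A x) has_integral integral {c..d} (\<lambda>x. h x * A x)) {c..d}"
    by (intro integrable_integral integrable_continuous_interval continuous_intros h contA)
  have "((\<lambda>x. H x * A' x + h x * A x) has_integral H d * A d - H c * A c) {c..d}"
    by (rule fundamental_theorem_of_calculus[OF cd])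
      (intro has_vector_derivative_mult H A)
  from has_integral_diff[OF this 1]
  have 2: "((\<lambda>x. H x * A' x) has_integral H d * A d - integral {c..d} (\<lambda>x. h x * A x)) {c..d}"
    by (simp add: H_def)
  have bnd: "cmod (H x * A' x) \<le> K * M1" if "x \<in> {c..d}" for x
    unfolding norm_mult H_def by (intro mult_mono K M that) (use K0 in auto)
  have "0 \<le> K * M1" using order_trans[OF norm_ge_zero bnd[of c]] cd by simp
  from has_integral_bound_real[OF this finite.emptyI 2] bnd cd
  have "cmod (H d * A d - integral {c..d} (\<lambda>x. h x * A x)) \<le> K * M1 * (d - c)" by simp
  moreover have "cmod (H d * A d) \<le> K * M0"
    unfolding norm_mult H_def by (intro mult_mono K M) (use K0 cd in auto)
  ultimately have "cmod (integral {c..d} (\<lambda>x. h x * A x)) \<le> K * M0 + K * M1 * (d - c)"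
    using norm_triangle_ineq4[of "H d * A d" "H d * A d - integral {c..d} (\<lambda>x. h x * A x)"] by simp
  then show ?thesis by (simp add: algebra_simps)
qed

text \<open>The linear phase \<open>L x\<close> drops out because only derivatives of order at least two are used.\<close>

lemma oscillatory_integral_bound:
  fixes k :: "nat \<Rightarrow> real \<Rightarrow> real" and A A' :: "real \<Rightarrow> complex"
  assumes cd: "c \<le> d" and \<mu>: "0 < \<mu>" and t: "0 < t" and m: "2 \<le> m" and \<sigma>: "\<bar>\<sigma>\<bar> = 1"
    and k: "\<And>i x. i < m \<Longrightarrow> x \<in> {c..d} \<Longrightarrow> (k i has_real_derivative k (Suc i) x) (at x within {c..d})"
    and ge: "\<And>x. x \<in> {c..d} \<Longrightarrow> \<mu> \<le> \<sigma> * k m x"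
    and A: "\<And>x. x \<in> {c..d} \<Longrightarrow> (A has_vector_derivative A' x) (at x within {c..d})"
    and M: "\<And>x. x \<in> {c..d} \<Longrightarrow> cmod (A x) \<le> M0" "\<And>x. x \<in> {c..d} \<Longrightarrow> cmod (A' x) \<le> M1"
  shows "cmod (integral {c..d} (\<lambda>x. exp (\<i> * of_real (L * x - t * k 0 x)) * A x))
    \<le> corput_const m * (t * \<mu>) powr (- 1 / real m) * (M0 + M1 * (d - c))"
proof (rule integral_amplitude_bound[OF cd _ A M])
  define f where "f i x = (if i = 0 then L * x else if i = 1 then L else 0) - t * k i x" for i x
  have f: "(f i has_real_derivative f (Suc i) x) (at x within {c..d'})"
    if "i < m" "x \<in> {c..d'}" "d' \<le> d" for i x d'
  proof -
    have ki: "(k i has_real_derivative k (Suc i) x) (at x within {c..d'})"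
      using k[of i x] that by (auto intro: has_field_derivative_subset)
    have "((\<lambda>x. if i = 0 then L * x else if i = 1 then L else 0) has_real_derivative
        (if Suc i = 0 then L * x else if Suc i = 1 then L else 0)) (at x within {c..d'})"
      by (cases "i = 0"; cases "i = 1") (auto intro!: derivative_eq_intros)
    then show ?thesis unfolding f_def[abs_def] by (intro DERIV_diff DERIV_cmult ki)
  qed
  show "continuous_on {c..d} (\<lambda>x. exp (\<i> * complex_of_real (L * x - t * k 0 x)))"
    by (intro continuous_intros DERIV_continuous_on[where D = "k (Suc 0)"]) (use k[of 0] m in auto)
  fix d' assume d': "d' \<in> {c..d}"
  have "cmod (integral {c..d'} (\<lambda>x. exp (\<i> * of_real (f 0 x)))) \<le> corput_const m * (t * \<mu>) powr (- 1 / real m)"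
  \<comment> \<open>The phase contains \<open>- t * k\<close>, whence the opposite sign.\<close>
  proof (rule van_der_corput[where \<sigma> = "- \<sigma>"])
    fix x assume "x \<in> {c..d'}"
    then have "t * \<mu> \<le> t * (\<sigma> * k m x)" using ge[of x] d' t by (intro mult_left_mono) auto
    then show "t * \<mu> \<le> - \<sigma> * f m x" using m by (simp add: f_def algebra_simps)
  qed (use f d' t \<mu> m \<sigma> in auto)
  then show "cmod (integral {c..d'} (\<lambda>x. exp (\<i> * complex_of_real (L * x - t * k 0 x))))
      \<le> corput_const m * (t * \<mu>) powr (- 1 / real m)"
    by (simp add: f_def)
qed

section \<open>Holomorphic continuation of the phase functions\<close>

text \<open>The real and the complex \<open>D_poly\<close> are separate polynomials; their
  derivatives are compared by differentiating along the real axis.\<close>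

lemma pderiv_of_real:
  fixes f :: "complex poly" and g :: "real poly"
  assumes "\<And>x. poly f (of_real x) = of_real (poly g x)"
  shows "poly (pderiv f) (of_real x) = of_real (poly (pderiv g) x)"
proof (rule vector_derivative_unique_at)
  show "((\<lambda>x. poly f (of_real x)) has_vector_derivative poly (pderiv f) (of_real x)) (at x)"
    by (rule has_vector_derivative_real_field) (rule poly_DERIV)
  have "((\<lambda>x. complex_of_real (poly g x)) has_vector_derivative of_real (poly (pderiv g) x)) (at x)"
    by (rule has_vector_derivative_of_real)
      (use poly_DERIV in \<open>simp add: has_real_derivative_iff_has_vector_derivative[symmetric]\<close>)
  then show "((\<lambda>x. poly f (of_real x)) has_vector_derivative of_real (poly (pderiv g) x)) (at x)"
    by (simp add: assms)
qed

lemma local_inverse: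
  fixes f :: "complex \<Rightarrow> complex"
  assumes "f holomorphic_on S" "open S" "\<xi> \<in> S" "deriv f \<xi> \<noteq> 0"
  obtains \<rho> g where "0 < \<rho>" "ball \<xi> \<rho> \<subseteq> S" "open (f ` ball \<xi> \<rho>)" "g holomorphic_on f ` ball \<xi> \<rho>"
    "\<And>z. z \<in> ball \<xi> \<rho> \<Longrightarrow> g (f z) = z"
proof -
  obtain \<rho> where \<rho>: "0 < \<rho>" "ball \<xi> \<rho> \<subseteq> S" "open (f ` ball \<xi> \<rho>)" "inj_on f (ball \<xi> \<rho>)"
    using has_complex_derivative_locally_invertible[OF assms(1,3,2,4)] by metis
  obtain g where "g holomorphic_on f ` ball \<xi> \<rho>" "\<And>z. z \<in> ball \<xi> \<rho> \<Longrightarrow> g (f z) = z"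
    using holomorphic_has_inverse[OF holomorphic_on_subset[OF assms(1) \<rho>(2)] open_ball \<rho>(4)] by metis
  then show ?thesis using that \<rho> by blast
qed

text \<open>Selects the branch of a square root: \<open>\<epsilon>\<close> records the sign of
  \<open>z\<close>, \<open>\<epsilon>'\<close> that of \<open>s\<close>.\<close>

lemma sq_eq_imp_sign:
  fixes z :: complex and s x \<epsilon> :: real
  assumes "z\<^sup>2 = of_real (s\<^sup>2)" "0 \<le> \<epsilon> * Re z" "0 \<le> \<epsilon>' * s" "\<bar>\<epsilon>\<bar> = 1" "\<bar>\<epsilon>'\<bar> = 1"
  shows "z = of_real (\<epsilon> * \<epsilon>' * s)"
proof -
  have "z = of_real s \<or> z = - of_real s" using assms(1) by (simp add: power2_eq_iff)
  then show ?thesis using assms(2-5) by (auto simp: abs_if zero_le_mult_iff split: if_splits)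
qed

context periodic_coeffs
begin

lemma D'_of_real: "D' (of_real x :: complex) = of_real (D' x)"
  by (rule pderiv_of_real) (rule D_of_real)

lemma D''_of_real: "D'' (of_real x :: complex) = of_real (D'' x)"
  by (rule pderiv_of_real) (rule D'_of_real)

lemma phase_near:
  assumes "j < q" "0 < \<rho>"
  obtains r where "0 < r" "\<And>\<phi>. \<bar>\<phi> - \<phi>0\<bar> < r \<Longrightarrow> \<bar>phase j \<phi> - phase j \<phi>0\<bar> < \<rho>"
proof -
  have "isCont (phase j) \<phi>0"
    using continuous_phase[OF assms(1), of UNIV] by (simp add: continuous_on_eq_continuous_at)
  then show ?thesis
    using assms(2) that unfolding continuous_at_eps_delta dist_real_def by metis
qed

text \<open>Composes a local inverse of \<open>D\<close> with \<open>2 * cos\<close>. Continuity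
  keeps the phase in the domain of injectivity, so the inverse picks out the phase of this
  band.\<close>

lemma local_extension_regular:
  assumes j: "j < q" and nz: "D' (phase j \<phi>0) \<noteq> 0"
  shows "\<exists>r K. 0 < r \<and> K holomorphic_on ball (of_real \<phi>0) r \<and>
    (\<forall>z\<in>ball (of_real \<phi>0) r. D (K z) = 2 * cos z) \<and>
    (\<forall>\<phi>. \<bar>\<phi> - \<phi>0\<bar> < r \<longrightarrow> K (of_real \<phi>) = of_real (phase j \<phi>))"
proof -
  define \<xi> where "\<xi> = complex_of_real (phase j \<phi>0)"
  have dD: "deriv D \<xi> = D' \<xi>" by (rule DERIV_imp_deriv[OF D_deriv])
  obtain \<rho> g where \<rho>: "0 < \<rho>" "open (D ` ball \<xi> \<rho>)" "g holomorphic_on D ` ball \<xi> \<rho>"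
    and g: "\<And>z. z \<in> ball \<xi> \<rho> \<Longrightarrow> g (D z) = z"
  proof (rule local_inverse[of "D :: complex \<Rightarrow> complex" UNIV \<xi>])
    show "deriv D \<xi> \<noteq> 0" using nz unfolding dD unfolding \<xi>_def D'_of_real by simp
  qed (auto intro!: holomorphic_intros)
  define T where "T = (\<lambda>z::complex. 2 * cos z) -` (D ` ball \<xi> \<rho>)"
  have "open T"
    unfolding T_def by (rule open_vimage[OF \<rho>(2)]) (intro continuous_intros)
  moreover have cosD: "2 * cos (complex_of_real \<phi>) = D (complex_of_real (phase j \<phi>))" for \<phi>
    by (simp add: D_of_real D_phase[OF j] cos_of_real)
  then have "of_real \<phi>0 \<in> T"
    unfolding T_def using \<rho>(1) by (auto simp: \<xi>_def)
  ultimately obtain r1 where r1: "0 < r1" "ball (of_real \<phi>0) r1 \<subseteq> T"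
    by (meson open_contains_ball)
  obtain r2 where r2: "0 < r2" "\<And>\<phi>. \<bar>\<phi> - \<phi>0\<bar> < r2 \<Longrightarrow> \<bar>phase j \<phi> - phase j \<phi>0\<bar> < \<rho>"
    using phase_near[OF j \<rho>(1)] by metis
  define K where "K z = g (2 * cos z)" for z
  have T: "2 * cos z \<in> D ` ball \<xi> \<rho>" if "z \<in> ball (of_real \<phi>0) (min r1 r2)" for z
    using r1(2) that by (auto simp: T_def)
  show ?thesis
  proof (intro exI[of _ "min r1 r2"] exI[of _ K] conjI ballI allI impI)
    show "K holomorphic_on ball (of_real \<phi>0) (min r1 r2)"
      unfolding K_def[abs_def]
      by (rule holomorphic_on_compose_gen[OF _ \<rho>(3), unfolded o_def])
        (use T in \<open>auto intro!: holomorphic_intros\<close>)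
    show "D (K z) = 2 * cos z" if "z \<in> ball (of_real \<phi>0) (min r1 r2)" for z
      using T[OF that] g unfolding K_def by auto
    show "K (of_real \<phi>) = of_real (phase j \<phi>)" if "\<bar>\<phi> - \<phi>0\<bar> < min r1 r2" for \<phi>
    proof -
      have "of_real (phase j \<phi>) \<in> ball \<xi> \<rho>"
        using r2(2)[of \<phi>] that by (simp add: \<xi>_def dist_norm abs_minus_commute flip: of_real_diff)
      then show ?thesis by (simp add: K_def cosD g)
    qed
  qed (use r1 r2 in auto)
qed

text \<open>At a closed gap \<open>D\<close> has a nondegenerate extremum, so that a holomorphic square root
  \<open>\<psi>\<close> of \<open>2 - \<sigma> D\<close> is a local coordinate in which the phase is \<open>2 sin ((\<phi> - \<phi>0) / 2)\<close> up to sign.\<close>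

lemma local_extension_closed_gap:
  assumes j: "j < q" and \<phi>0: "\<phi>0 \<in> {-pi..0}" and z: "D' (phase j \<phi>0) = 0"
  shows "\<exists>r K. 0 < r \<and> K holomorphic_on ball (of_real \<phi>0) r \<and>
    (\<forall>z\<in>ball (of_real \<phi>0) r. D (K z) = 2 * cos z) \<and>
    (\<forall>\<phi>\<in>{-pi..0}. \<bar>\<phi> - \<phi>0\<bar> < r \<longrightarrow> K (of_real \<phi>) = of_real (phase j \<phi>))"
proof -
  define x0 where "x0 = phase j \<phi>0"
  define \<xi> where "\<xi> = complex_of_real x0"
  define \<sigma> where "\<sigma> = D x0 / 2"
  have \<sigma>cos: "\<sigma> = cos \<phi>0" by (simp add: \<sigma>_def x0_def D_phase[OF j])
  have D2: "\<bar>D x0\<bar> = 2"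
  proof -
    have "\<bar>D x0\<bar> = 2 * \<bar>cos \<phi>0\<bar>" by (simp add: x0_def D_phase[OF j] abs_mult)
    then have "\<bar>D x0\<bar> \<le> 2" using abs_cos_le_one[of \<phi>0] by simp
    moreover have "\<not> \<bar>D x0\<bar> < 2" using D'_nonzero_inside[of x0] z by (auto simp: x0_def)
    ultimately show ?thesis by simp
  qed
  then have \<sigma>: "\<sigma> = 1 \<or> \<sigma> = - 1" by (auto simp: \<sigma>_def)
  have sin0: "sin \<phi>0 = 0" using \<sigma> sin_squared_eq[of \<phi>0] by (auto simp: \<sigma>cos)
  have "\<phi>0 = 0 \<or> \<phi>0 = - pi"
    using \<phi>0 sin0 sin_gt_zero[of "- \<phi>0"] by (cases "\<phi>0 = 0 \<or> \<phi>0 = - pi") auto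
  \<comment> \<open>\<open>\<phi>0\<close> is an end of \<open>{-pi..0}\<close>, so the half-angle
    sine has one sign there.\<close>
  then obtain \<epsilon>' :: real where \<epsilon>': "\<bar>\<epsilon>'\<bar> = 1" "\<And>\<phi>. \<phi> \<in> {-pi..0} \<Longrightarrow> 0 \<le> \<epsilon>' * sin ((\<phi> - \<phi>0) / 2)"
  proof
    assume "\<phi>0 = 0"
    then have "0 \<le> - 1 * sin ((\<phi> - \<phi>0) / 2)" if "\<phi> \<in> {-pi..0}" for \<phi>
      using sin_ge_zero[of "- \<phi> / 2"] that by simp
    then show ?thesis using that[of "- 1"] by simp
  next
    assume "\<phi>0 = - pi"
    then have "0 \<le> 1 * sin ((\<phi> - \<phi>0) / 2)" if "\<phi> \<in> {-pi..0}" for \<phi>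
      using sin_ge_zero[of "(\<phi> - \<phi>0) / 2"] that by simp
    then show ?thesis using that[of 1] by simp
  qed
  have "x0 = lower j \<or> x0 = upper j"
    using D2 band_facts(5)[OF j, of x0] phase_in[OF j, of \<phi>0] by (force simp: x0_def)
  \<comment> \<open>\<open>x0\<close> is an edge of band \<open>j\<close>, which therefore lies on
    one side of it. This sign distinguishes the two bands that meet at a closed gap.\<close>
  then obtain \<epsilon> :: real where \<epsilon>: "\<bar>\<epsilon>\<bar> = 1" "\<And>\<phi>. 0 \<le> \<epsilon> * (phase j \<phi> - x0)"
  proof
    assume "x0 = lower j"
    then show ?thesis using that[of 1] phase_in[OF j] by simp
  next
    assume "x0 = upper j"
    then show ?thesis using that[of "- 1"] phase_in[OF j] by simp
  qed
  \<comment> \<open>\<open>\<xi>\<close> is a double root of \<open>D - 2 * \<sigma>\<close>, and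
    the cofactor \<open>h\<close> has the value \<open>D'' / 2\<close> there.\<close>
  obtain h :: "complex poly" where h: "D_poly - [:2 * of_real \<sigma>:] = [:- \<xi>, 1:] * ([:- \<xi>, 1:] * h)"
    and h\<xi>: "poly h \<xi> = D'' \<xi> / 2"
  proof -
    have "poly (D_poly - [:2 * of_real \<sigma>:]) \<xi> = 0" by (simp add: \<xi>_def D_of_real \<sigma>_def)
    then obtain p1 where p1: "D_poly - [:2 * of_real \<sigma>:] = [:- \<xi>, 1:] * p1"
      by (metis dvdE poly_eq_0_iff_dvd)
    have Dp: "pderiv D_poly = p1 + [:- \<xi>, 1:] * pderiv p1"
      using arg_cong[OF p1, of pderiv] by (simp only: pderiv_mult pderiv_diff) (simp add: pderiv_pCons)
    have "D' \<xi> = 0" using z by (simp add: \<xi>_def x0_def D'_of_real)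
    then have "poly p1 \<xi> = 0" unfolding Dp by simp
    then obtain h where h: "p1 = [:- \<xi>, 1:] * h" by (metis dvdE poly_eq_0_iff_dvd)
    have p1': "pderiv p1 = h + [:- \<xi>, 1:] * pderiv h"
      unfolding h by (simp only: pderiv_mult) (simp add: pderiv_pCons)
    have "pderiv (pderiv D_poly) = pderiv p1 + (pderiv p1 + [:- \<xi>, 1:] * pderiv (pderiv p1))"
      unfolding Dp by (simp only: pderiv_add pderiv_mult) (simp add: pderiv_pCons)
    then have "D'' \<xi> = 2 * poly h \<xi>" by (simp add: p1')
    then show ?thesis using that[of h] p1 h by simp
  qed
  \<comment> \<open>Now \<open>2 - \<sigma> * D = (z - \<xi>)\<^sup>2 * w\<close>, and
    \<open>D''_sign\<close> makes the real part of \<open>w\<close> positive at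
    \<open>\<xi>\<close>, so the principal square root is holomorphic nearby.\<close>
  define w where "w z = - of_real \<sigma> * poly h z" for z
  define \<psi> where "\<psi> z = (z - \<xi>) * csqrt (w z)" for z
  have "\<sigma> * D'' x0 < 0" using D''_sign[OF D2] z by (simp add: \<sigma>_def x0_def)
  moreover have w\<xi>: "w \<xi> = of_real (- \<sigma> * D'' x0 / 2)"
    using h\<xi> D''_of_real[of x0] by (simp add: w_def \<xi>_def)
  ultimately have Rew: "0 < Re (w \<xi>)" by simp
  define B where "B = {z. 0 < Re (w z)}"
  have B: "open B" "\<xi> \<in> B"
  proof -
    have "continuous_on UNIV (\<lambda>z. Re (w z))" unfolding w_def by (intro continuous_intros)
    then have "open ((\<lambda>z. Re (w z)) -` {0<..})" by (intro open_vimage) auto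
    then show "open B" by (simp add: B_def vimage_def)
  qed (use Rew in \<open>simp add: B_def\<close>)
  have hol\<psi>: "\<psi> holomorphic_on B"
    unfolding \<psi>_def[abs_def] w_def
    by (intro holomorphic_intros) (auto simp: B_def w_def complex_nonpos_Reals_iff)
  have sq: "(\<psi> z)\<^sup>2 = 2 - of_real \<sigma> * D z" for z
  proof -
    have "D z - 2 * of_real \<sigma> = (z - \<xi>)\<^sup>2 * poly h z"
      using arg_cong[OF h, of "\<lambda>p. poly p z"] by (simp add: power2_eq_square algebra_simps)
    then have "(\<psi> z)\<^sup>2 = - of_real \<sigma> * (D z - 2 * of_real \<sigma>)"
      by (simp add: \<psi>_def w_def power_mult_distrib)
    then show ?thesis using \<sigma> by auto
  qed
  have \<psi>\<xi>: "\<psi> \<xi> = 0" by (simp add: \<psi>_def)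
  have "(\<psi> has_field_derivative csqrt (w \<xi>)) (at \<xi>)"
  proof -
    have "(\<lambda>z. csqrt (w z)) holomorphic_on B"
      unfolding w_def by (intro holomorphic_intros) (auto simp: B_def w_def complex_nonpos_Reals_iff)
    then obtain d where "((\<lambda>z. csqrt (w z)) has_field_derivative d) (at \<xi>)"
      using B by (meson holomorphic_on_open)
    from DERIV_mult[OF DERIV_diff[OF DERIV_ident DERIV_const[of \<xi>]] this]
    show ?thesis by (simp add: \<psi>_def[abs_def])
  qed
  then have "deriv \<psi> \<xi> \<noteq> 0" using Rew by (auto simp: DERIV_imp_deriv)
  then obtain \<rho> g where \<rho>: "0 < \<rho>" "ball \<xi> \<rho> \<subseteq> B" "open (\<psi> ` ball \<xi> \<rho>)" "g holomorphic_on \<psi> ` ball \<xi> \<rho>"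
    and g: "\<And>z. z \<in> ball \<xi> \<rho> \<Longrightarrow> g (\<psi> z) = z"
    using local_inverse[OF hol\<psi> B] by metis
  \<comment> \<open>A square root of \<open>2 - 2 * cos (z - \<phi>0)\<close>; the sign
    \<open>\<epsilon> * \<epsilon>'\<close> matches it with \<open>\<psi>\<close> along band
    \<open>j\<close>.\<close>
  define s where "s z = of_real (\<epsilon> * \<epsilon>') * (2 * sin ((z - of_real \<phi>0) / 2))" for z :: complex
  define T where "T = s -` (\<psi> ` ball \<xi> \<rho>)"
  have "open T"
    unfolding T_def s_def by (rule open_vimage[OF \<rho>(3)]) (intro continuous_intros, simp)
  moreover have "of_real \<phi>0 \<in> T"
    unfolding T_def using \<rho>(1) \<psi>\<xi> by (auto simp: s_def image_iff intro!: bexI[of _ \<xi>])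
  ultimately obtain r1 where r1: "0 < r1" "ball (of_real \<phi>0) r1 \<subseteq> T"
    by (meson open_contains_ball)
  obtain r2 where r2: "0 < r2" "\<And>\<phi>. \<bar>\<phi> - \<phi>0\<bar> < r2 \<Longrightarrow> \<bar>phase j \<phi> - phase j \<phi>0\<bar> < \<rho>"
    using phase_near[OF j \<rho>(1)] by metis
  define K where "K z = g (s z)" for z
  have T: "s z \<in> \<psi> ` ball \<xi> \<rho>" if "z \<in> ball (of_real \<phi>0) (min r1 r2)" for z
    using r1(2) that by (auto simp: T_def)
  have s2: "2 - (s z)\<^sup>2 = 2 * cos (z - of_real \<phi>0)" for z
  proof -
    have "of_real (\<epsilon> * \<epsilon>') ^ 2 = (1 :: complex)"
      using \<epsilon>(1) \<epsilon>'(1) by (auto simp: abs_if power_mult_distrib split: if_splits)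
    moreover have "cos (z - of_real \<phi>0) = 1 - 2 * (sin ((z - of_real \<phi>0) / 2))\<^sup>2"
    proof -
      have "2 * ((z - of_real \<phi>0) / 2) = z - of_real \<phi>0" by simp
      then show ?thesis using cos_double_sin[of "(z - of_real \<phi>0) / 2"] by (simp only:)
    qed
    ultimately show ?thesis by (simp only: s_def power_mult_distrib) simp
  qed
  \<comment> \<open>\<open>\<phi>0\<close> is 0 or -pi, so the shift changes the cosine by the sign
    \<open>\<sigma>\<close> at most.\<close>
  have cos_shift: "of_real \<sigma> * cos (z - of_real \<phi>0) = cos z" for z :: complex
  proof -
    have "cos (complex_of_real \<phi>0) = of_real \<sigma>" "sin (complex_of_real \<phi>0) = 0"
      by (simp_all add: \<sigma>cos sin0 cos_of_real sin_of_real)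
    then show ?thesis using \<sigma> by (auto simp: cos_diff)
  qed
  show ?thesis
  proof (intro exI[of _ "min r1 r2"] exI[of _ K] conjI ballI allI impI)
    show "K holomorphic_on ball (of_real \<phi>0) (min r1 r2)"
      unfolding K_def[abs_def]
      by (rule holomorphic_on_compose_gen[OF _ \<rho>(4), unfolded o_def])
        (use T in \<open>auto simp: s_def intro!: holomorphic_intros\<close>)
    show "D (K z) = 2 * cos z" if "z \<in> ball (of_real \<phi>0) (min r1 r2)" for z
    proof -
      have "\<psi> (K z) = s z" using T[OF that] g unfolding K_def by auto
      then have "(s z)\<^sup>2 = 2 - of_real \<sigma> * D (K z)" using sq[of "K z"] by simp
      then have "of_real \<sigma> * D (K z) = 2 * cos (z - of_real \<phi>0)" using s2[of z] by simp
      then have "of_real \<sigma> * (of_real \<sigma> * D (K z)) = 2 * cos z"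
        using cos_shift[of z] by simp
      then show ?thesis using \<sigma> by auto
    qed
    show "K (of_real \<phi>) = of_real (phase j \<phi>)" if \<phi>: "\<phi> \<in> {-pi..0}" "\<bar>\<phi> - \<phi>0\<bar> < min r1 r2" for \<phi>
    proof -
      define x where "x = complex_of_real (phase j \<phi>)"
      have x: "x \<in> ball \<xi> \<rho>"
        using r2(2)[of \<phi>] \<phi> by (simp add: x_def \<xi>_def x0_def dist_norm abs_minus_commute flip: of_real_diff)
      have "\<psi> x = of_real (\<epsilon> * \<epsilon>' * (2 * sin ((\<phi> - \<phi>0) / 2)))"
      proof (rule sq_eq_imp_sign)
        have "D x = 2 * cos (complex_of_real \<phi>)"
          by (simp add: x_def D_of_real D_phase[OF j] cos_of_real)
        then have "(\<psi> x)\<^sup>2 = 2 - 2 * (of_real \<sigma> * cos (complex_of_real \<phi>))" by (simp add: sq)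
        also have "of_real \<sigma> * cos (complex_of_real \<phi>) = cos (complex_of_real \<phi> - of_real \<phi>0)"
          unfolding cos_shift[of "of_real \<phi>", symmetric] using \<sigma> by auto
        also have "2 - 2 * cos (complex_of_real \<phi> - of_real \<phi>0) = of_real (2 - 2 * cos (\<phi> - \<phi>0))"
          by (simp flip: cos_of_real)
        also have "2 - 2 * cos (\<phi> - \<phi>0) = (2 * sin ((\<phi> - \<phi>0) / 2))\<^sup>2"
        proof -
          have "2 * ((\<phi> - \<phi>0) / 2) = \<phi> - \<phi>0" by simp
          then have "cos (\<phi> - \<phi>0) = 1 - 2 * (sin ((\<phi> - \<phi>0) / 2))\<^sup>2"
            using cos_double_sin[of "(\<phi> - \<phi>0) / 2"] by (simp only:)
          then show ?thesis by (simp add: power_mult_distrib)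
        qed
        finally show "(\<psi> x)\<^sup>2 = of_real ((2 * sin ((\<phi> - \<phi>0) / 2))\<^sup>2)" .
        have "\<psi> x = of_real (phase j \<phi> - x0) * csqrt (w x)" by (simp add: \<psi>_def x_def \<xi>_def)
        then have "\<epsilon> * Re (\<psi> x) = (\<epsilon> * (phase j \<phi> - x0)) * Re (csqrt (w x))"
          by (simp del: csqrt.sel)
        also have "0 \<le> \<dots>" by (intro mult_nonneg_nonneg \<epsilon>(2) Re_csqrt)
        finally show "0 \<le> \<epsilon> * Re (\<psi> x)" .
        show "0 \<le> \<epsilon>' * (2 * sin ((\<phi> - \<phi>0) / 2))" using \<epsilon>'(2)[OF \<phi>(1)] by simp
      qed (use \<epsilon> \<epsilon>' in auto)
      then have "\<psi> x = s (of_real \<phi>)"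
        by (simp add: s_def flip: sin_of_real)
      then show ?thesis using g[OF x] by (simp add: K_def x_def)
    qed
  qed (use r1 r2 in auto)
qed

lemma local_extension:
  assumes j: "j < q" and \<phi>0: "\<phi>0 \<in> {-pi..0}"
  obtains r K where "0 < r" "K holomorphic_on ball (of_real \<phi>0) r"
    "\<And>z. z \<in> ball (of_real \<phi>0) r \<Longrightarrow> D (K z) = 2 * cos z"
    "\<And>\<phi>. \<phi> \<in> {-pi..0} \<Longrightarrow> \<bar>\<phi> - \<phi>0\<bar> < r \<Longrightarrow> K (of_real \<phi>) = of_real (phase j \<phi>)"
  using local_extension_regular[OF j, of \<phi>0] local_extension_closed_gap[OF j \<phi>0] by metis

definition phase_deriv :: "nat \<Rightarrow> nat \<Rightarrow> real \<Rightarrow> real" where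
  "phase_deriv j i = (deriv_within {-pi..0} ^^ i) (phase j)"

lemma phase_deriv_0 [simp]: "phase_deriv j 0 = phase j" and phase_deriv_Suc: "phase_deriv j (Suc i) = deriv_within {-pi..0} (phase_deriv j i)"
  by (simp_all add: phase_deriv_def)

text \<open>By induction on the order, the iterated one-sided derivatives are restrictions of the
  complex ones; the values are real because the function differentiated is. In particular the phases
  are smooth up to the ends of the interval.\<close>

lemma deriv_extension_real:
  assumes r: "0 < r" and hol: "K holomorphic_on ball (of_real \<phi>0) r"
    and K: "\<And>\<phi>. \<phi> \<in> {-pi..0} \<Longrightarrow> \<bar>\<phi> - \<phi>0\<bar> < r \<Longrightarrow> K (of_real \<phi>) = of_real (phase j \<phi>)"
  shows "\<phi> \<in> {-pi..0} \<Longrightarrow> \<bar>\<phi> - \<phi>0\<bar> < r \<Longrightarrow> (deriv ^^ i) K (of_real \<phi>) = of_real (phase_deriv j i \<phi>)"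
    "\<phi> \<in> {-pi..0} \<Longrightarrow> \<bar>\<phi> - \<phi>0\<bar> < r \<Longrightarrow>
      (phase_deriv j i has_real_derivative phase_deriv j (Suc i) \<phi>) (at \<phi> within {-pi..0})"
proof -
  have step: "(deriv ^^ Suc i) K (of_real \<phi>) = of_real (phase_deriv j (Suc i) \<phi>) \<and>
      (phase_deriv j i has_real_derivative phase_deriv j (Suc i) \<phi>) (at \<phi> within {-pi..0})"
    if IH: "\<And>\<phi>. \<phi> \<in> {-pi..0} \<Longrightarrow> \<bar>\<phi> - \<phi>0\<bar> < r \<Longrightarrow> (deriv ^^ i) K (of_real \<phi>) = of_real (phase_deriv j i \<phi>)"
      and \<phi>: "\<phi> \<in> {-pi..0}" "\<bar>\<phi> - \<phi>0\<bar> < r" for i \<phi>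
  proof -
    define d where "d = (deriv ^^ Suc i) K (of_real \<phi>)"
    have ball: "complex_of_real x \<in> ball (of_real \<phi>0) r" if "\<bar>x - \<phi>0\<bar> < r" for x
      using that by (simp add: dist_norm abs_minus_commute flip: of_real_diff)
    have "((deriv ^^ i) K has_field_derivative d) (at (of_real \<phi>))"
      using has_field_derivative_higher_deriv[OF hol open_ball ball[OF \<phi>(2)]] by (simp add: d_def)
    then have vd: "((\<lambda>x. (deriv ^^ i) K (of_real x)) has_vector_derivative d) (at \<phi> within {-pi..0})"
      by (rule has_vector_derivative_real_field)
    have vd': "((\<lambda>x. complex_of_real (phase_deriv j i x)) has_vector_derivative d) (at \<phi> within {-pi..0})"
    proof (rule has_vector_derivative_transform_within[OF vd])
      show "0 < r - \<bar>\<phi> - \<phi>0\<bar>" using \<phi> by simp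
      show "(deriv ^^ i) K (of_real x) = of_real (phase_deriv j i x)"
        if "x \<in> {-pi..0}" "dist x \<phi> < r - \<bar>\<phi> - \<phi>0\<bar>" for x
        using IH[of x] that by (simp add: dist_real_def)
    qed (rule \<phi>(1))
    from bounded_linear.has_vector_derivative[OF bounded_linear_Re this]
    have re: "(phase_deriv j i has_vector_derivative Re d) (at \<phi> within {-pi..0})" by simp
    have re': "(phase_deriv j i has_real_derivative Re d) (at \<phi> within {-pi..0})"
      using re by (simp add: has_real_derivative_iff_has_vector_derivative)
    have phase_deriv: "phase_deriv j (Suc i) \<phi> = Re d"
      unfolding phase_deriv_Suc deriv_within_def
      by (rule vector_derivative_within_closed_interval[OF _ \<phi>(1) re]) simp
    have "d = of_real (Re d)"
      by (rule vector_derivative_unique_within_closed_interval[of "- pi" 0 \<phi>])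
        (use \<phi> vd' has_vector_derivative_of_real[OF re'] in auto)
    then show ?thesis
      using re' by (simp add: phase_deriv d_def)
  qed
  have all: "(deriv ^^ i) K (of_real \<phi>) = of_real (phase_deriv j i \<phi>)"
    if "\<phi> \<in> {-pi..0}" "\<bar>\<phi> - \<phi>0\<bar> < r" for i \<phi>
    using that
  proof (induction i arbitrary: \<phi>)
    case 0
    then show ?case using K by simp
  next
    case (Suc i)
    then show ?case using step[of i \<phi>] by blast
  qed
  show "\<phi> \<in> {-pi..0} \<Longrightarrow> \<bar>\<phi> - \<phi>0\<bar> < r \<Longrightarrow> (deriv ^^ i) K (of_real \<phi>) = of_real (phase_deriv j i \<phi>)"
    by (rule all)
  show "\<phi> \<in> {-pi..0} \<Longrightarrow> \<bar>\<phi> - \<phi>0\<bar> < r \<Longrightarrow>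
      (phase_deriv j i has_real_derivative phase_deriv j (Suc i) \<phi>) (at \<phi> within {-pi..0})"
    using step[of i \<phi>] all by blast
qed

lemma phase_deriv_DERIV:
  assumes "j < q" "\<phi> \<in> {-pi..0}"
  shows "(phase_deriv j i has_real_derivative phase_deriv j (Suc i) \<phi>) (at \<phi> within {-pi..0})"
proof -
  obtain r K where rK: "0 < r" "K holomorphic_on ball (of_real \<phi>) r"
    "\<And>\<phi>'. \<phi>' \<in> {-pi..0} \<Longrightarrow> \<bar>\<phi>' - \<phi>\<bar> < r \<Longrightarrow> K (of_real \<phi>') = of_real (phase j \<phi>')"
    using local_extension[OF assms] by metis
  show ?thesis by (rule deriv_extension_real(2)[OF rK]) (use assms rK(1) in auto)
qed

end

section \<open>Dispersive estimates\<close>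

text \<open>The bound is known only along a set accumulating at \<xi>, in the application on the
  real axis, so boundedness in a full neighbourhood has to be derived. Comparing orders of vanishing
  does this: a numerator of lower order would violate the bound near \<xi>.\<close>

lemma bounded_ratio_extends:
  fixes f g :: "complex \<Rightarrow> complex"
  assumes f: "f holomorphic_on ball \<xi> r" and g: "g holomorphic_on ball \<xi> r"
    and lim: "\<xi> islimpt {z \<in> ball \<xi> r. g z \<noteq> 0 \<and> cmod (f z) \<le> cmod (g z)}"
  obtains \<rho> B where "0 < \<rho>" "B holomorphic_on ball \<xi> \<rho>"
    "\<And>z. z \<in> ball \<xi> \<rho> \<Longrightarrow> z \<noteq> \<xi> \<Longrightarrow> B z = f z / g z"
proof -
  define X where "X = {z \<in> ball \<xi> r. g z \<noteq> 0 \<and> cmod (f z) \<le> cmod (g z)}"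
  have "X \<noteq> {}" using lim islimpt_EMPTY unfolding X_def[symmetric] by metis
  then obtain z0 where z0: "z0 \<in> ball \<xi> r" "g z0 \<noteq> 0" by (auto simp: X_def)
  then have r: "0 < r" by (metis ball_eq_empty empty_iff not_less)
  then have \<xi>: "\<xi> \<in> ball \<xi> r" by simp
  define n gg where "n = nat (zorder g \<xi>)" and "gg = zor_poly g \<xi>"
  obtain r1 where r1: "0 < r1" "gg holomorphic_on cball \<xi> r1"
    and gg: "\<And>w. w \<in> cball \<xi> r1 \<Longrightarrow> g w = gg w * (w - \<xi>) ^ n \<and> gg w \<noteq> 0"
    using zorder_exist_zero[OF g open_ball connected_ball \<xi>] z0 unfolding n_def gg_def by blast
  show ?thesis
  proof (cases "\<forall>w\<in>ball \<xi> r. f w = 0")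
    case True
    show ?thesis by (rule that[of r "\<lambda>_. 0"]) (use r True in auto)
  next
    case False
    define m ff where "m = nat (zorder f \<xi>)" and "ff = zor_poly f \<xi>"
    obtain r2 where r2: "0 < r2" "ff holomorphic_on cball \<xi> r2"
      and ff: "\<And>w. w \<in> cball \<xi> r2 \<Longrightarrow> f w = ff w * (w - \<xi>) ^ m \<and> ff w \<noteq> 0"
      using zorder_exist_zero[OF f open_ball connected_ball \<xi>] False unfolding m_def ff_def by blast
    define \<rho> where "\<rho> = min r1 r2"
    have \<rho>: "0 < \<rho>" "ball \<xi> \<rho> \<subseteq> cball \<xi> r1" "ball \<xi> \<rho> \<subseteq> cball \<xi> r2"
      using r1 r2 by (auto simp: \<rho>_def)
    have "n \<le> m"
    proof (rule ccontr)
      assume nm: "\<not> n \<le> m"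
      have cont: "isCont ff \<xi>" "isCont gg \<xi>"
        using r1 r2 \<rho> holomorphic_on_subset[OF _ \<rho>(2)] holomorphic_on_subset[OF _ \<rho>(3)]
        by (auto intro!: continuous_on_interior[of "ball \<xi> \<rho>"] holomorphic_on_imp_continuous_on)
      \<comment> \<open>Dividing the bound by the common power and letting \<open>z\<close> tend to
        \<open>\<xi>\<close> within \<open>X\<close> forces the leading coefficient
        \<open>ff \<xi>\<close> to vanish.\<close>
      have "cmod (ff \<xi>) \<le> cmod (gg \<xi>) * cmod (\<xi> - \<xi>) ^ (n - m)"
      proof (rule tendsto_le)
        show "at \<xi> within X \<noteq> bot"
          using lim unfolding X_def[symmetric] by (simp add: trivial_limit_within)
        show "((\<lambda>z. cmod (ff z)) \<longlongrightarrow> cmod (ff \<xi>)) (at \<xi> within X)"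
          "((\<lambda>z. cmod (gg z) * cmod (z - \<xi>) ^ (n - m)) \<longlongrightarrow> cmod (gg \<xi>) * cmod (\<xi> - \<xi>) ^ (n - m)) (at \<xi> within X)"
        proof -
          have t: "(ff \<longlongrightarrow> ff \<xi>) (at \<xi> within X)" "(gg \<longlongrightarrow> gg \<xi>) (at \<xi> within X)"
            using cont[THEN continuous_at_imp_continuous_at_within, of X] by (simp_all add: continuous_within)
          show "((\<lambda>z. cmod (ff z)) \<longlongrightarrow> cmod (ff \<xi>)) (at \<xi> within X)"
            "((\<lambda>z. cmod (gg z) * cmod (z - \<xi>) ^ (n - m)) \<longlongrightarrow> cmod (gg \<xi>) * cmod (\<xi> - \<xi>) ^ (n - m)) (at \<xi> within X)"
            by (intro tendsto_intros t)+
        qed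
        have "\<forall>\<^sub>F z in at \<xi> within X. z \<in> ball \<xi> \<rho> \<and> z \<noteq> \<xi> \<and> z \<in> X"
          using \<rho>(1) eventually_at_ball[OF \<rho>(1), of \<xi> X] eventually_neq_at_within[of \<xi> \<xi> X]
            eventually_at_topological by (auto simp: eventually_at_filter elim: eventually_elim2)
        then show "\<forall>\<^sub>F z in at \<xi> within X. cmod (ff z) \<le> cmod (gg z) * cmod (z - \<xi>) ^ (n - m)"
        proof (rule eventually_mono)
          fix z assume z: "z \<in> ball \<xi> \<rho> \<and> z \<noteq> \<xi> \<and> z \<in> X"
          have "cmod (f z) \<le> cmod (g z)" using z by (simp add: X_def)
          then have "cmod (ff z) * cmod (z - \<xi>) ^ m \<le> cmod (gg z) * cmod (z - \<xi>) ^ n"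
          proof -
            have "f z = ff z * (z - \<xi>) ^ m" "g z = gg z * (z - \<xi>) ^ n"
              using ff[of z] gg[of z] z \<rho>(2,3) by blast+
            then show ?thesis using \<open>cmod (f z) \<le> cmod (g z)\<close> by (simp add: norm_mult norm_power)
          qed
          also have "cmod (z - \<xi>) ^ n = cmod (z - \<xi>) ^ (n - m) * cmod (z - \<xi>) ^ m"
            using nm by (simp flip: power_add)
          finally show "cmod (ff z) \<le> cmod (gg z) * cmod (z - \<xi>) ^ (n - m)"
            using z by (simp flip: mult.assoc)
        qed
      qed
      then have "ff \<xi> = 0" using nm by (simp add: power_0_left)
      then show False using ff[of \<xi>] r2 by simp
    qed
    define B where "B z = (z - \<xi>) ^ (m - n) * ff z / gg z" for z
    show ?thesis
    proof (rule that[of \<rho> B])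
      show "B holomorphic_on ball \<xi> \<rho>"
        unfolding B_def
        by (intro holomorphic_intros holomorphic_on_subset[OF r2(2)] holomorphic_on_subset[OF r1(2)] \<rho>)
          (use gg \<rho> in auto)
      fix z assume z: "z \<in> ball \<xi> \<rho>" "z \<noteq> \<xi>"
      have "(z - \<xi>) ^ m = (z - \<xi>) ^ (m - n) * (z - \<xi>) ^ n" using \<open>n \<le> m\<close> by (simp flip: power_add)
      moreover have "f z = ff z * (z - \<xi>) ^ m" "g z = gg z * (z - \<xi>) ^ n" "gg z \<noteq> 0"
        using ff[of z] gg[of z] z \<rho> by auto
      ultimately show "B z = f z / g z" using z by (simp add: B_def field_simps)
    qed (rule \<rho>)
  qed
qed

section \<open>Waves and amplitudes\<close>

context periodic_coeffs
begin

text \<open>For real arguments \<open>e = 1\<close> and \<open>e = -1\<close> give complex conjugate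
  values; the sign replaces conjugation, which would not be holomorphic in \<open>z\<close>.\<close>

definition wave :: "nat \<Rightarrow> real \<Rightarrow> complex \<Rightarrow> complex \<Rightarrow> complex" where
  "wave r e z x = P (q + r) x - exp (- \<i> * of_real e * z) * P r x"

definition amp :: "nat \<Rightarrow> nat \<Rightarrow> real \<Rightarrow> nat \<Rightarrow> real \<Rightarrow> real \<Rightarrow> complex" where
  "amp j r e r' e' \<phi> = wave r e (of_real \<phi>) (of_real (phase j \<phi>))
     * wave r' e' (of_real \<phi>) (of_real (phase j \<phi>)) / of_real (W (phase j \<phi>))"

lemma P_of_real: "P n (of_real x :: complex) = of_real (P n x)"
  using eval_of_real[where 'x = complex, of n x] by simp

text \<open>The squared modulus is one of the nonnegative summands of \<open>W\<close>.\<close>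

lemma cmod_wave:
  assumes x: "D x = 2 * cos \<phi>" and e: "\<bar>e\<bar> = 1" and r: "r < q"
  shows "(cmod (wave r e (of_real \<phi>) (of_real x)))\<^sup>2 \<le> W x"
proof -
  define s p where "s = P (q + r) x" and "p = P r x"
  have "wave r e (of_real \<phi>) (of_real x) = of_real s - exp (\<i> * of_real (- e * \<phi>)) * of_real p"
    by (simp add: wave_def P_of_real s_def p_def mult.assoc)
  also have "\<dots> = Complex (s - cos (e * \<phi>) * p) (sin (e * \<phi>) * p)"
    by (simp add: complex_eq_iff Re_exp Im_exp)
  finally have "(cmod (wave r e (of_real \<phi>) (of_real x)))\<^sup>2
      = (s - cos (e * \<phi>) * p)\<^sup>2 + (sin (e * \<phi>) * p)\<^sup>2"
    by (simp add: cmod_power2)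
  also have "\<dots> = s\<^sup>2 - 2 * cos (e * \<phi>) * s * p + ((cos (e * \<phi>))\<^sup>2 + (sin (e * \<phi>))\<^sup>2) * p\<^sup>2"
    by algebra
  also have "cos (e * \<phi>) = cos \<phi>" using e by (auto simp: abs_if split: if_splits)
  also have "sin (e * \<phi>) ^ 2 = sin \<phi> ^ 2" using e by (auto simp: abs_if split: if_splits)
  finally have eq: "(cmod (wave r e (of_real \<phi>) (of_real x)))\<^sup>2 = s\<^sup>2 - D x * s * p + p\<^sup>2"
    by (simp add: x)
  have D2: "\<bar>D x\<bar> \<le> 2" using abs_cos_le_one[of \<phi>] unfolding x abs_mult by simp
  have "(P (q + r) x)\<^sup>2 - D x * P (q + r) x * P r x + (P r x)\<^sup>2 \<le> W x"
    unfolding W_eq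
    by (rule member_le_sum[where A = "{..<q}"
          and f = "\<lambda>r. (P (q + r) x)\<^sup>2 - D x * P (q + r) x * P r x + (P r x)\<^sup>2"])
      (use r W_term_nonneg[OF D2] in auto)
  then show ?thesis by (simp add: eq s_def p_def)
qed

lemma cmod_wave_mult:
  assumes x: "D x = 2 * cos \<phi>" and e: "\<bar>e\<bar> = 1" "\<bar>e'\<bar> = 1" and r: "r < q" "r' < q"
  shows "cmod (wave r e (of_real \<phi>) (of_real x) * wave r' e' (of_real \<phi>) (of_real x)) \<le> W x"
proof -
  have W: "0 \<le> W x" using cmod_wave[OF x e(1) r(1)] zero_le_power2 order_trans by blast
  have "cmod (wave r e (of_real \<phi>) (of_real x)) \<le> sqrt (W x)"
    "cmod (wave r' e' (of_real \<phi>) (of_real x)) \<le> sqrt (W x)"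
    using cmod_wave[OF x] e r by (auto intro: real_le_rsqrt)
  then have "cmod (wave r e (of_real \<phi>) (of_real x) * wave r' e' (of_real \<phi>) (of_real x))
      \<le> sqrt (W x) * sqrt (W x)"
    unfolding norm_mult by (intro mult_mono) (use W in auto)
  then show ?thesis using W by simp
qed

lemma sin_nonzero: "\<phi> \<in> {-pi<..<0} \<Longrightarrow> sin \<phi> \<noteq> 0"
  using sin_gt_zero[of "- \<phi>"] by auto

lemma W_phase_pos: "j < q \<Longrightarrow> \<phi> \<in> {-pi<..<0} \<Longrightarrow> 0 < W (phase j \<phi>)"
  using W_pos_inside phase_inside(3) sin_nonzero by blast

text \<open>Euler's formula for both factors \<open>sin \<phi> * P\<close>; the constant is the
  square of \<open>1 / (2 * \<i>)\<close>. The numbers of periods \<open>l\<close> and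
  \<open>l'\<close> appear in the exponents alone.\<close>

lemma density_eq_amp:
  assumes j: "j < q" and \<phi>: "\<phi> \<in> {-pi<..<0}"
  shows "of_real (spectral_density j (l * q + r) (l' * q + r') \<phi>)
    = - (1 / 4) * (\<Sum>e\<in>{1, -1}. \<Sum>e'\<in>{1, -1}. of_real (e * e')
        * (exp (\<i> * of_real ((e * l + e' * l') * \<phi>)) * amp j r e r' e' \<phi>))"
proof -
  define x where "x = phase j \<phi>"
  define w where "w r e = wave r e (of_real \<phi>) (of_real x)" for r e
  define E where "E l e = exp (\<i> * complex_of_real (e * real l * \<phi>))" for l e
  have s: "2 * \<i> * of_real (sin \<phi> * P (l * q + r) x) = E l 1 * w r 1 - E l (-1) * w r (-1)" for l r
  proof -
    have sin: "2 * \<i> * complex_of_real (sin \<theta>) = exp (\<i> * of_real \<theta>) - exp (- (\<i> * of_real \<theta>))" for \<theta>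
      by (simp add: sin_of_real[symmetric] sin_exp_eq del: sin_of_real)
    have "2 * \<i> * of_real (sin \<phi> * P (l * q + r) x)
        = 2 * \<i> * of_real (sin (real l * \<phi>)) * P (q + r) (of_real x)
          - 2 * \<i> * of_real (sin ((real l - 1) * \<phi>)) * P r (of_real x)"
      unfolding sin_mult_sol(1)[OF D_phase[OF j], of \<phi>, folded x_def]
      by (simp add: P_of_real algebra_simps)
    also have "\<dots> = (E l 1 - E l (-1)) * P (q + r) (of_real x)
          - (E l 1 * exp (- \<i> * of_real 1 * of_real \<phi>) - E l (-1) * exp (- \<i> * of_real (-1) * of_real \<phi>)) * P r (of_real x)"
      unfolding sin E_def exp_add[symmetric] by (simp add: algebra_simps)
    finally show ?thesis by (simp only: w_def wave_def) (simp only: algebra_simps)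
  qed
  have W: "complex_of_real (W x) \<noteq> 0" using W_phase_pos[OF j \<phi>] by (simp add: x_def)
  have Emult: "exp (\<i> * of_real ((e * l + e' * l') * \<phi>)) = E l e * E l' e'" for e e' :: real
    unfolding E_def exp_add[symmetric] by (simp add: algebra_simps)
  have "(2 * \<i> * of_real (sin \<phi> * P (l * q + r) x)) * (2 * \<i> * of_real (sin \<phi> * P (l' * q + r') x)) / of_real (W x)
      = - 4 * of_real (spectral_density j (l * q + r) (l' * q + r') \<phi>)"
    by (simp add: spectral_density_def x_def[symmetric] power2_eq_square algebra_simps)
  then have "of_real (spectral_density j (l * q + r) (l' * q + r') \<phi>)
      = - (1 / 4) * ((E l 1 * w r 1 - E l (-1) * w r (-1)) * (E l' 1 * w r' 1 - E l' (-1) * w r' (-1)) / of_real (W x))"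
    unfolding s by simp
  also have "\<dots> = - (1 / 4) * (\<Sum>e\<in>{1, -1}. \<Sum>e'\<in>{1, -1}. of_real (e * e')
        * (E l e * E l' e' * (w r e * w r' e' / of_real (W x))))"
    using W by (simp add: field_simps)
  finally show ?thesis by (simp only: Emult amp_def w_def x_def)
qed

lemma islimpt_open_phase:
  assumes \<phi>0: "\<phi>0 \<in> {-pi..0}" and d: "0 < d"
  obtains \<phi> where "\<phi> \<in> {-pi<..<0}" "\<phi> \<noteq> \<phi>0" "\<bar>\<phi> - \<phi>0\<bar> < d"
proof (cases "\<phi>0 = - pi")
  case True
  then show ?thesis using d that[of "- pi + min d pi / 2"] pi_gt_zero by (auto simp: min_def)
next
  case False
  define h where "h = min d (\<phi>0 + pi) / 2"
  have "0 < h" "h < d" "h < \<phi>0 + pi" using False \<phi>0 d by (auto simp: h_def)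
  then show ?thesis using that[of "\<phi>0 - h"] \<phi>0 by auto
qed

text \<open>The bound \<open>cmod_wave_mult\<close> at nearby real phases removes the singularity
  that may arise where \<open>W\<close> vanishes. At the ends of the interval \<open>amp\<close> may
  read 0 / 0; excluding them and \<open>\<phi>0\<close> costs single points only.\<close>

lemma amp_extension:
  assumes j: "j < q" and \<phi>0: "\<phi>0 \<in> {-pi..0}" and e: "\<bar>e\<bar> = 1" "\<bar>e'\<bar> = 1" and r: "r < q" "r' < q"
  obtains \<rho> B where "0 < \<rho>" "B holomorphic_on ball (of_real \<phi>0) \<rho>"
    "\<And>\<phi>. \<phi> \<in> {-pi<..<0} \<Longrightarrow> \<phi> \<noteq> \<phi>0 \<Longrightarrow> \<bar>\<phi> - \<phi>0\<bar> < \<rho> \<Longrightarrow> B (of_real \<phi>) = amp j r e r' e' \<phi>"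
proof -
  obtain R K where R: "0 < R" and K: "K holomorphic_on ball (of_real \<phi>0) R"
    "\<And>\<phi>. \<phi> \<in> {-pi..0} \<Longrightarrow> \<bar>\<phi> - \<phi>0\<bar> < R \<Longrightarrow> K (of_real \<phi>) = of_real (phase j \<phi>)"
    using local_extension[OF j \<phi>0] by metis
  define f where "f z = wave r e z (K z) * wave r' e' z (K z)" for z
  define g where "g z = W (K z)" for z
  have fg: "f (of_real \<phi>) = wave r e (of_real \<phi>) (of_real (phase j \<phi>)) * wave r' e' (of_real \<phi>) (of_real (phase j \<phi>))"
    "g (of_real \<phi>) = of_real (W (phase j \<phi>))" if "\<phi> \<in> {-pi<..<0}" "\<bar>\<phi> - \<phi>0\<bar> < R" for \<phi>
    using K(2)[of \<phi>] that by (simp_all add: f_def g_def W_of_real)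
  have ball: "complex_of_real \<phi> \<in> ball (of_real \<phi>0) d \<longleftrightarrow> \<bar>\<phi> - \<phi>0\<bar> < d" for \<phi> d
    by (simp add: dist_norm abs_minus_commute flip: of_real_diff)
  have lim: "of_real \<phi>0 islimpt {z \<in> ball (of_real \<phi>0) R. g z \<noteq> 0 \<and> cmod (f z) \<le> cmod (g z)}"
    unfolding islimpt_approachable
  proof (intro allI impI)
    fix d :: real assume "0 < d"
    then obtain \<phi> where \<phi>: "\<phi> \<in> {-pi<..<0}" "\<phi> \<noteq> \<phi>0" "\<bar>\<phi> - \<phi>0\<bar> < min d R"
      using islimpt_open_phase[OF \<phi>0, of "min d R"] R by auto
    have W: "0 < W (phase j \<phi>)" by (rule W_phase_pos[OF j \<phi>(1)])
    have "cmod (f (of_real \<phi>)) \<le> cmod (g (of_real \<phi>))"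
      using cmod_wave_mult[OF D_phase[OF j] e r, of \<phi>] fg[of \<phi>] \<phi> W by simp
    then show "\<exists>x'\<in>{z \<in> ball (of_real \<phi>0) R. g z \<noteq> 0 \<and> cmod (f z) \<le> cmod (g z)}.
        x' \<noteq> of_real \<phi>0 \<and> dist x' (of_real \<phi>0) < d"
      using \<phi> W fg[of \<phi>] ball[of \<phi> R]
      by (intro bexI[of _ "of_real \<phi>"]) (auto simp: dist_norm simp flip: of_real_diff)
  qed
  have hol: "f holomorphic_on ball (of_real \<phi>0) R" "g holomorphic_on ball (of_real \<phi>0) R"
    unfolding f_def[abs_def] g_def[abs_def] wave_def by (intro holomorphic_intros K(1))+
  obtain \<rho> B where \<rho>: "0 < \<rho>" "B holomorphic_on ball (of_real \<phi>0) \<rho>"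
    "\<And>z. z \<in> ball (of_real \<phi>0) \<rho> \<Longrightarrow> z \<noteq> of_real \<phi>0 \<Longrightarrow> B z = f z / g z"
    using bounded_ratio_extends[OF hol lim] by blast
  show ?thesis
  proof (rule that[of "min \<rho> R" B])
    show "B holomorphic_on ball (of_real \<phi>0) (min \<rho> R)"
      by (rule holomorphic_on_subset[OF \<rho>(2)]) auto
    show "B (of_real \<phi>) = amp j r e r' e' \<phi>"
      if "\<phi> \<in> {-pi<..<0}" "\<phi> \<noteq> \<phi>0" "\<bar>\<phi> - \<phi>0\<bar> < min \<rho> R" for \<phi>
      using \<rho>(3)[of "of_real \<phi>"] fg[of \<phi>] that ball[of \<phi> \<rho>] by (simp add: amp_def)
  qed (use \<rho>(1) R in simp)
qed

text \<open>The interval is so short that the \<open>m\<close>-th derivative keeps its sign and at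
  least half of its modulus at \<open>\<phi>0\<close>. One \<open>C\<close> serves all such
  subintervals around \<open>\<phi>0\<close>, all \<open>L\<close> and all \<open>t\<close>.\<close>

lemma local_oscillatory_bound:
  fixes A :: "real \<Rightarrow> complex"
  assumes j: "j < q" and \<phi>0: "\<phi>0 \<in> {-pi..0}" and m: "2 \<le> m" "phase_deriv j m \<phi>0 \<noteq> 0"
    and \<rho>: "0 < \<rho>" and B: "B holomorphic_on ball (of_real \<phi>0) \<rho>"
    and BA: "\<And>\<phi>. \<phi> \<in> {-pi<..<0} \<Longrightarrow> \<phi> \<noteq> \<phi>0 \<Longrightarrow> \<bar>\<phi> - \<phi>0\<bar> < \<rho> \<Longrightarrow> B (of_real \<phi>) = A \<phi>"
  shows "\<exists>d>0. \<exists>C\<ge>0. \<forall>c c' t L.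
      - pi \<le> c \<and> c \<le> \<phi>0 \<and> \<phi>0 \<le> c' \<and> c' \<le> 0 \<and> c' - c < d \<and> 0 < t \<longrightarrow>
      (\<lambda>\<phi>. exp (\<i> * of_real (L * \<phi> - t * phase j \<phi>)) * A \<phi>) integrable_on {c..c'} \<and>
      cmod (integral {c..c'} (\<lambda>\<phi>. exp (\<i> * of_real (L * \<phi> - t * phase j \<phi>)) * A \<phi>))
        \<le> C * t powr (- 1 / real m)"
proof -
  define \<mu> where "\<mu> = \<bar>phase_deriv j m \<phi>0\<bar> / 2"
  define \<sigma> where "\<sigma> = sgn (phase_deriv j m \<phi>0)"
  have \<mu>: "0 < \<mu>" and \<sigma>: "\<bar>\<sigma>\<bar> = 1" using m by (simp_all add: \<mu>_def \<sigma>_def abs_sgn_eq)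
  have "continuous_on {-pi..0} (phase_deriv j m)"
    by (rule DERIV_continuous_on) (rule phase_deriv_DERIV[OF j])
  then obtain d1 where d1: "0 < d1" "\<And>\<phi>. \<phi> \<in> {-pi..0} \<Longrightarrow> \<bar>\<phi> - \<phi>0\<bar> < d1 \<Longrightarrow> \<bar>phase_deriv j m \<phi> - phase_deriv j m \<phi>0\<bar> < \<mu>"
    using \<phi>0 \<mu> unfolding continuous_on_iff dist_real_def by metis
  have ge: "\<mu> \<le> \<sigma> * phase_deriv j m \<phi>" if "\<phi> \<in> {-pi..0}" "\<bar>\<phi> - \<phi>0\<bar> < d1" for \<phi>
  proof -
    have k: "\<bar>phase_deriv j m \<phi> - phase_deriv j m \<phi>0\<bar> < \<bar>phase_deriv j m \<phi>0\<bar> / 2" using d1(2)[OF that] by (simp add: \<mu>_def)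
    consider "0 < phase_deriv j m \<phi>0" "\<sigma> = 1" | "phase_deriv j m \<phi>0 < 0" "\<sigma> = - 1"
      using m(2) by (cases "0 < phase_deriv j m \<phi>0") (auto simp: \<sigma>_def)
    then show ?thesis
    proof cases
      case 1
      then have "\<sigma> * phase_deriv j m \<phi> = phase_deriv j m \<phi>" by simp
      then show ?thesis using k 1 unfolding \<mu>_def by linarith
    next
      case 2
      then have "\<sigma> * phase_deriv j m \<phi> = - phase_deriv j m \<phi>" by simp
      then show ?thesis using k 2 unfolding \<mu>_def by linarith
    qed
  qed
  have cb: "cball (complex_of_real \<phi>0) (\<rho> / 2) \<subseteq> ball (of_real \<phi>0) \<rho>" using \<rho> by auto
  have cp: "compact (B ` cball (of_real \<phi>0) (\<rho> / 2))" "compact (deriv B ` cball (of_real \<phi>0) (\<rho> / 2))"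
    by (intro compact_continuous_image holomorphic_on_imp_continuous_on holomorphic_on_subset[OF _ cb]
        holomorphic_deriv B open_ball compact_cball)+
  obtain M0 M1 where "\<forall>z\<in>cball (of_real \<phi>0) (\<rho> / 2). cmod (B z) \<le> M0"
    "\<forall>z\<in>cball (of_real \<phi>0) (\<rho> / 2). cmod (deriv B z) \<le> M1"
    using cp[THEN compact_imp_bounded] unfolding bounded_iff by blast
  then have M: "\<And>z. z \<in> cball (of_real \<phi>0) (\<rho> / 2) \<Longrightarrow> cmod (B z) \<le> M0"
    "\<And>z. z \<in> cball (of_real \<phi>0) (\<rho> / 2) \<Longrightarrow> cmod (deriv B z) \<le> M1"
    by blast+
  have cball0: "complex_of_real \<phi>0 \<in> cball (of_real \<phi>0) (\<rho> / 2)" using \<rho> by simp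
  have M0: "0 \<le> M0" "0 \<le> M1" using order_trans[OF norm_ge_zero M(1)[OF cball0]]
      order_trans[OF norm_ge_zero M(2)[OF cball0]] by simp_all
  \<comment> \<open>\<open>pi\<close> bounds the length of every subinterval, so \<open>C\<close>
    does not depend on it.\<close>
  define C where "C = corput_const m * \<mu> powr (- 1 / real m) * (M0 + M1 * pi)"
  show ?thesis
  proof (rule exI[of _ "min d1 (\<rho> / 2)"], rule conjI, use d1 \<rho> in simp, rule exI[of _ C], rule conjI)
    show "0 \<le> C" unfolding C_def using corput_const_pos[of m] M0 by simp
    show "\<forall>c c' t L.
      - pi \<le> c \<and> c \<le> \<phi>0 \<and> \<phi>0 \<le> c' \<and> c' \<le> 0 \<and> c' - c < min d1 (\<rho> / 2) \<and> 0 < t \<longrightarrow>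
      (\<lambda>\<phi>. exp (\<i> * of_real (L * \<phi> - t * phase j \<phi>)) * A \<phi>) integrable_on {c..c'} \<and>
      cmod (integral {c..c'} (\<lambda>\<phi>. exp (\<i> * of_real (L * \<phi> - t * phase j \<phi>)) * A \<phi>))
        \<le> C * t powr (- 1 / real m)"
    proof (rule allI, rule allI, rule allI, rule allI, rule impI)
      fix c c' t L :: real
      assume "- pi \<le> c \<and> c \<le> \<phi>0 \<and> \<phi>0 \<le> c' \<and> c' \<le> 0 \<and> c' - c < min d1 (\<rho> / 2) \<and> 0 < t"
      then have c: "- pi \<le> c" "c \<le> \<phi>0" "\<phi>0 \<le> c'" "c' \<le> 0" "c' - c < min d1 (\<rho> / 2)" and t: "0 < t"
        by blast+
      have near: "\<phi> \<in> {-pi..0}" "\<bar>\<phi> - \<phi>0\<bar> < d1" "\<bar>\<phi> - \<phi>0\<bar> < \<rho> / 2" if "\<phi> \<in> {c..c'}" for \<phi>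
      proof -
        have "\<bar>\<phi> - \<phi>0\<bar> \<le> c' - c" using c that by (auto simp: abs_le_iff)
        then show "\<phi> \<in> {-pi..0}" "\<bar>\<phi> - \<phi>0\<bar> < d1" "\<bar>\<phi> - \<phi>0\<bar> < \<rho> / 2" using c that by auto
      qed
      have cb\<phi>: "complex_of_real \<phi> \<in> cball (of_real \<phi>0) (\<rho> / 2)" if "\<phi> \<in> {c..c'}" for \<phi>
        using near(3)[OF that] by (simp add: dist_norm abs_minus_commute flip: of_real_diff)
      have dB: "((\<lambda>x. B (of_real x)) has_vector_derivative deriv B (of_real \<phi>)) (at \<phi> within {c..c'})"
        if "\<phi> \<in> {c..c'}" for \<phi>
        by (rule has_vector_derivative_real_field)
          (use holomorphic_derivI[OF B open_ball] cb\<phi>[OF that] cb in blast)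
      define hB where "hB \<phi> = exp (\<i> * of_real (L * \<phi> - t * phase j \<phi>)) * B (of_real \<phi>)" for \<phi>
      define hA where "hA \<phi> = exp (\<i> * of_real (L * \<phi> - t * phase j \<phi>)) * A \<phi>" for \<phi>
      have contB: "continuous_on {c..c'} (\<lambda>x. B (of_real x))"
        using dB by (meson continuous_on_vector_derivative)
      have intB: "hB integrable_on {c..c'}"
        unfolding hB_def by (intro integrable_continuous_interval continuous_intros contB continuous_phase[OF j])
      \<comment> \<open>\<open>A\<close> and the extension \<open>B\<close> may differ at these
        three points, a null set.\<close>
      have AB: "hA \<phi> = hB \<phi>" if "\<phi> \<in> {c..c'} - {\<phi>0, - pi, 0}" for \<phi>
        using BA[of \<phi>] near[of \<phi>] that \<rho> by (auto simp: hA_def hB_def)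
      have intA: "hA integrable_on {c..c'}"
        by (rule integrable_spike[OF intB, of "{\<phi>0, - pi, 0}"]) (use AB in auto)
      have eq: "integral {c..c'} hA = integral {c..c'} hB"
        by (rule integral_spike[of "{\<phi>0, - pi, 0}"]) (use AB in auto)
      have "cmod (integral {c..c'} (\<lambda>x. exp (\<i> * of_real (L * x - t * phase_deriv j 0 x)) * B (of_real x)))
          \<le> corput_const m * (t * \<mu>) powr (- 1 / real m) * (M0 + M1 * (c' - c))"
      proof (rule oscillatory_integral_bound[where \<sigma> = \<sigma> and A' = "\<lambda>x. deriv B (of_real x)"])
        show "(phase_deriv j i has_real_derivative phase_deriv j (Suc i) x) (at x within {c..c'})" if "x \<in> {c..c'}" for i x
          by (rule has_field_derivative_subset[OF phase_deriv_DERIV[OF j]]) (use near(1)[OF that] c in auto)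
        show "\<mu> \<le> \<sigma> * phase_deriv j m x" if "x \<in> {c..c'}" for x
          by (rule ge[OF near(1,2)[OF that]])
        show "cmod (B (of_real x)) \<le> M0" "cmod (deriv B (of_real x)) \<le> M1" if "x \<in> {c..c'}" for x
          using M cb\<phi>[OF that] by blast+
      qed (use c \<mu> t m \<sigma> dB in auto)
      also have "\<dots> \<le> corput_const m * (t * \<mu>) powr (- 1 / real m) * (M0 + M1 * pi)"
        using corput_const_pos[of m] M0 c by (intro mult_left_mono add_left_mono) auto
      also have "\<dots> = C * t powr (- 1 / real m)"
        using t \<mu> by (simp add: C_def powr_mult)
      finally show "(\<lambda>\<phi>. exp (\<i> * of_real (L * \<phi> - t * phase j \<phi>)) * A \<phi>) integrable_on {c..c'} \<and>
        cmod (integral {c..c'} (\<lambda>\<phi>. exp (\<i> * of_real (L * \<phi> - t * phase j \<phi>)) * A \<phi>))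
          \<le> C * t powr (- 1 / real m)"
        using intA eq unfolding hA_def[abs_def] hB_def[abs_def] by simp
    qed
  qed
qed

end

text \<open>Degree count for truncated series: up to order \<open>N\<close>, \<open>F\<close> is a
  polynomial of degree at most \<open>s\<close>, so its composition with \<open>p\<close> has degree
  at most \<open>s * degree p\<close>.\<close>

lemma poly_comp_fps_expansion:
  fixes f :: "complex \<Rightarrow> complex"
  assumes f: "f has_fps_expansion F" and F: "\<And>n. s < n \<Longrightarrow> n \<le> N \<Longrightarrow> fps_nth F n = 0"
  shows "\<exists>H. (\<lambda>w. poly p (f w)) has_fps_expansion H \<and>
    (\<forall>n. s * degree p < n \<longrightarrow> n \<le> N \<longrightarrow> fps_nth H n = 0)"
proof (induction p rule: pCons_induct)
  case 0
  show ?case by (rule exI[of _ 0]) auto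
next
  case (pCons c p)
  show ?case
  proof (cases "p = 0")
    case True
    then show ?thesis by (intro exI[of _ "fps_const c"]) auto
  next
    case False
    obtain H where H: "(\<lambda>w. poly p (f w)) has_fps_expansion H"
    "\<And>n. s * degree p < n \<Longrightarrow> n \<le> N \<Longrightarrow> fps_nth H n = 0" using pCons.IH by blast
    have "(\<lambda>w. poly (pCons c p) (f w)) has_fps_expansion fps_const c + F * H"
      using f H(1) by (auto intro!: fps_expansion_intros)
    moreover have "fps_nth (fps_const c + F * H) n = 0" if n: "s * degree (pCons c p) < n" "n \<le> N" for n
    proof -
      have deg: "degree (pCons c p) = Suc (degree p)" using False by simp
      have "fps_nth F i * fps_nth H (n - i) = 0" if "i \<le> n" for i
      proof (cases "s < i")
        case True
        then show ?thesis using F[of i] that n by simp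
      next
        case False
        then have "s * degree p < n - i" using n deg by simp
        then show ?thesis using H(2)[of "n - i"] n by simp
      qed
      then have "fps_nth (F * H) n = 0" unfolding fps_mult_nth by (intro sum.neutral) auto
      then show ?thesis using n by (cases n) auto
    qed
    ultimately show ?thesis by blast
  qed
qed

lemma cos_shift_fps:
  fixes c :: complex
  shows "(\<lambda>w. 2 * cos (c + w)) has_fps_expansion
    fps_const (2 * cos c) * fps_cos 1 - fps_const (2 * sin c) * fps_sin 1"
proof -
  have "(\<lambda>w. (2 * cos c) * cos (1 * w) - (2 * sin c) * sin (1 * w)) has_fps_expansion
    fps_const (2 * cos c) * fps_cos 1 - fps_const (2 * sin c) * fps_sin 1"
    by (intro fps_expansion_intros)
  moreover have "(\<lambda>w. (2 * cos c) * cos (1 * w) - (2 * sin c) * sin (1 * w)) = (\<lambda>w. 2 * cos (c + w))"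
    by (simp add: cos_add algebra_simps)
  ultimately show ?thesis by simp
qed

lemma finite_uniform_bound:
  assumes "finite I" "\<And>i. i \<in> I \<Longrightarrow> \<exists>C\<ge>0. Q i C" "\<And>i C C'. Q i C \<Longrightarrow> C \<le> C' \<Longrightarrow> Q i C'"
  obtains C :: real where "0 \<le> C" "\<And>i. i \<in> I \<Longrightarrow> Q i C"
proof -
  obtain f where f: "\<And>i. i \<in> I \<Longrightarrow> 0 \<le> f i \<and> Q i (f i)" using assms(2) by metis
  show ?thesis
  proof (rule that[of "sum f I"])
    show "0 \<le> sum f I" using f by (intro sum_nonneg) auto
    show "Q i (sum f I)" if "i \<in> I" for i
      using assms(3)[of i "f i"] f that member_le_sum[of i I f] assms(1) by auto
  qed
qed

section \<open>From local to uniform estimates\<close>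

context periodic_coeffs
begin

text \<open>Bisection of \<open>{-pi..0}\<close> takes the place of a finite subcover: the estimate
  passes to the union of adjacent intervals, with constants adding up. For \<open>t \<ge> 1\<close>
  every order \<open>m \<le> M\<close> yields at least the rate of \<open>M\<close>.\<close>

lemma oscillatory_bound:
  fixes A :: "real \<Rightarrow> complex"
  assumes j: "j < q" and nz: "\<And>\<phi>. \<phi> \<in> {-pi..0} \<Longrightarrow> \<exists>m. 2 \<le> m \<and> m \<le> M \<and> phase_deriv j m \<phi> \<noteq> 0"
    and ext: "\<And>\<phi>0. \<phi>0 \<in> {-pi..0} \<Longrightarrow> \<exists>\<rho> B. 0 < \<rho> \<and> B holomorphic_on ball (of_real \<phi>0) \<rho> \<and>
      (\<forall>\<phi>. \<phi> \<in> {-pi<..<0} \<longrightarrow> \<phi> \<noteq> \<phi>0 \<longrightarrow> \<bar>\<phi> - \<phi>0\<bar> < \<rho> \<longrightarrow> B (of_real \<phi>) = A \<phi>)"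
  shows "\<exists>C\<ge>0. \<forall>t\<ge>1. \<forall>L.
    (\<lambda>\<phi>. exp (\<i> * of_real (L * \<phi> - t * phase j \<phi>)) * A \<phi>) integrable_on {-pi..0} \<and>
    cmod (integral {-pi..0} (\<lambda>\<phi>. exp (\<i> * of_real (L * \<phi> - t * phase j \<phi>)) * A \<phi>))
      \<le> C * t powr (- 1 / real M)"
proof -
  define h where "h t L \<phi> = exp (\<i> * of_real (L * \<phi> - t * phase j \<phi>)) * A \<phi>" for t L \<phi>
  define G where "G c d \<longleftrightarrow> (c \<in> {-pi..0} \<longrightarrow> d \<in> {-pi..0} \<longrightarrow> c \<le> d \<longrightarrow> (\<exists>C\<ge>0. \<forall>t\<ge>1. \<forall>L.
      h t L integrable_on {c..d} \<and> cmod (integral {c..d} (h t L)) \<le> C * t powr (- 1 / real M)))" for c d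
  have "G (- pi) 0"
  proof (rule Bolzano)
    fix a b c assume G: "G a b" "G b c" and abc: "a \<le> b" "b \<le> c"
    show "G a c"
      unfolding G_def
    proof (intro impI)
      assume ac: "a \<in> {-pi..0}" "c \<in> {-pi..0}"
      obtain C1 where C1: "0 \<le> C1" "\<forall>t\<ge>1. \<forall>L. h t L integrable_on {a..b} \<and>
          cmod (integral {a..b} (h t L)) \<le> C1 * t powr (- 1 / real M)"
        using G(1) ac abc unfolding G_def by auto
      obtain C2 where C2: "0 \<le> C2" "\<forall>t\<ge>1. \<forall>L. h t L integrable_on {b..c} \<and>
          cmod (integral {b..c} (h t L)) \<le> C2 * t powr (- 1 / real M)"
        using G(2) ac abc unfolding G_def by auto
      show "\<exists>C\<ge>0. \<forall>t\<ge>1. \<forall>L. h t L integrable_on {a..c} \<and>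
          cmod (integral {a..c} (h t L)) \<le> C * t powr (- 1 / real M)"
      proof (intro exI[of _ "C1 + C2"] conjI allI impI)
        fix t L :: real assume t: "1 \<le> t"
        have i1: "h t L integrable_on {a..b}" and i2: "h t L integrable_on {b..c}"
          using C1 C2 t by blast+
        show i: "h t L integrable_on {a..c}"
          by (rule Henstock_Kurzweil_Integration.integrable_combine[OF abc i1 i2])
        have "integral {a..c} (h t L) = integral {a..b} (h t L) + integral {b..c} (h t L)"
          using Henstock_Kurzweil_Integration.integral_combine[OF abc i] by simp
        then have "cmod (integral {a..c} (h t L)) \<le> cmod (integral {a..b} (h t L)) + cmod (integral {b..c} (h t L))"
          by (simp add: norm_triangle_ineq)
        also have "\<dots> \<le> C1 * t powr (- 1 / real M) + C2 * t powr (- 1 / real M)"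
          using C1 C2 t by (intro add_mono) blast+
        finally show "cmod (integral {a..c} (h t L)) \<le> (C1 + C2) * t powr (- 1 / real M)"
          by (simp add: distrib_right)
      qed (use C1 C2 in auto)
    qed
  next
    fix \<phi>0 assume "- pi \<le> \<phi>0" "\<phi>0 \<le> 0"
    then have \<phi>0: "\<phi>0 \<in> {-pi..0}" by simp
    obtain m where m: "2 \<le> m" "m \<le> M" "phase_deriv j m \<phi>0 \<noteq> 0" using nz[OF \<phi>0] by auto
    obtain \<rho> B where \<rho>: "0 < \<rho>" "B holomorphic_on ball (of_real \<phi>0) \<rho>"
      "\<And>\<phi>. \<phi> \<in> {-pi<..<0} \<Longrightarrow> \<phi> \<noteq> \<phi>0 \<Longrightarrow> \<bar>\<phi> - \<phi>0\<bar> < \<rho> \<Longrightarrow> B (of_real \<phi>) = A \<phi>"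
      using ext[OF \<phi>0] by blast
    have h: "h = (\<lambda>t L \<phi>. exp (\<i> * of_real (L * \<phi> - t * phase j \<phi>)) * A \<phi>)"
      by (simp add: h_def fun_eq_iff)
    obtain d C where d: "0 < d" "0 \<le> C"
      and dC: "\<forall>c c' t L. - pi \<le> c \<and> c \<le> \<phi>0 \<and> \<phi>0 \<le> c' \<and> c' \<le> 0 \<and> c' - c < d \<and> 0 < t \<longrightarrow>
        h t L integrable_on {c..c'} \<and> cmod (integral {c..c'} (h t L)) \<le> C * t powr (- 1 / real m)"
      using local_oscillatory_bound[OF j \<phi>0 m(1,3) \<rho>] unfolding h by blast
    have "G a b" if ab: "a \<le> \<phi>0 \<and> \<phi>0 \<le> b \<and> b - a < d" for a b
      unfolding G_def
    proof (intro impI exI[of _ C] conjI allI)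
      fix t L :: real assume S: "a \<in> {-pi..0}" "b \<in> {-pi..0}" and t: "1 \<le> t"
      have *: "h t L integrable_on {a..b} \<and> cmod (integral {a..b} (h t L)) \<le> C * t powr (- 1 / real m)"
        by (rule dC[rule_format]) (use ab S t in auto)
      then show "h t L integrable_on {a..b}" by simp
      have "t powr (- 1 / real m) \<le> t powr (- 1 / real M)"
        by (rule powr_mono) (use m t in \<open>auto simp: frac_le\<close>)
      then have "C * t powr (- 1 / real m) \<le> C * t powr (- 1 / real M)"
        using d(2) by (rule mult_left_mono)
      then show "cmod (integral {a..b} (h t L)) \<le> C * t powr (- 1 / real M)" using * by simp
    qed (use d in auto)
    then show "\<exists>d>0. \<forall>a b. a \<le> \<phi>0 \<and> \<phi>0 \<le> b \<and> b - a < d \<longrightarrow> G a b" using d(1) by blast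
  qed simp
  then show ?thesis unfolding G_def h_def by simp
qed

lemma amp_uniform_bound:
  assumes nz: "\<And>j \<phi>. j < q \<Longrightarrow> \<phi> \<in> {-pi..0} \<Longrightarrow> \<exists>m. 2 \<le> m \<and> m \<le> M \<and> phase_deriv j m \<phi> \<noteq> 0"
  shows "\<exists>C\<ge>0. \<forall>j<q. \<forall>r<q. \<forall>r'<q. \<forall>e\<in>{1, -1}. \<forall>e'\<in>{1, -1}. \<forall>t\<ge>1. \<forall>L.
    (\<lambda>\<phi>. exp (\<i> * of_real (L * \<phi> - t * phase j \<phi>)) * amp j r e r' e' \<phi>) integrable_on {-pi..0} \<and>
    cmod (integral {-pi..0} (\<lambda>\<phi>. exp (\<i> * of_real (L * \<phi> - t * phase j \<phi>)) * amp j r e r' e' \<phi>))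
      \<le> C * t powr (- 1 / real M)"
proof -
  define Q where "Q i C \<longleftrightarrow> (case i of (j, r, r', e, e') \<Rightarrow> \<forall>t\<ge>1. \<forall>L.
      (\<lambda>\<phi>. exp (\<i> * of_real (L * \<phi> - t * phase j \<phi>)) * amp j r e r' e' \<phi>) integrable_on {-pi..0} \<and>
      cmod (integral {-pi..0} (\<lambda>\<phi>. exp (\<i> * of_real (L * \<phi> - t * phase j \<phi>)) * amp j r e r' e' \<phi>))
        \<le> C * t powr (- 1 / real M))" for i C
  obtain C where C: "0 \<le> C"
    "\<And>i. i \<in> {..<q} \<times> {..<q} \<times> {..<q} \<times> {1, -1} \<times> {1, -1} \<Longrightarrow> Q i C"
  proof (rule finite_uniform_bound[of "{..<q} \<times> {..<q} \<times> {..<q} \<times> {1, -1} \<times> {1, -1}" Q])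
    fix i :: "nat \<times> nat \<times> nat \<times> real \<times> real"
    assume i: "i \<in> {..<q} \<times> {..<q} \<times> {..<q} \<times> {1, -1} \<times> {1, -1}"
    obtain j r r' e e' where [simp]: "i = (j, r, r', e, e')" by (metis surj_pair)
    have b: "j < q" "r < q" "r' < q" "\<bar>e\<bar> = 1" "\<bar>e'\<bar> = 1" using i by auto
    have "\<exists>\<rho> B. 0 < \<rho> \<and> B holomorphic_on ball (of_real \<phi>0) \<rho> \<and>
      (\<forall>\<phi>. \<phi> \<in> {-pi<..<0} \<longrightarrow> \<phi> \<noteq> \<phi>0 \<longrightarrow> \<bar>\<phi> - \<phi>0\<bar> < \<rho> \<longrightarrow> B (of_real \<phi>) = amp j r e r' e' \<phi>)"
      if "\<phi>0 \<in> {-pi..0}" for \<phi>0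
      using amp_extension[OF b(1) that b(4,5,2,3)] by metis
    from oscillatory_bound[OF b(1) nz[OF b(1)] this]
    show "\<exists>C\<ge>0. Q i C" by (simp add: Q_def)
  next
    fix i C C' assume Q: "Q i C" and le: "C \<le> (C' :: real)"
    have "C * t powr (- 1 / real M) \<le> C' * t powr (- 1 / real M)" for t
      by (rule mult_right_mono[OF le]) simp
    then show "Q i C'" using Q unfolding Q_def by (auto split: prod.splits intro: order_trans)
  qed auto
  then show ?thesis by (intro exI[of _ C]) (auto simp: Q_def)
qed

text \<open>Both halves of the theorem are instances, with different bounds \<open>M\<close> for the
  orders of nonvanishing derivatives.\<close>

lemma dispersive_estimate:
  assumes nz: "\<And>j \<phi>. j < q \<Longrightarrow> \<phi> \<in> {-pi..0} \<Longrightarrow> \<exists>m. 2 \<le> m \<and> m \<le> M \<and> phase_deriv j m \<phi> \<noteq> 0"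
  shows "\<exists>C::real. C > 0 \<and> (\<forall>t::real. t > 0 \<longrightarrow> (\<forall>u\<in>ell1.
    ellinf_norm (exp_op (- \<i> * of_real t) J (cont_proj J u)) \<le> ereal (C * t powr (- 1 / real M) * ell1_norm u)))"
proof -
  obtain C where C0: "0 \<le> C" and C: "\<forall>j<q. \<forall>r<q. \<forall>r'<q. \<forall>e\<in>{1, -1}. \<forall>e'\<in>{1, -1}. \<forall>t\<ge>1. \<forall>L.
    (\<lambda>\<phi>. exp (\<i> * of_real (L * \<phi> - t * phase j \<phi>)) * amp j r e r' e' \<phi>) integrable_on {-pi..0} \<and>
    cmod (integral {-pi..0} (\<lambda>\<phi>. exp (\<i> * of_real (L * \<phi> - t * phase j \<phi>)) * amp j r e r' e' \<phi>))
      \<le> C * t powr (- 1 / real M)"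
    using amp_uniform_bound[OF nz] by blast
  \<comment> \<open>\<open>2 * q\<close> is the trivial bound used for \<open>t < 1\<close>;
    \<open>q * C\<close> is the sum over the bands used for \<open>t \<ge> 1\<close>, where
    \<open>2 / pi \<le> 1\<close>.\<close>
  define C1 where "C1 = 2 * real q + q * C"
  have M2: "2 \<le> M" using nz[of 0 0] q_pos by fastforce
  have kb: "cmod (spectral_kernel (\<lambda>x. exp (- \<i> * of_real t * of_real x)) n m) \<le> C1 * t powr (- 1 / real M)"
    if t: "0 < t" for t n m
  proof (cases "t < 1")
    case True
    obtain R where R: "0 < R" "\<And>j \<phi>. j < q \<Longrightarrow> \<bar>phase j \<phi>\<bar> \<le> R" using phase_bounded by metis
    have "cmod (spectral_kernel (\<lambda>x. exp (- \<i> * of_real t * of_real x)) n m) \<le> 2 * real q * 1"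
      by (rule kernel_bound[OF _ _ R(2)]) (auto intro!: continuous_intros simp: norm_exp_eq_Re)
    also have "\<dots> \<le> C1 * 1" using C0 by (simp add: C1_def)
    also have "\<dots> \<le> C1 * t powr (- 1 / real M)"
    proof (rule mult_left_mono)
      have "t powr 0 \<le> t powr (- 1 / real M)"
        by (rule powr_mono') (use True t M2 in auto)
      then show "1 \<le> t powr (- 1 / real M)" using t by simp
    qed (use C0 in \<open>simp add: C1_def\<close>)
    finally show ?thesis .
  next
    case False
    then have t1: "1 \<le> t" by simp
    define l r l' r' where "l = n div q" and "r = n mod q" and "l' = m div q" and "r' = m mod q"
    have r: "r < q" "r' < q" using q_pos by (simp_all add: r_def r'_def)
    have nm: "n = l * q + r" "m = l' * q + r'" by (simp_all add: l_def r_def l'_def r'_def)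
    have "cmod (integral {-pi..0} (\<lambda>\<phi>. exp (- \<i> * of_real t * of_real (phase j \<phi>)) * of_real (spectral_density j n m \<phi>)))
        \<le> C * t powr (- 1 / real M)" if j: "j < q" for j
    proof -
      define h where "h e e' \<phi> = exp (\<i> * of_real ((e * l + e' * l') * \<phi> - t * phase j \<phi>)) * amp j r e r' e' \<phi>" for e e' \<phi> :: real
      define s where "s \<phi> = - (1 / 4) * (\<Sum>e\<in>{1, -1}. \<Sum>e'\<in>{1, -1}. of_real (e * e') * h e e' \<phi>)" for \<phi>
      have hC: "h e e' integrable_on {-pi..0}" "cmod (integral {-pi..0} (h e e')) \<le> C * t powr (- 1 / real M)"
        if "e \<in> {1, -1}" "e' \<in> {1, -1}" for e e'
        using C[rule_format, OF j r that t1, of "e * l + e' * l'"] unfolding h_def by auto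
      have "integral {-pi..0} (\<lambda>\<phi>. exp (- \<i> * of_real t * of_real (phase j \<phi>)) * of_real (spectral_density j n m \<phi>))
          = integral {-pi..0} s"
      proof (rule integral_spike[of "{-pi, 0}"])
        fix \<phi> assume "\<phi> \<in> {-pi..0} - {-pi, 0}"
        then have \<phi>: "\<phi> \<in> {-pi<..<0}" by auto
        have e: "exp (- \<i> * of_real t * of_real (phase j \<phi>)) * exp (\<i> * of_real (L * \<phi>))
            = exp (\<i> * of_real (L * \<phi> - t * phase j \<phi>))" for L
          unfolding exp_add[symmetric] by (simp add: algebra_simps)
        show "s \<phi> = exp (- \<i> * of_real t * of_real (phase j \<phi>)) * of_real (spectral_density j n m \<phi>)"
          unfolding nm density_eq_amp[OF j \<phi>] s_def h_def e[symmetric]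
          by (simp add: algebra_simps)
      qed simp
      also have "\<dots> = - (1 / 4) * (\<Sum>e\<in>{1, -1}. \<Sum>e'\<in>{1, -1}. of_real (e * e') * integral {-pi..0} (h e e'))"
        unfolding s_def[abs_def]
        by (intro integral_unique has_integral_mult_right has_integral_sum integrable_integral hC) auto
      also have "cmod \<dots> \<le> 1 / 4 * (\<Sum>e\<in>{1, -1::real}. \<Sum>e'\<in>{1, -1::real}. C * t powr (- 1 / real M))"
        unfolding norm_mult
        by (intro mult_mono sum_norm_le) (use hC in \<open>auto simp: norm_mult intro!: sum_nonneg C0\<close>)
      also have "\<dots> = C * t powr (- 1 / real M)" by simp
      finally show ?thesis .
    qed
    then have "cmod (\<Sum>j<q. integral {-pi..0} (\<lambda>\<phi>. exp (- \<i> * of_real t * of_real (phase j \<phi>)) * of_real (spectral_density j n m \<phi>)))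
        \<le> real q * (C * t powr (- 1 / real M))"
      by (intro order_trans[OF sum_norm_le[of "{..<q}" _ "\<lambda>_. C * t powr (- 1 / real M)"]]) auto
    then have "cmod (spectral_kernel (\<lambda>x. exp (- \<i> * of_real t * of_real x)) n m) \<le> 2 / pi * (real q * (C * t powr (- 1 / real M)))"
      unfolding spectral_kernel_def norm_mult by (intro mult_mono) (auto simp: norm_divide)
    also have "\<dots> \<le> 1 * (real q * (C * t powr (- 1 / real M)))"
      by (rule mult_right_mono) (use pi_ge_two C0 in auto)
    also have "\<dots> \<le> C1 * t powr (- 1 / real M)" by (simp add: C1_def distrib_right)
    finally show ?thesis .
  qed
  have "0 < C1" using C0 q_pos by (simp add: C1_def add_pos_nonneg)
  then show ?thesis
    using exp_op_bound[OF _ kb] by (intro exI[of _ C1]) auto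
qed

section \<open>Nondegenerate phases for even periods with open gaps\<close>

lemma D_phase_deriv:
  assumes j: "j < q" and \<phi>: "\<phi> \<in> {-pi..0}"
  shows "D' (phase j \<phi>) * phase_deriv j 1 \<phi> = - 2 * sin \<phi>"
proof (rule vector_derivative_unique_within_closed_interval[of "- pi" 0 \<phi>])
  have "(phase j has_real_derivative phase_deriv j 1 \<phi>) (at \<phi> within {-pi..0})"
    using phase_deriv_DERIV[OF j \<phi>, of 0] by simp
  from DERIV_chain2[OF D_deriv this]
  show "((\<lambda>\<phi>. D (phase j \<phi>)) has_vector_derivative D' (phase j \<phi>) * phase_deriv j 1 \<phi>) (at \<phi> within cbox (- pi) 0)"
    by (simp add: has_real_derivative_iff_has_vector_derivative)
  have "((\<lambda>\<phi>. 2 * cos \<phi>) has_real_derivative - 2 * sin \<phi>) (at \<phi> within {-pi..0})"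
    by (auto intro!: derivative_eq_intros)
  then show "((\<lambda>\<phi>. D (phase j \<phi>)) has_vector_derivative - 2 * sin \<phi>) (at \<phi> within cbox (- pi) 0)"
    by (simp add: D_phase[OF j] has_real_derivative_iff_has_vector_derivative)
qed (use \<phi> in auto)

text \<open>If the derivatives of orders \<open>2, \<dots>, q + 1\<close> of the phase vanish at \<open>\<phi>\<close>, then \<open>D\<close> composed with
  the phase agrees to order \<open>q + 1\<close> with a polynomial of degree \<open>q\<close>, whereas the coefficient of order
  \<open>q + 1\<close> of \<open>2 cos\<close> is a nonzero multiple of \<open>sin \<phi>\<close> for even \<open>q\<close>.\<close>

lemma phase_not_flat:
  assumes j: "j < q" and \<phi>: "\<phi> \<in> {-pi..0}" and q: "2 \<le> q" "even q"
    and open_gap: "sin \<phi> = 0 \<Longrightarrow> D' (phase j \<phi>) \<noteq> 0"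
  shows "\<exists>m. 2 \<le> m \<and> m \<le> q + 1 \<and> phase_deriv j m \<phi> \<noteq> 0"
proof (rule ccontr)
  assume "\<not> ?thesis"
  then have flat: "phase_deriv j m \<phi> = 0" if "2 \<le> m" "m \<le> q + 1" for m using that by blast
  obtain r K where r: "0 < r" and K: "K holomorphic_on ball (of_real \<phi>) r"
    "\<And>z. z \<in> ball (of_real \<phi>) r \<Longrightarrow> D (K z) = 2 * cos z"
    "\<And>\<phi>'. \<phi>' \<in> {-pi..0} \<Longrightarrow> \<bar>\<phi>' - \<phi>\<bar> < r \<Longrightarrow> K (of_real \<phi>') = of_real (phase j \<phi>')"
    using local_extension[OF j \<phi>] by metis
  define k where "k w = K (of_real \<phi> + w)" for w
  have "k holomorphic_on ball 0 r"
    unfolding k_def[abs_def]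
    by (rule holomorphic_on_compose_gen[OF _ K(1), unfolded o_def])
      (auto intro!: holomorphic_intros simp: dist_norm)
  then have kF: "k has_fps_expansion fps_expansion k 0"
    using r by (intro has_fps_expansion_fps_expansion[of "ball 0 r"]) auto
  define F where "F = fps_expansion k 0"
  note kF = kF[folded F_def]
  have Fn: "fps_nth F n = of_real (phase_deriv j n \<phi>) / fact n" for n
  proof -
    have "fps_nth F n = (deriv ^^ n) k 0 / fact n" by (rule fps_nth_fps_expansion[OF kF])
    also have "(deriv ^^ n) k 0 = (deriv ^^ n) K (of_real \<phi>)"
      by (simp add: higher_deriv_shift_0[of n K "of_real \<phi>"] k_def[abs_def] o_def)
    also have "\<dots> = of_real (phase_deriv j n \<phi>)"
      by (rule deriv_extension_real(1)[OF r K(1,3)]) (use \<phi> r in auto)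
    finally show ?thesis .
  qed
  define G where "G = fps_const (2 * cos (complex_of_real \<phi>)) * fps_cos 1 - fps_const (2 * sin (of_real \<phi>)) * fps_sin 1"
  have G: "(\<lambda>w. 2 * cos (of_real \<phi> + w)) has_fps_expansion G"
    unfolding G_def by (rule cos_shift_fps)
  have HG: "H = G" if "(\<lambda>w. D (k w)) has_fps_expansion H" for H
  proof (rule fps_expansion_unique_complex)
    have ev: "\<forall>\<^sub>F w in nhds 0. D (k w) = 2 * cos (of_real \<phi> + w)"
      using eventually_nhds_in_open[of "ball 0 r" 0] r
      by (auto elim!: eventually_mono simp: k_def K(2) dist_norm)
    show "(\<lambda>w. 2 * cos (of_real \<phi> + w)) has_fps_expansion H"
      using iffD1[OF has_fps_expansion_cong[OF ev refl] that] .
  qed (rule G)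
  have coef: "fps_nth G n = 0" if z: "\<And>n. s < n \<Longrightarrow> n \<le> N \<Longrightarrow> fps_nth F n = 0" and n: "s * q < n" "n \<le> N" for s N n
  proof -
    obtain H where "(\<lambda>w. D (k w)) has_fps_expansion H" "\<forall>n. s * q < n \<longrightarrow> n \<le> N \<longrightarrow> fps_nth H n = 0"
      using poly_comp_fps_expansion[OF kF z, of s N D_poly] by (auto simp: degree_D)
    then show ?thesis using HG n by blast
  qed
  have "fps_nth G (q + 1) = 0"
    by (rule coef[of 1 "q + 1"]) (auto simp: Fn flat)
  moreover have "fps_nth G (q + 1) = - 2 * sin (of_real \<phi>) * ((- 1) ^ (q div 2) / fact (q + 1))"
    using q by (simp add: G_def fps_cos_def fps_sin_def del: fact_Suc)
  ultimately have "sin (complex_of_real \<phi>) = 0" by (simp del: fact_Suc)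
  then have sin0: "sin \<phi> = 0" by (simp add: sin_of_real)
  \<comment> \<open>What remains is a band edge. There the first derivative vanishes too, so
    \<open>F\<close> is constant up to order two, whereas the second coefficient of the cosine at
    \<open>\<phi>\<close> is not 0.\<close>
  have "phase_deriv j 1 \<phi> = 0" using D_phase_deriv[OF j \<phi>] open_gap[OF sin0] sin0 by simp
  then have "fps_nth G 2 = 0"
    using flat q by (intro coef[of 0 2]) (auto simp: Fn le_Suc_eq numeral_2_eq_2)
  moreover have "fps_nth G 2 = - cos (of_real \<phi>)"
    by (simp add: G_def fps_cos_def fps_sin_def)
  ultimately have "cos (complex_of_real \<phi>) = 0" by simp
  then have "cos \<phi> = 0" by (simp add: cos_of_real)
  then show False using sin0 sin_cos_squared_add[of \<phi>] by simp
qed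

text \<open>At an edge with \<open>D' = 0\<close> the modulus of \<open>D\<close> has a strict local
  maximum, so it is below 2 just outside the band as well. Such points belong to another band, but
  the other bands are closed and miss \<open>x0\<close>.\<close>

lemma disjoint_bands_open_gaps:
  assumes disj: "disjoint_family_on (band a b q) {..<q}" and j: "j < q" and x0: "x0 \<in> band a b q j" and D2: "\<bar>D x0\<bar> = 2"
  shows "D' x0 \<noteq> 0"
proof
  assume z: "D' x0 = 0"
  define \<sigma> where "\<sigma> = D x0 / 2"
  have \<sigma>: "\<sigma> = 1 \<or> \<sigma> = - 1" using D2 by (auto simp: \<sigma>_def)
  have "x0 = lower j \<or> x0 = upper j"
    using D2 band_facts(5)[OF j, of x0] x0 by (force simp: band_eq)
  \<comment> \<open>\<open>s\<close> points from \<open>x0\<close> into the band, so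
    \<open>x0 - s * h\<close> with \<open>h > 0\<close> lies outside.\<close>
  then obtain s :: real where s: "s = 1 \<or> s = - 1" "\<And>x. x \<in> band a b q j \<Longrightarrow> 0 \<le> s * (x - x0)"
  proof
    assume "x0 = lower j"
    then show ?thesis using that[of 1] by (simp add: band_eq)
  next
    assume "x0 = upper j"
    then show ?thesis using that[of "- 1"] by (simp add: band_eq)
  qed
  define g g' where "g h = \<sigma> * D (x0 - s * h)" and "g' h = - \<sigma> * s * D' (x0 - s * h)" for h
  have dg: "(g has_real_derivative g' h) (at h)" for h
    unfolding g_def g'_def
    by (rule derivative_eq_intros DERIV_chain2[OF D_deriv] refl)+ simp
  have "(g' has_real_derivative \<sigma> * D'' x0) (at 0)"
  proof -
    have "(g' has_real_derivative - \<sigma> * s * (D'' (x0 - s * 0) * - s)) (at 0)"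
      unfolding g'_def by (rule derivative_eq_intros DERIV_chain2[OF poly_DERIV] refl)+ simp
    moreover have "- \<sigma> * s * (D'' (x0 - s * 0) * - s) = \<sigma> * D'' x0" using s(1) by auto
    ultimately show ?thesis by (simp only:)
  qed
  moreover have "\<sigma> * D'' x0 < 0" using D''_sign[OF D2 z] by (simp add: \<sigma>_def)
  ultimately obtain d1 where d1: "0 < d1" "\<And>h. 0 < h \<Longrightarrow> h < d1 \<Longrightarrow> g' (0 + h) < g' 0"
    using DERIV_neg_dec_right by metis
  have g0: "g 0 = 2" "g' 0 = 0" using \<sigma> z by (auto simp: g_def g'_def \<sigma>_def)
  have "isCont g 0" using dg by (rule DERIV_isCont)
  then obtain d2 where d2: "0 < d2" "\<And>h. \<bar>h\<bar> < d2 \<Longrightarrow> \<bar>g h - g 0\<bar> < 1"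
    unfolding continuous_at_eps_delta dist_real_def by (metis diff_zero zero_less_one)
  define C where "C = (\<Union>i\<in>{..<q} - {j}. band a b q i)"
  have "closed C" unfolding C_def by (intro closed_UN) (auto simp: band_eq)
  moreover have "x0 \<notin> C" using disj j x0 by (fastforce simp: C_def disjoint_family_on_def)
  ultimately obtain e where e: "0 < e" "\<And>x. \<bar>x - x0\<bar> < e \<Longrightarrow> x \<notin> C"
    unfolding closed_def open_dist dist_real_def by (metis Compl_iff)
  define h where "h = min (min d1 d2) e / 2"
  have h: "0 < h" "h < d1" "h < d2" "h < e" using d1 d2 e by (auto simp: h_def)
  define x where "x = x0 - s * h"
  have "g h < g 0"
  proof (rule DERIV_neg_imp_decreasing_open[OF h(1)])
    fix w assume "0 < w" "w < h"
    then show "\<exists>y. (g has_real_derivative y) (at w) \<and> y < 0"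
      using dg[of w] d1(2)[of w] h g0 by auto
  qed (use dg in \<open>meson DERIV_continuous_on has_field_derivative_at_within\<close>)
  moreover have "\<bar>g h - g 0\<bar> < 1" using d2(2)[of h] h by simp
  ultimately have "\<bar>g h\<bar> < 2" using g0 by auto
  then have "\<bar>D x\<bar> < 2" using \<sigma> by (auto simp: g_def x_def)
  then have "x \<in> D -` {-2..2}" by auto
  then obtain i where i: "i < q" "x \<in> band a b q i" unfolding band_facts(8) band_eq by auto
  have "x \<notin> band a b q j" using s(2)[of x] s(1) h by (auto simp: x_def)
  then have "x \<in> C" using i by (auto simp: C_def)
  moreover have "\<bar>x - x0\<bar> < e" using s(1) h by (auto simp: x_def)
  ultimately show False using e(2) by blast
qed

end

theorem theorem3p2:
  fixes a b :: "nat \<Rightarrow> real" and q :: nat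
  assumes "periodic_jacobi a b q"
  shows
    "((\<forall>j<q. \<forall>\<phi>\<in>{-pi..0}.
         (deriv_within {-pi..0} ^^ 2) (phase_fun a b q j) \<phi> = 0 \<longrightarrow>
         (deriv_within {-pi..0} ^^ 3) (phase_fun a b q j) \<phi> \<noteq> 0)
      \<longrightarrow>
      (\<exists>C::real. C > 0 \<and> (\<forall>t::real. t > 0 \<longrightarrow> (\<forall>u\<in>ell1.
         ellinf_norm (exp_op (- \<i> * of_real t) (jacobi a b) (cont_proj (jacobi a b) u))
           \<le> ereal (C * t powr (- 1 / 3) * ell1_norm u)))))
     \<and>
     (2 \<le> q \<and> even q
      \<and> cont_spectrum (jacobi a b) = complex_of_real ` (\<Union>j<q. band a b q j)
      \<and> disjoint_family_on (band a b q) {..<q}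
      \<longrightarrow>
      (\<exists>C::real. C > 0 \<and> (\<forall>t::real. t > 0 \<longrightarrow> (\<forall>u\<in>ell1.
         ellinf_norm (exp_op (- \<i> * of_real t) (jacobi a b) (cont_proj (jacobi a b) u))
           \<le> ereal (C * t powr (- 1 / (real q + 1)) * ell1_norm u)))))"
proof -
  interpret periodic_coeffs a b q
    using assms by unfold_locales (auto simp: periodic_jacobi_def is_period_def)
  show ?thesis
  proof (intro conjI impI)
    assume *: "\<forall>j<q. \<forall>\<phi>\<in>{-pi..0}. (deriv_within {-pi..0} ^^ 2) (phase_fun a b q j) \<phi> = 0 \<longrightarrow>
         (deriv_within {-pi..0} ^^ 3) (phase_fun a b q j) \<phi> \<noteq> 0"
    \<comment> \<open>The hypothesis says that a derivative of order two or three is nonzero at each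
      phase, so \<open>M = 3\<close>.\<close>
    have "\<exists>m. 2 \<le> m \<and> m \<le> 3 \<and> phase_deriv j m \<phi> \<noteq> 0" if "j < q" "\<phi> \<in> {-pi..0}" for j \<phi>
    proof (cases "phase_deriv j 2 \<phi> = 0")
      case True
      then have "phase_deriv j 3 \<phi> \<noteq> 0" using * that unfolding phase_deriv_def by blast
      then show ?thesis by (intro exI[of _ 3]) simp
    next
      case False
      then show ?thesis by (intro exI[of _ 2]) simp
    qed
    from dispersive_estimate[OF this]
    show "\<exists>C::real. C > 0 \<and> (\<forall>t::real. t > 0 \<longrightarrow> (\<forall>u\<in>ell1.
         ellinf_norm (exp_op (- \<i> * of_real t) (jacobi a b) (cont_proj (jacobi a b) u))
           \<le> ereal (C * t powr (- 1 / 3) * ell1_norm u)))" by simp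
  next
    assume *: "2 \<le> q \<and> even q \<and> cont_spectrum (jacobi a b) = complex_of_real ` (\<Union>j<q. band a b q j)
      \<and> disjoint_family_on (band a b q) {..<q}"
    have "\<exists>m. 2 \<le> m \<and> m \<le> q + 1 \<and> phase_deriv j m \<phi> \<noteq> 0" if j: "j < q" and \<phi>: "\<phi> \<in> {-pi..0}" for j \<phi>
    proof (rule phase_not_flat[OF j \<phi>])
      \<comment> \<open>The point is a band edge, where disjointness of the bands gives
        \<open>D' \<noteq> 0\<close>.\<close>
      assume "sin \<phi> = 0"
      then have "cos \<phi> = 1 \<or> cos \<phi> = - 1"
        using sin_cos_squared_add[of \<phi>] by (simp add: power2_eq_1_iff)
      then have "\<bar>cos \<phi>\<bar> = 1" by auto
      then have "\<bar>D (phase j \<phi>)\<bar> = 2" by (simp add: D_phase[OF j] abs_mult)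
      then show "D' (phase j \<phi>) \<noteq> 0"
        using disjoint_bands_open_gaps[of j "phase j \<phi>"] * j phase_in[OF j] by (simp add: band_eq)
    qed (use * in auto)
    from dispersive_estimate[OF this]
    show "\<exists>C::real. C > 0 \<and> (\<forall>t::real. t > 0 \<longrightarrow> (\<forall>u\<in>ell1.
         ellinf_norm (exp_op (- \<i> * of_real t) (jacobi a b) (cont_proj (jacobi a b) u))
           \<le> ereal (C * t powr (- 1 / (real q + 1)) * ell1_norm u)))" by (simp add: add.commute)
  qed
qed

end
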